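(* Let $H\in(1/2,1)$, let $(B^H_t)_{t\ge0}$ be a (real-valued) fractional Brownian motion with Hurst parameter $H$, and let $X^H_t:=\int_0^t f_s\,\mathrm{d}B^H_s$ for some deterministic $f\in L^2_{\theta,H}(\mathbb{R}^+)$. For $n\ge1$ and $t\ge0$ let $$\mathbb{X}^{n,H}_{0,t}:=\int_0^t\int_0^{s_n}\cdots\int_0^{s_2}\mathrm{d}X^H_{s_1}\cdots\mathrm{d}X^H_{s_{n-1}}\,\mathrm{d}X^H_{s_n}$$ be the $n$-th order iterated fractional Wiener–Itô–Skorokhod (fWIS) integral, where $\mathrm{d}X^H_s=f_s\,\mathrm{d}B^H_s$, and let $$L^{\mathbb{X},H}_{0,t}:=\limsup_{n\to\infty}\left|\left(\frac n2\right)!\;\mathbb{X}^{n,H}_{0,t}\right|^{2/n}.$$ Then almost surely $$L^{\mathbb{X},H}_{0,t}=\frac12\,\|f\|_{\theta,H,t}^2,\qquad\text{where}\quad \|f\|^2_{\theta,H,t}:=\int_0^t\int_0^t f(u)f(v)\,\theta_H(u,v)\,\mathrm{d}u\,\mathrm{d}v$$ and $\theta_H(u,v)=H(2H-1)|u-v|^{2H-2}$.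
   Context: Fractional Brownian motion with Hurst parameter $H\in(0,1)$ is a centered Gaussian process $(B^H_t)_{t\ge0}$ with a.s. continuous paths and covariance $R_H(s,t)=\mathbb{E}[B^H_sB^H_t]=\frac12(t^{2H}+s^{2H}-|t-s|^{2H})$. For $H>1/2$ let $\theta_H(s,t)=H(2H-1)|s-t|^{2H-2}$, so that $\int_0^t\int_0^s\theta_H(u,v)\,\mathrm{d}u\,\mathrm{d}v=R_H(s,t)$, and define on the Schwartz space $\mathcal{S}(\mathbb{R}^+)$ of rapidly decreasing functions the inner product $$\langle f,g\rangle_H=\int_0^\infty\int_0^\infty f(s)g(t)\theta_H(s,t)\,\mathrm{d}s\,\mathrm{d}t.$$ $L^2_{\theta,H}(\mathbb{R}^+)$ denotes the Hilbert space obtained as the completion of $\mathcal{S}(\mathbb{R}^+)$ with respect to the norm $\|\cdot\|_H$ induced by $\langle\cdot,\cdot\rangle_H$. The setting is that of white noise theory: $\Omega=\mathcal{S}'(\mathbb{R}^+)$ is the space of tempered distributions (the dual of $\mathcal{S}(\mathbb{R}^+)$) with the probability measure $\mathbb{P}$ on its Borel sets characterised (Bochner–Minlos) by $\int_\Omega\exp(i\langle\omega,g\rangle)\,\mathbb{P}(\mathrm{d}\omega)=\exp(-\frac12\|g\|_H^2)$ for $g\in\mathcal{S}(\mathbb{R}^+)$. The fractional Brownian motion is the continuous version of $t\mapsto\langle\omega,1_{[0,t]}\rangle$. For deterministic $f\in L^2_{\theta,H}(\mathbb{R}^+)$, with $f_n\in\mathcal{S}(\mathbb{R}^+)$ approximating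 $f$, the stochastic integral is $\left(\int_0^t f_s\,\mathrm{d}B^H_s\right)(\omega):=\lim_n\langle\omega,f_n1_{[0,t]}\rangle$. The fWIS integral is the standard Itô-type integral with respect to fractional Brownian motion with $H>1/2$, defined for stochastic integrands by means of Malliavin calculus, analogously to the Skorokhod integral with respect to Brownian motion. The iterated fWIS integrals are obtained by integrating successively, i.e. $\mathbb{X}^{0,H}_{0,t}=1$ and $\mathbb{X}^{n,H}_{0,t}=\int_0^t\mathbb{X}^{n-1,H}_{0,s}\,f_s\,\mathrm{d}B^H_s$. For a nonnegative integer $n$, $(n/2)!:=\Gamma(n/2+1)$. *)

theory Defs
  imports "HOL-Probability.Probability"
begin

section \<open>The kernel and the inner product\<close>

definition theta :: "real \<Rightarrow> real \<Rightarrow> real \<Rightarrow> real" where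
  "theta H s t = H * (2 * H - 1) * \<bar>s - t\<bar> powr (2 * H - 2)"

definition fbm_cov :: "real \<Rightarrow> real \<Rightarrow> real \<Rightarrow> real" where
  "fbm_cov H s t = 1/2 * (t powr (2 * H) + s powr (2 * H) - \<bar>t - s\<bar> powr (2 * H))"

definition theta_inner_on :: "real \<Rightarrow> real set \<Rightarrow> (real \<Rightarrow> real) \<Rightarrow> (real \<Rightarrow> real) \<Rightarrow> real" where
  "theta_inner_on H A f g = (LINT s:A|lborel. (LINT t:A|lborel. f s * g t * theta H s t))"

abbreviation theta_inner :: "real \<Rightarrow> (real \<Rightarrow> real) \<Rightarrow> (real \<Rightarrow> real) \<Rightarrow> real" where
  "theta_inner H \<equiv> theta_inner_on H {0..}"

definition theta_norm :: "real \<Rightarrow> (real \<Rightarrow> real) \<Rightarrow> real" where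
  "theta_norm H f = sqrt (theta_inner H f f)"

text \<open>
  The functions for which the double integral defining the inner product converges as a Lebesgue
  integral.  They contain the Schwartz functions, their restrictions to intervals, and
  indicators of bounded intervals.
\<close>

definition theta_functions :: "real \<Rightarrow> (real \<Rightarrow> real) set" where
  "theta_functions H = {f \<in> borel_measurable borel.
     (\<integral>\<^sup>+s\<in>{0..}. (\<integral>\<^sup>+t\<in>{0..}. ennreal (\<bar>f s\<bar> * \<bar>f t\<bar> * theta H s t) \<partial>lborel) \<partial>lborel) < \<infinity>}"

definition restrict_upto :: "real \<Rightarrow> (real \<Rightarrow> real) \<Rightarrow> real \<Rightarrow> real" where
  "restrict_upto t f s = indicator {0..t} s * f s"


section \<open>Schwartz functions and tempered distributions on the half line\<close>

text \<open>
  Derivatives at \<open>0\<close> are one-sided.  A function on the half line is represented by the function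
  on the real line that vanishes on the negative half axis.
\<close>

definition half_deriv :: "(real \<Rightarrow> real) \<Rightarrow> real \<Rightarrow> real" where
  "half_deriv f x = vector_derivative f (at x within {0..})"

definition schwartz :: "(real \<Rightarrow> real) set" where
  "schwartz = {f. (\<forall>x<0. f x = 0) \<and>
     (\<forall>k. \<forall>x\<ge>0. (half_deriv ^^ k) f differentiable (at x within {0..})) \<and>
     (\<forall>m k. bounded ((\<lambda>x. x ^ m * (half_deriv ^^ k) f x) ` {0..}))}"

definition schwartz_seminorm :: "nat \<Rightarrow> nat \<Rightarrow> (real \<Rightarrow> real) \<Rightarrow> real" where
  "schwartz_seminorm m k f = (SUP x\<in>{0..}. \<bar>x ^ m * (half_deriv ^^ k) f x\<bar>)"

text \<open>
  The last conjunct is continuity of \<open>\<omega>\<close> for the Frechet topology given by the seminorms.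
\<close>

definition tempered :: "((real \<Rightarrow> real) \<Rightarrow> real) set" where
  "tempered = {\<omega> \<in> extensional schwartz.
     (\<forall>f\<in>schwartz. \<forall>g\<in>schwartz. \<forall>a b. \<omega> (\<lambda>x. a * f x + b * g x) = a * \<omega> f + b * \<omega> g) \<and>
     (\<exists>C N. \<forall>f\<in>schwartz. \<bar>\<omega> f\<bar> \<le> C * (\<Sum>m\<le>N. \<Sum>k\<le>N. schwartz_seminorm m k f))}"

definition tempered_topology :: "((real \<Rightarrow> real) \<Rightarrow> real) topology" where
  "tempered_topology = subtopology (product_topology (\<lambda>_. euclideanreal) schwartz) tempered"

text \<open>
  The white noise measure: the dual space carries the Borel sets of the weak-* topology (these
  are also the Borel sets of the strong dual topology), and the probability measure has the
  characteristic functional prescribed by the Bochner-Minlos theorem, which determines it.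
\<close>

definition white_noise :: "real \<Rightarrow> ((real \<Rightarrow> real) \<Rightarrow> real) measure \<Rightarrow> bool" where
  "white_noise H P \<longleftrightarrow> prob_space P \<and> space P = tempered \<and>
     sets P = sigma_sets tempered {U. openin tempered_topology U} \<and>
     (\<forall>g\<in>schwartz. (LINT \<omega>|P. exp (\<i> * complex_of_real (\<omega> g)))
        = complex_of_real (exp (- (1/2) * (theta_norm H g)\<^sup>2)))"


section \<open>The completion of the Schwartz space\<close>

text \<open>
  An element of the completion is an equivalence class of Cauchy sequences of Schwartz
  functions, so that \<open>G \<in> f\<close> says that \<open>G\<close> is a sequence of Schwartz functions
  approximating \<open>f\<close>.
\<close>

definition theta_cauchy :: "real \<Rightarrow> (nat \<Rightarrow> real \<Rightarrow> real) set" where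
  "theta_cauchy H = {G. (\<forall>k. G k \<in> schwartz) \<and>
     (\<forall>e>0. \<exists>N. \<forall>j\<ge>N. \<forall>k\<ge>N. theta_norm H (\<lambda>x. G j x - G k x) < e)}"

definition theta_equiv :: "real \<Rightarrow> ((nat \<Rightarrow> real \<Rightarrow> real) \<times> (nat \<Rightarrow> real \<Rightarrow> real)) set" where
  "theta_equiv H = {(F, G). F \<in> theta_cauchy H \<and> G \<in> theta_cauchy H \<and>
     (\<lambda>k. theta_norm H (\<lambda>x. F k x - G k x)) \<longlonglongrightarrow> 0}"

definition L2_theta :: "real \<Rightarrow> (nat \<Rightarrow> real \<Rightarrow> real) set set" where
  "L2_theta H = theta_cauchy H // theta_equiv H"

definition theta_embed :: "real \<Rightarrow> (real \<Rightarrow> real) \<Rightarrow> (nat \<Rightarrow> real \<Rightarrow> real) set" where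
  "theta_embed H h = {G \<in> theta_cauchy H. (\<lambda>k. theta_norm H (\<lambda>x. G k x - h x)) \<longlonglongrightarrow> 0}"

text \<open>
  Convergence to \<open>f\<close> of a sequence of functions that need not be smooth.  If \<open>f\<close> is the class of
  a function \<open>h\<close>, then the constant sequence \<open>h\<close> is allowed.
\<close>

definition theta_approximates ::
    "real \<Rightarrow> (nat \<Rightarrow> real \<Rightarrow> real) \<Rightarrow> (nat \<Rightarrow> real \<Rightarrow> real) set \<Rightarrow> bool" where
  "theta_approximates H F f \<longleftrightarrow> (\<forall>k. F k \<in> theta_functions H) \<and>
     (\<exists>G\<in>f. (\<lambda>k. theta_norm H (\<lambda>x. F k x - G k x)) \<longlonglongrightarrow> 0)"

text \<open>
  Elements of the completion need not be functions, so the double integral of \<open>f\<close> over the square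
  is taken as the limit of the double integrals of functions approximating \<open>f\<close>.  For the class
  of a function \<open>h\<close> in \<^const>\<open>theta_functions\<close>, the constant sequence \<open>h\<close> shows that it is the
  double integral of \<open>h\<close>.
\<close>

definition theta_norm_sq_upto :: "real \<Rightarrow> real \<Rightarrow> (nat \<Rightarrow> real \<Rightarrow> real) set \<Rightarrow> real" where
  "theta_norm_sq_upto H t f = (THE l. \<forall>F. theta_approximates H F f \<longrightarrow>
     (\<lambda>k. theta_inner_on H {0..t} (F k) (F k)) \<longlonglongrightarrow> l)"


section \<open>Fractional Brownian motion and integrals of deterministic integrands\<close>

definition L2_fun :: "'a measure \<Rightarrow> ('a \<Rightarrow> real) set" where
  "L2_fun M = {Z \<in> borel_measurable M. integrable M (\<lambda>\<omega>. (Z \<omega>)\<^sup>2)}"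

definition L2_tendsto :: "'a measure \<Rightarrow> (nat \<Rightarrow> 'a \<Rightarrow> real) \<Rightarrow> ('a \<Rightarrow> real) \<Rightarrow> bool" where
  "L2_tendsto M Z Y \<longleftrightarrow> (\<forall>k. Z k \<in> L2_fun M) \<and> Y \<in> L2_fun M \<and>
     (\<lambda>k. LINT \<omega>|M. (Z k \<omega> - Y \<omega>)\<^sup>2) \<longlonglongrightarrow> 0"

definition gaussian_var :: "'a measure \<Rightarrow> ('a \<Rightarrow> real) \<Rightarrow> bool" where
  "gaussian_var M Z \<longleftrightarrow> Z \<in> borel_measurable M \<and>
     (\<exists>\<mu>. (AE \<omega> in M. Z \<omega> = \<mu>) \<or>
          (\<exists>\<sigma>>0. distributed M lborel Z (\<lambda>x. ennreal (normal_density \<mu> \<sigma> x))))"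

definition fractional_brownian_motion ::
    "real \<Rightarrow> 'a measure \<Rightarrow> (real \<Rightarrow> 'a \<Rightarrow> real) \<Rightarrow> bool" where
  "fractional_brownian_motion H M B \<longleftrightarrow> prob_space M \<and>
     (\<forall>T c. finite T \<longrightarrow> T \<subseteq> {0..} \<longrightarrow> gaussian_var M (\<lambda>\<omega>. \<Sum>t\<in>T. c t * B t \<omega>)) \<and>
     (\<forall>t\<ge>0. (LINT \<omega>|M. B t \<omega>) = 0) \<and>
     (\<forall>s\<ge>0. \<forall>t\<ge>0. (LINT \<omega>|M. B s \<omega> * B t \<omega>) = fbm_cov H s t) \<and>
     (AE \<omega> in M. continuous_on {0..} (\<lambda>t. B t \<omega>))"

text \<open>\<open>Z\<close> is (a version of) the pairing of \<open>\<omega>\<close> with the element \<open>f\<close> of the completion.\<close>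

definition pairing :: "((real \<Rightarrow> real) \<Rightarrow> real) measure \<Rightarrow> (nat \<Rightarrow> real \<Rightarrow> real) set \<Rightarrow>
    (((real \<Rightarrow> real) \<Rightarrow> real) \<Rightarrow> real) \<Rightarrow> bool" where
  "pairing P f Z \<longleftrightarrow> (\<forall>G\<in>f. L2_tendsto P (\<lambda>k \<omega>. \<omega> (G k)) Z)"

text \<open>
  On the white noise space, the fractional Brownian motion is the continuous version of the
  pairing of \<open>\<omega>\<close> with the indicator of \<open>[0,t]\<close>.
\<close>

definition white_noise_fbm :: "real \<Rightarrow> ((real \<Rightarrow> real) \<Rightarrow> real) measure \<Rightarrow>
    (real \<Rightarrow> ((real \<Rightarrow> real) \<Rightarrow> real) \<Rightarrow> real) \<Rightarrow> bool" where
  "white_noise_fbm H P B \<longleftrightarrow> fractional_brownian_motion H P B \<and>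
     (\<forall>t\<ge>0. pairing P (theta_embed H (indicator {0..t})) (B t))"

definition wiener_integral :: "real \<Rightarrow> ((real \<Rightarrow> real) \<Rightarrow> real) measure \<Rightarrow>
    (nat \<Rightarrow> real \<Rightarrow> real) set \<Rightarrow> real \<Rightarrow> (((real \<Rightarrow> real) \<Rightarrow> real) \<Rightarrow> real) \<Rightarrow> bool" where
  "wiener_integral H P f t Z \<longleftrightarrow> (\<forall>F\<in>f. \<exists>Y.
     (\<forall>k. pairing P (theta_embed H (restrict_upto t (F k))) (Y k)) \<and> L2_tendsto P Y Z)"


section \<open>The fractional Wiener-Ito-Skorokhod integral\<close>

text \<open>
  Smooth functions of \<open>n\<close> real variables, bounded together with all partial derivatives.
  Arguments are sequences of which only the coordinates below \<open>n\<close> matter.  As all iterated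
  partial derivatives exist and are bounded, they are Lipschitz, hence continuous.
\<close>

definition partial_deriv :: "nat \<Rightarrow> ((nat \<Rightarrow> real) \<Rightarrow> real) \<Rightarrow> (nat \<Rightarrow> real) \<Rightarrow> real" where
  "partial_deriv i \<phi> x = deriv (\<lambda>r. \<phi> (x(i := r))) (x i)"

definition smooth_bounded :: "nat \<Rightarrow> ((nat \<Rightarrow> real) \<Rightarrow> real) \<Rightarrow> bool" where
  "smooth_bounded n \<phi> \<longleftrightarrow> (\<forall>x y. (\<forall>i<n. x i = y i) \<longrightarrow> \<phi> x = \<phi> y) \<and>
     (\<forall>is. set is \<subseteq> {..<n} \<longrightarrow>
        bounded (range (fold partial_deriv is \<phi>)) \<and>
        (\<forall>i<n. \<forall>x. (\<lambda>r. fold partial_deriv is \<phi> (x(i := r))) differentiable (at (x i))))"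

text \<open>
  The cylinder functional \<open>\<phi>(\<langle>\<omega>,g\<^sub>0\<rangle>, \<dots>, \<langle>\<omega>,g\<^sub>n\<^sub>-\<^sub>1\<rangle>)\<close> and its Malliavin derivative, which is
  a process with values in the Schwartz space.
\<close>

definition cylinder :: "((nat \<Rightarrow> real) \<Rightarrow> real) \<Rightarrow> (nat \<Rightarrow> real \<Rightarrow> real) \<Rightarrow>
    ((real \<Rightarrow> real) \<Rightarrow> real) \<Rightarrow> real" where
  "cylinder \<phi> g \<omega> = \<phi> (\<lambda>i. \<omega> (g i))"

definition malliavin_deriv :: "nat \<Rightarrow> ((nat \<Rightarrow> real) \<Rightarrow> real) \<Rightarrow> (nat \<Rightarrow> real \<Rightarrow> real) \<Rightarrow>
    ((real \<Rightarrow> real) \<Rightarrow> real) \<Rightarrow> real \<Rightarrow> real" where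
  "malliavin_deriv n \<phi> g \<omega> s = (\<Sum>i<n. partial_deriv i \<phi> (\<lambda>j. \<omega> (g j)) * g i s)"

text \<open>
  The integral as the divergence operator, i.e. the adjoint of the Malliavin derivative: \<open>u\<close> is a
  square integrable process in its domain, and \<open>Z\<close> is its integral over the half line.
\<close>

definition fwis_integral :: "real \<Rightarrow> ((real \<Rightarrow> real) \<Rightarrow> real) measure \<Rightarrow>
    (((real \<Rightarrow> real) \<Rightarrow> real) \<Rightarrow> real \<Rightarrow> real) \<Rightarrow> (((real \<Rightarrow> real) \<Rightarrow> real) \<Rightarrow> real) \<Rightarrow> bool" where
  "fwis_integral H P u Z \<longleftrightarrow>
     (\<lambda>(\<omega>, s). u \<omega> s) \<in> borel_measurable (P \<Otimes>\<^sub>M lborel) \<and>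
     (\<integral>\<^sup>+\<omega>. (\<integral>\<^sup>+s\<in>{0..}. (\<integral>\<^sup>+r\<in>{0..}. ennreal (\<bar>u \<omega> s\<bar> * \<bar>u \<omega> r\<bar> * theta H s r)
        \<partial>lborel) \<partial>lborel) \<partial>P) < \<infinity> \<and>
     Z \<in> L2_fun P \<and>
     (\<forall>n \<phi> g. smooth_bounded n \<phi> \<longrightarrow> (\<forall>i. g i \<in> schwartz) \<longrightarrow>
        (LINT \<omega>|P. cylinder \<phi> g \<omega> * Z \<omega>)
        = (LINT \<omega>|P. theta_inner H (malliavin_deriv n \<phi> g \<omega>) (u \<omega>)))"

definition iterated_fwis_fun :: "real \<Rightarrow> ((real \<Rightarrow> real) \<Rightarrow> real) measure \<Rightarrow>
    (real \<Rightarrow> real) \<Rightarrow> (nat \<Rightarrow> real \<Rightarrow> ((real \<Rightarrow> real) \<Rightarrow> real) \<Rightarrow> real) \<Rightarrow> bool" where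
  "iterated_fwis_fun H P h Y \<longleftrightarrow> (\<forall>t\<ge>0. \<forall>\<omega>. Y 0 t \<omega> = 1) \<and>
     (\<forall>n. \<forall>t\<ge>0. fwis_integral H P (\<lambda>\<omega>. restrict_upto t (\<lambda>s. Y n s \<omega> * h s)) (Y (Suc n) t))"

text \<open>
  The iterated integrals for an integrand \<open>f\<close> in the completion, for which a pointwise product
  with a random process need not make sense: as in \<^const>\<open>wiener_integral\<close>, \<open>f\<close> is approximated by
  functions.  For the class of a function \<open>h\<close> in \<^const>\<open>theta_functions\<close>, the constant sequence
  \<open>h\<close> is among the approximations, so that \<open>X n t\<close> is almost surely the iterated integral
  of \<open>h\<close> obtained by integrating successively.
\<close>

definition iterated_fwis :: "real \<Rightarrow> ((real \<Rightarrow> real) \<Rightarrow> real) measure \<Rightarrow>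
    (nat \<Rightarrow> real \<Rightarrow> real) set \<Rightarrow> (nat \<Rightarrow> real \<Rightarrow> ((real \<Rightarrow> real) \<Rightarrow> real) \<Rightarrow> real) \<Rightarrow> bool" where
  "iterated_fwis H P f X \<longleftrightarrow> (\<forall>F. theta_approximates H F f \<longrightarrow>
     (\<exists>Y. (\<forall>k. iterated_fwis_fun H P (F k) (Y k)) \<and>
          (\<forall>n. \<forall>t\<ge>0. L2_tendsto P (\<lambda>k. Y k n t) (X n t))))"

end

theory Submission
  imports Defs "HOL-Real_Asymp.Real_Asymp"
begin

text \<open>
  Testing the duality against \<open>cos (\<langle>\<omega>,g\<rangle> + j \<pi>/2)\<close> turns the iterated integrals of a function \<open>h\<close>
  into iterated Lebesgue integrals: with \<open>c = \<langle>g, 1\<^sub>[\<^sub>0\<^sub>,\<^sub>t\<^sub>] h\<rangle>\<close>, the expectation of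
  \<open>cos (\<langle>\<omega>,g\<rangle> + j \<pi>/2) Y\<^sub>n\<close> is \<open>cos ((n + j) \<pi>/2) c\<^sup>n / n! exp (- \<parallel>g\<parallel>\<^sup>2 / 2)\<close>.  The Hermite polynomial
  of degree \<open>n\<close> and variance \<open>q = \<parallel>1\<^sub>[\<^sub>0\<^sub>,\<^sub>t\<^sub>] h\<parallel>\<^sup>2\<close> of the Gaussian variable paired with \<open>1\<^sub>[\<^sub>0\<^sub>,\<^sub>t\<^sub>] h\<close>, divided
  by \<open>n!\<close>, has the same expectations, and these determine an integrable variable because the Borel
  sets of the tempered distributions are generated by cylinder sets.  The \<open>L\<^sup>2\<close> limits along
  functions approximating \<open>f\<close> therefore are Hermite polynomials in the first order integral, with
  variance \<open>l\<close> equal to its second moment, which is also the limit defining the norm of \<open>f\<close> up to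
  \<open>t\<close>.  At every point \<open>x\<close> the Hermite polynomials satisfy
  \<open>limsup \<bar>(n/2)! H\<^sub>n(x) / n!\<bar>\<^bsup>2/n\<^esup> = l/2\<close>: the recursion gives the upper bound, and Turan's inequality
  \<open>H\<^sub>n\<^sup>2 - H\<^sub>n\<^sub>+\<^sub>1 H\<^sub>n\<^sub>-\<^sub>1 \<ge> l\<^sup>n (n - 1)!\<close> the lower bound.
\<close>

section \<open>Hermite polynomials\<close>

text \<open>The duality admits only smooth test functions that are bounded with all their
  derivatives, which excludes polynomials and exponentials. Shifted cosines are bounded and are
  permuted by differentiation, so each use of the duality merely raises \<open>j\<close> by one.
  Three obstacles shape the rest. Positivity of the inner product is not visible from the kernel; it
  comes from writing the kernel as a mixture of products of interval indicators. The weak-* topology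
  has uncountably many coordinates, whereas a sigma-algebra handles countably many operations;
  separability of the Schwartz space bridges this. At a fixed \<open>x\<close> a single Hermite
  value may vanish, so no lower bound holds for each \<open>n\<close>; Turan's inequality says
  instead that three consecutive values cannot all be small. The number \<open>l\<close> is a second
  moment of the given first order integral and so does not depend on an approximating sequence. This
  makes the limit defining the norm of \<open>f\<close> up to \<open>t\<close> exist and be the same
  for every approximation.\<close>

fun herm :: "real \<Rightarrow> real \<Rightarrow> nat \<Rightarrow> real" where
  "herm v x 0 = 1"
| "herm v x (Suc 0) = x"
| "herm v x (Suc (Suc n)) = x * herm v x (Suc n) - real (Suc n) * v * herm v x n"

text \<open>The recursion gives \<open>?D (Suc n) = v * (real (Suc n) * ?D n + (herm v x (Suc
  n))\<^sup>2)\<close>. Dropping the square leaves the recursion of the left-hand side, with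
  equality at \<open>?D 0 = v\<close>.\<close>

lemma herm_turan:
  assumes "0 \<le> v"
  shows "v ^ Suc n * fact n \<le> (herm v x (Suc n))\<^sup>2 - herm v x (Suc (Suc n)) * herm v x n"
proof (induction n)
  case (Suc n)
  let ?D = "\<lambda>n. (herm v x (Suc n))\<^sup>2 - herm v x (Suc (Suc n)) * herm v x n"
  have "?D (Suc n) = v * (real (Suc n) * ?D n + (herm v x (Suc n))\<^sup>2)"
    by (simp add: algebra_simps power2_eq_square)
  moreover have "v * (real (Suc n) * (v ^ Suc n * fact n)) \<le> v * (real (Suc n) * ?D n + (herm v x (Suc n))\<^sup>2)"
    using mult_left_mono[OF Suc, of "real (Suc n)"] assms
    by (intro mult_left_mono) (auto intro: add_increasing2)
  ultimately show ?case by (simp add: algebra_simps)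
qed (simp add: power2_eq_square)

text \<open>After division by the square root of n! the coefficient of the middle term is |x| / sqrt
  (n + 2), which tends to 0. A geometric sequence with ratio \<open>s\<close>, where
  \<open>s\<^sup>2 = \<rho>\<close>, therefore dominates the recursion from some index on, because v
  < \<rho>.\<close>

lemma herm_upper:
  assumes "0 \<le> v" "v < \<rho>"
  obtains C where "0 < C" "\<And>n. (herm v x n)\<^sup>2 \<le> C * \<rho> ^ n * fact n"
proof -
  define s where "s = sqrt \<rho>"
  have s: "0 < s" "s\<^sup>2 = \<rho>" using assms by (auto simp: s_def)
  define a where "a n = \<bar>herm v x n\<bar> / sqrt (fact n)" for n
  have rec: "a (Suc (Suc n)) \<le> \<bar>x\<bar> / sqrt (real n + 2) * a (Suc n) + v * a n" for n
  proof -
    have f: "sqrt (fact (Suc (Suc n))) = sqrt (real n + 2) * sqrt (fact (Suc n))"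
      "sqrt (fact (Suc n)) = sqrt (real n + 1) * sqrt (fact n)"
      by (simp_all add: real_sqrt_mult[symmetric] algebra_simps)
    have "\<bar>herm v x (Suc (Suc n))\<bar> \<le> \<bar>x\<bar> * \<bar>herm v x (Suc n)\<bar> + real (Suc n) * v * \<bar>herm v x n\<bar>"
      using assms abs_triangle_ineq4[of "x * herm v x (Suc n)" "real (Suc n) * v * herm v x n"]
      by (simp add: abs_mult)
    hence "a (Suc (Suc n)) \<le> (\<bar>x\<bar> * \<bar>herm v x (Suc n)\<bar> + real (Suc n) * v * \<bar>herm v x n\<bar>) / sqrt (fact (Suc (Suc n)))"
      unfolding a_def by (intro divide_right_mono) auto
    also have "\<dots> = \<bar>x\<bar> / sqrt (real n + 2) * a (Suc n) + real (Suc n) * v * \<bar>herm v x n\<bar> / sqrt (fact (Suc (Suc n)))"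
      unfolding a_def f(1) by (simp add: add_divide_distrib)
    also have "real (Suc n) * v * \<bar>herm v x n\<bar> / sqrt (fact (Suc (Suc n)))
        = real (Suc n) / (sqrt (real n + 2) * sqrt (real n + 1)) * (v * a n)"
      unfolding a_def f by simp
    also have "\<dots> \<le> 1 * (v * a n)"
    proof (intro mult_right_mono)
      have "real (Suc n) = sqrt (real n + 1) * sqrt (real n + 1)" by simp
      also have "\<dots> \<le> sqrt (real n + 2) * sqrt (real n + 1)" by (intro mult_right_mono) auto
      finally show "real (Suc n) / (sqrt (real n + 2) * sqrt (real n + 1)) \<le> 1"
        by simp
    qed (use assms in \<open>auto simp: a_def\<close>)
    finally show ?thesis by simp
  qed
  have "(\<lambda>n. \<bar>x\<bar> / sqrt (real n + 2) * s + v) \<longlonglongrightarrow> 0 * s + v"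
    by (intro tendsto_intros; real_asymp)
  hence "\<forall>\<^sub>F n in sequentially. \<bar>x\<bar> / sqrt (real n + 2) * s + v < \<rho>"
    using assms(2) by (intro order_tendstoD(2)) auto
  then obtain N where N: "\<And>n. n \<ge> N \<Longrightarrow> \<bar>x\<bar> / sqrt (real n + 2) * s + v \<le> \<rho>"
    unfolding eventually_sequentially using less_imp_le by metis
  \<comment> \<open>The recursion needs two predecessors, so the bound must hold up to
    \<open>Suc N\<close> before it can propagate; the summand 1 makes \<open>C\<close>
    positive.\<close>
  define C where "C = (\<Sum>k\<le>Suc N. a k / s ^ k) + 1"
  have a0: "0 \<le> a n" for n by (simp add: a_def)
  have C: "0 < C" unfolding C_def using s a0 by (intro add_nonneg_pos sum_nonneg) auto
  have ini: "a n \<le> C * s ^ n" if "n \<le> Suc N" for n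
  proof -
    have "a n / s ^ n \<le> (\<Sum>k\<le>Suc N. a k / s ^ k)"
      using that s a0 by (intro member_le_sum) auto
    hence "a n / s ^ n \<le> C" unfolding C_def by simp
    thus ?thesis using s by (simp add: divide_simps)
  qed
  have main: "a n \<le> C * s ^ n" for n
  proof (induction n rule: less_induct)
    case (less n)
    show ?case
    proof (cases "n \<le> Suc N")
      case False
      then obtain m where m: "n = Suc (Suc m)" "m \<ge> N" by (metis not_less_eq_eq Suc_leD less_eqE add_Suc_right not0_implies_Suc nat_le_linear Suc_le_D)
      have "a n \<le> \<bar>x\<bar> / sqrt (real m + 2) * a (Suc m) + v * a m" using rec m by simp
      also have "\<dots> \<le> \<bar>x\<bar> / sqrt (real m + 2) * (C * s ^ Suc m) + v * (C * s ^ m)"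
        using less.IH[of "Suc m"] less.IH[of m] m(1) assms by (intro add_mono mult_left_mono) auto
      also have "\<dots> = C * s ^ m * (\<bar>x\<bar> / sqrt (real m + 2) * s + v)" by (simp add: algebra_simps)
      also have "\<dots> \<le> C * s ^ m * \<rho>" using N m C s by (intro mult_left_mono) auto
      also have "\<dots> = C * s ^ n" unfolding m(1) s(2)[symmetric] by (simp add: power2_eq_square)
      finally show ?thesis .
    qed (use ini in auto)
  qed
  have "(herm v x n)\<^sup>2 \<le> C\<^sup>2 * \<rho> ^ n * fact n" for n
  proof -
    have "(a n)\<^sup>2 \<le> (C * s ^ n)\<^sup>2" using main a0 by (intro power_mono) auto
    also have "\<dots> = C\<^sup>2 * \<rho> ^ n" unfolding s(2)[symmetric] by (simp add: power_mult_distrib power_mult[symmetric] mult.commute)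
    finally show ?thesis unfolding a_def by (simp add: power_divide divide_simps)
  qed
  thus ?thesis using that[of "C\<^sup>2"] C by auto
qed

text \<open>The functional equation of Gamma shows that passing from \<open>m\<close> to
  \<open>m + 2\<close> multiplies the quotient by (m + 2) / (m + 1); the starting values at 0 and 1
  are 1 and \<pi>/2. Polynomial bounds suffice, since an n-th root is taken afterwards.\<close>

lemma Gamma_half_fact_bounds:
  "1 \<le> (Gamma (real n / 2 + 1))\<^sup>2 * 2 ^ n / fact n \<and>
   (Gamma (real n / 2 + 1))\<^sup>2 * 2 ^ n / fact n \<le> real n + 1"
proof (induction n rule: less_induct)
  case (less n)
  consider "n = 0" | "n = 1" | m where "n = Suc (Suc m)" by (metis One_nat_def not0_implies_Suc)
  thus ?case
  proof cases
    case 2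
    have "(1/2::real) \<notin> \<int>\<^sub>\<le>\<^sub>0" using nonpos_Ints_nonpos[of "1/2::real"] by linarith
    hence g: "Gamma (3/2 :: real) = 1/2 * sqrt pi"
      using Gamma_plus1[of "1/2::real"] Gamma_one_half_real by simp
    have "(Gamma (real n / 2 + 1))\<^sup>2 * 2 ^ n / fact n = (Gamma (3/2))\<^sup>2 * 2" using 2 by simp
    also have "\<dots> = pi / 2" unfolding g by (simp add: power_mult_distrib power_divide)
    finally have "(Gamma (real n / 2 + 1))\<^sup>2 * 2 ^ n / fact n = pi / 2" .
    thus ?thesis using 2 pi_ge_two pi_less_4 by simp
  next
    case (3 m)
    let ?G = "\<lambda>n::nat. (Gamma (real n / 2 + 1))\<^sup>2 * 2 ^ n / fact n :: real"
    have "Gamma (real n / 2 + 1) = (real m / 2 + 1) * Gamma (real m / 2 + 1)"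
      using Gamma_plus1[of "real m / 2 + 1"] 3 by (simp add: nonpos_Ints_def add.commute add_divide_distrib)
    hence "?G n = ((real m / 2 + 1) * Gamma (real m / 2 + 1))\<^sup>2 * (4 * 2 ^ m) / ((real m + 2) * ((real m + 1) * fact m))"
      using 3 by (simp add: algebra_simps)
    also have "\<dots> = (4 * (real m / 2 + 1)\<^sup>2 / ((real m + 2) * (real m + 1))) * ?G m"
      by (simp add: power_mult_distrib mult_ac)
    also have "4 * (real m / 2 + 1)\<^sup>2 / ((real m + 2) * (real m + 1)) = (real m + 2) / (real m + 1)"
    proof -
      have "4 * (real m / 2 + 1)\<^sup>2 = (real m + 2) * (real m + 2)" by (simp add: field_simps power2_eq_square)
      thus ?thesis by simp
    qed
    finally have e: "?G n = (real m + 2) / (real m + 1) * ?G m" .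
    have IH: "1 \<le> ?G m" "?G m \<le> real m + 1" using less 3 by auto
    have "1 * 1 \<le> (real m + 2) / (real m + 1) * ?G m"
      using IH(1) by (intro mult_mono) auto
    moreover have "(real m + 2) / (real m + 1) * ?G m \<le> (real m + 2) / (real m + 1) * (real m + 1)"
      using IH(2) by (intro mult_left_mono) auto
    hence "(real m + 2) / (real m + 1) * ?G m \<le> real n + 1" using 3 by simp
    ultimately show ?thesis unfolding e by simp
  qed simp
qed

lemma limsup_herm:
  assumes v: "0 \<le> v"
  shows "limsup (\<lambda>n. ereal (\<bar>Gamma (real n / 2 + 1) * (herm v x n / fact n)\<bar> powr (2 / real n))) = ereal (v / 2)"
    (is "limsup ?L = _")
proof (rule antisym)
  \<comment> \<open>Squaring replaces the exponent 2/n by 1/n and isolates a factor whose n-th root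
    tends to 1.\<close>
  define G where "G n = (Gamma (real n / 2 + 1))\<^sup>2 * 2 ^ n / fact n" for n :: nat
  have G: "1 \<le> G n" "G n \<le> real n + 1" for n using Gamma_half_fact_bounds[of n] by (auto simp: G_def)
  have L: "\<bar>Gamma (real n / 2 + 1) * (herm v x n / fact n)\<bar> powr (2 / real n)
      = (G n * ((herm v x n)\<^sup>2 / fact n) / 2 ^ n) powr (1 / real n)" (is "?l = _") for n
  proof -
    have "?l = (\<bar>Gamma (real n / 2 + 1) * (herm v x n / fact n)\<bar> powr 2) powr (1 / real n)"
      unfolding powr_powr by simp
    also have "\<bar>Gamma (real n / 2 + 1) * (herm v x n / fact n)\<bar> powr 2 = G n * ((herm v x n)\<^sup>2 / fact n) / 2 ^ n"
      by (simp add: G_def power_mult_distrib power_divide power2_eq_square)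
    finally show ?thesis .
  qed
  show "limsup ?L \<le> ereal (v / 2)"
  proof (rule ereal_le_epsilon2)
    fix e :: real assume e: "0 < e"
    define \<rho> where "\<rho> = v + 2 * e"
    have \<rho>: "v < \<rho>" "0 < \<rho>" using e v by (auto simp: \<rho>_def)
    obtain C where C: "0 < C" "\<And>n. (herm v x n)\<^sup>2 \<le> C * \<rho> ^ n * fact n"
      using herm_upper[OF v \<rho>(1), of x] by blast
    have le: "?L n \<le> ereal (((real n + 1) * C) powr (1 / real n) * (\<rho> / 2))" if "n > 0" for n
    proof -
      have "(G n * ((herm v x n)\<^sup>2 / fact n) / 2 ^ n) powr (1 / real n) \<le> ((real n + 1) * (C * \<rho> ^ n) / 2 ^ n) powr (1 / real n)"
      proof (intro powr_mono2 divide_right_mono mult_mono)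
        show "(herm v x n)\<^sup>2 / fact n \<le> C * \<rho> ^ n" using C(2)[of n] by (simp add: divide_simps)
        show "0 \<le> G n * ((herm v x n)\<^sup>2 / fact n) / 2 ^ n" using G(1)[of n] by simp
      qed (use G in auto)
      also have "\<dots> = ((real n + 1) * C * (\<rho> / 2) ^ n) powr (1 / real n)" unfolding power_divide mult.assoc times_divide_eq_right ..
      also have "\<dots> = ((real n + 1) * C) powr (1 / real n) * (\<rho> / 2)"
        using \<rho> C that by (simp add: powr_mult powr_powr flip: powr_realpow)
      finally show ?thesis unfolding L by simp
    qed
    have "(\<lambda>n. ((real n + 1) * C) powr (1 / real n)) \<longlonglongrightarrow> 1" using C(1) by real_asymp
    hence lim: "(\<lambda>n. ereal (((real n + 1) * C) powr (1 / real n) * (\<rho> / 2))) \<longlonglongrightarrow> ereal (1 * (\<rho> / 2))"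
      by (intro tendsto_intros)
    have "limsup ?L \<le> limsup (\<lambda>n. ereal (((real n + 1) * C) powr (1 / real n) * (\<rho> / 2)))"
      using le by (intro Limsup_mono) (auto simp: eventually_sequentially intro!: exI[of _ 1])
    also have "\<dots> = ereal (v / 2) + ereal e"
      using lim_imp_Limsup[OF _ lim] by (simp add: \<rho>_def add_divide_distrib)
    finally show "limsup ?L \<le> ereal (v / 2) + ereal e" .
  qed
  show "ereal (v / 2) \<le> limsup ?L"
  \<comment> \<open>If the limsup were smaller, then for some \<rho> < v all late squares would be
    at most \<rho>^n n!, and Turan's difference would grow too slowly.\<close>
  proof (rule ccontr)
    assume "\<not> ?thesis"
    hence lt: "limsup ?L < ereal (v / 2)" by simp
    have nn: "0 \<le> limsup ?L" by (intro le_Limsup) auto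
    obtain r where r: "limsup ?L < ereal r" "r < v / 2"
      using ereal_dense2[OF lt] by auto
    have "0 < ereal r" using nn r(1) by (rule order_le_less_trans)
    hence r0: "0 < r" by simp
    define \<rho> where "\<rho> = 2 * r"
    have \<rho>: "0 < \<rho>" "\<rho> < v" using r r0 by (auto simp: \<rho>_def)
    have "\<forall>\<^sub>F n in sequentially. ?L n < ereal r" using Limsup_lessD[OF r(1)] .
    then obtain N where N: "\<And>n. n \<ge> N \<Longrightarrow> ?L n < ereal r" by (auto simp: eventually_sequentially)
    have up: "(herm v x n)\<^sup>2 \<le> \<rho> ^ n * fact n" if "n \<ge> max N 1" for n
    proof -
      have n: "n > 0" using that by simp
      let ?b = "G n * ((herm v x n)\<^sup>2 / fact n) / 2 ^ n"
      have b: "0 \<le> ?b" using G(1)[of n] by simp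
      have "?b powr (1 / real n) < r" using N[of n] that L by simp
      hence "(?b powr (1 / real n)) ^ n \<le> r ^ n" by (intro power_mono) auto
      also have "(?b powr (1 / real n)) ^ n = ?b powr (1 / real n * real n)"
        unfolding powr_powr[symmetric] using n by (intro powr_realpow'[symmetric]) auto
      also have "\<dots> = ?b powr 1" using n by simp
      also have "\<dots> = ?b" using b by (rule powr_one)
      finally have "G n * ((herm v x n)\<^sup>2 / fact n) \<le> r ^ n * 2 ^ n"
        by (subst (asm) pos_divide_le_eq) auto
      also have "\<dots> = \<rho> ^ n" by (simp add: \<rho>_def power_mult_distrib)
      finally have "G n * ((herm v x n)\<^sup>2 / fact n) \<le> \<rho> ^ n" .
      moreover have "1 * ((herm v x n)\<^sup>2 / fact n) \<le> G n * ((herm v x n)\<^sup>2 / fact n)"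
        using G by (intro mult_right_mono) auto
      ultimately show ?thesis by (simp add: divide_simps)
    qed
    \<comment> \<open>The factor 3 is 1 for the square of the middle value plus 2 for the product of
      its neighbours; the 2 comes from n + 2 \<le> 4 (n + 1) under a square root.\<close>
    have key: "(v / \<rho>) ^ Suc n \<le> 3 * (real n + 1)" if n: "n \<ge> max N 1" for n
    proof -
      have "\<bar>herm v x (Suc (Suc n)) * herm v x n\<bar> \<le> 2 * (\<rho> ^ Suc n * fact (Suc n))"
      proof (rule power2_le_imp_le)
        have "\<bar>herm v x (Suc (Suc n)) * herm v x n\<bar>\<^sup>2 = (herm v x (Suc (Suc n)))\<^sup>2 * (herm v x n)\<^sup>2"
          by (simp add: power_mult_distrib del: herm.simps)
        also have "\<dots> \<le> (\<rho> ^ Suc (Suc n) * fact (Suc (Suc n))) * (\<rho> ^ n * fact n)"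
          using up[of n] up[of "Suc (Suc n)"] n \<rho> by (intro mult_mono) auto
        also have "\<dots> \<le> (\<rho> ^ Suc n)\<^sup>2 * (((real n + 2) * fact (Suc n)) * fact n)"
          by (simp add: power2_eq_square algebra_simps)
        also have "\<dots> \<le> (\<rho> ^ Suc n)\<^sup>2 * ((4 * (real n + 1) * fact (Suc n)) * fact n)"
          using \<rho> by (intro mult_left_mono mult_right_mono) auto
        also have "\<dots> = (2 * (\<rho> ^ Suc n * fact (Suc n)))\<^sup>2"
          by (simp add: power2_eq_square algebra_simps)
        finally show "\<bar>herm v x (Suc (Suc n)) * herm v x n\<bar>\<^sup>2 \<le> (2 * (\<rho> ^ Suc n * fact (Suc n)))\<^sup>2" .
      qed (use \<rho> in auto)
      hence "v ^ Suc n * fact n \<le> \<rho> ^ Suc n * fact (Suc n) + 2 * (\<rho> ^ Suc n * fact (Suc n))"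
        using herm_turan[OF v, of n x] up[of "Suc n"] n by linarith
      also have "\<dots> = \<rho> ^ Suc n * (3 * (real n + 1)) * fact n" by (simp add: algebra_simps)
      finally have "v ^ Suc n \<le> \<rho> ^ Suc n * (3 * (real n + 1))" by (subst (asm) mult_le_cancel_right_pos) auto
      thus ?thesis using \<rho> by (simp add: power_divide divide_simps mult.commute)
    qed
    define q where "q = v / \<rho>"
    have q: "1 < q" using \<rho> by (simp add: q_def)
    have "filterlim (\<lambda>n::nat. q ^ Suc n / (3 * (real n + 1))) at_top sequentially" using q by real_asymp
    hence "\<forall>\<^sub>F n in sequentially. 1 < q ^ Suc n / (3 * (real n + 1))"
      unfolding filterlim_at_top_dense by blast
    then obtain K where K: "\<And>n. n \<ge> K \<Longrightarrow> 1 < q ^ Suc n / (3 * (real n + 1))"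
      unfolding eventually_sequentially by blast
    define n where "n = max K (max N 1)"
    have n: "n \<ge> max N 1" "1 < q ^ Suc n / (3 * (real n + 1))" using K[of n] unfolding n_def by auto
    have "3 * (real n + 1) < q ^ Suc n" using n(2) by (subst (asm) pos_less_divide_eq) auto
    thus False using key[OF n(1)] unfolding q_def by linarith
  qed
qed

section \<open>Characteristic functions and moments\<close>

text \<open>This is the \<open>j\<close>-th derivative of cosine at \<open>y\<close>: one family
  contains cosine and sine with both signs, and differentiation is the step from \<open>j\<close> to
  \<open>Suc j\<close>.\<close>

abbreviation cosj :: "nat \<Rightarrow> real \<Rightarrow> real" where
  "cosj j y \<equiv> cos (y + real j * (pi/2))"

lemma DERIV_of_quadratic_bound:
  fixes f :: "real \<Rightarrow> real"
  assumes "\<And>d. \<bar>f (x + d) - f x - d * D\<bar> \<le> K * d\<^sup>2"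
  shows "(f has_field_derivative D) (at x)"
  unfolding DERIV_def
proof (rule LIM_zero_cancel, rule Lim_null_comparison)
  show "\<forall>\<^sub>F d in at 0. norm ((f (x + d) - f x) / d - D) \<le> K * \<bar>d\<bar>"
  proof (rule eventually_at_filter[THEN iffD2], intro always_eventually allI impI)
    fix d :: real assume d: "d \<noteq> 0"
    have "norm ((f (x + d) - f x) / d - D) = \<bar>f (x + d) - f x - d * D\<bar> / \<bar>d\<bar>"
      using d by (simp add: field_simps flip: abs_divide)
    also have "\<dots> \<le> K * d\<^sup>2 / \<bar>d\<bar>" by (intro divide_right_mono assms) auto
    also have "\<dots> = K * \<bar>d\<bar>" using d by (simp add: power2_eq_square field_simps abs_mult_self_eq flip: abs_mult)
    finally show "norm ((f (x + d) - f x) / d - D) \<le> K * \<bar>d\<bar>" .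
  qed
  show "((\<lambda>d. K * \<bar>d\<bar>) \<longlongrightarrow> 0) (at 0)"
    by (rule tendsto_eq_intros tendsto_rabs | simp)+
qed

lemma cos_first_order: "\<bar>cos (y + d) - cos y + d * sin y\<bar> \<le> d\<^sup>2" for y d :: real
proof -
  have "\<bar>cos (y + d) - cos y + d * sin y\<bar> = \<bar>Re (iexp y * (iexp d - (\<Sum>k\<le>1. (\<i> * d)^k / fact k)))\<bar>"
    by (simp add: cis_conv_exp[symmetric] cos_add algebra_simps)
  also have "\<dots> \<le> cmod (iexp y * (iexp d - (\<Sum>k\<le>1. (\<i> * d)^k / fact k)))" by (rule abs_Re_le_cmod)
  also have "\<dots> \<le> 1 * (\<bar>d\<bar>^(Suc 1) / fact (Suc 1))"
    unfolding norm_mult by (intro mult_mono iexp_approx1) auto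
  also have "\<dots> \<le> d\<^sup>2" by (simp add: power2_eq_square)
  finally show ?thesis .
qed

lemma iexp_eq_cos_sin: "iexp x = complex_of_real (cos x) + \<i> * complex_of_real (sin x)"
  by (simp add: cis_conv_exp[symmetric] complex_eq_iff)

context prob_space
begin

lemma integral_iexp_cos_sin:
  fixes X :: "'a \<Rightarrow> real"
  assumes [measurable]: "X \<in> borel_measurable M"
  shows "(LINT x|M. iexp (X x)) =
    complex_of_real (LINT x|M. cos (X x)) + \<i> * complex_of_real (LINT x|M. sin (X x))"
proof -
  have i: "integrable M (\<lambda>x. cos (X x))" "integrable M (\<lambda>x. sin (X x))"
    by (auto intro!: integrable_const_bound[of _ 1])
  have "(LINT x|M. iexp (X x)) = (LINT x|M. complex_of_real (cos (X x)) + \<i> * complex_of_real (sin (X x)))"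
    by (simp add: iexp_eq_cos_sin)
  also have "\<dots> = (LINT x|M. complex_of_real (cos (X x))) + (LINT x|M. \<i> * complex_of_real (sin (X x)))"
    using i by (intro Bochner_Integration.integral_add integrable_mult_right integrable_of_real)
  also have "\<dots> = complex_of_real (LINT x|M. cos (X x)) + \<i> * complex_of_real (LINT x|M. sin (X x))"
    by simp
  finally show ?thesis .
qed

lemma integrable_cos_mult:
  fixes X :: "'a \<Rightarrow> real"
  assumes [measurable]: "X \<in> borel_measurable M" and "integrable M (Z::_\<Rightarrow>real)"
  shows "integrable M (\<lambda>x. cos (X x) * Z x)" "integrable M (\<lambda>x. sin (X x) * Z x)"
  using assms(2)
  by (auto intro!: Bochner_Integration.integrable_bound[OF assms(2)] simp: abs_mult mult_left_le_one_le)

text \<open>The hypotheses give the characteristic function of \<open>sqrt v\<close> times a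
  standard normal variable, so Levy uniqueness identifies the laws and the moments carry over.
  Scaling a standard variable also covers v = 0, where no density exists.\<close>

lemma gaussian_moments_integrable:
  fixes T :: "'a \<Rightarrow> real"
  assumes [measurable]: "T \<in> borel_measurable M" and v: "0 \<le> v"
    and c: "\<And>s. (LINT x|M. cos (s * T x)) = exp (- (s\<^sup>2 * v) / 2)"
    and s: "\<And>s. (LINT x|M. sin (s * T x)) = 0"
  shows "integrable M (\<lambda>x. T x ^ k)"
proof -
  interpret N: real_distribution std_normal_distribution by (rule real_dist_normal_dist)
  let ?D = "distr M borel T" and ?N = "distr std_normal_distribution borel (\<lambda>x. sqrt v * x)"
  have D: "real_distribution ?D" by simp
  have N: "real_distribution ?N" by (rule N.real_distribution_distr) simp
  have "?D = ?N"
  proof (rule Levy_uniqueness[OF D N], rule ext)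
    fix t
    have "char ?D t = (LINT x|M. iexp (t * T x))"
      unfolding char_def by (subst integral_distr) auto
    also have "\<dots> = complex_of_real (exp (- (t\<^sup>2 * v) / 2))"
      by (subst integral_iexp_cos_sin) (auto simp: c s)
    also have "\<dots> = char std_normal_distribution (t * sqrt v)"
      using v by (simp add: char_std_normal_distribution power_mult_distrib)
    also have "\<dots> = char ?N t"
      unfolding char_def by (subst integral_distr) (auto simp: mult.assoc)
    finally show "char ?D t = char ?N t" .
  qed
  moreover have "integrable ?N (\<lambda>x. x ^ k)"
    by (subst integrable_distr_eq) (auto simp: power_mult_distrib integrable_std_normal_distribution_moment)
  ultimately have "integrable ?D (\<lambda>x. x ^ k)" by simp
  thus ?thesis by (subst (asm) integrable_distr_eq) auto
qed

text \<open>The first order Taylor remainder of cosine is at most \<open>(d * T x)\<^sup>2\<close>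
  everywhere. Integrated against |h| it is O(d^2) by \<open>hT2\<close>, which yields the derivative
  directly.\<close>

lemma DERIV_integral_cos:
  fixes W T :: "'a \<Rightarrow> real"
  assumes [measurable]: "W \<in> borel_measurable M" "T \<in> borel_measurable M"
    and h: "integrable M h" and hT: "integrable M (\<lambda>x. T x * h x)"
    and hT2: "integrable M (\<lambda>x. (T x)\<^sup>2 * h x)"
  shows "((\<lambda>s. LINT x|M. cos (W x + s * T x) * h x) has_field_derivative
           (LINT x|M. - sin (W x + s * T x) * (T x * h x))) (at s)"
proof (rule DERIV_of_quadratic_bound)
  fix d
  have [measurable]: "h \<in> borel_measurable M" using h by auto
  have i: "integrable M (\<lambda>x. cos (W x + r * T x) * h x)" "integrable M (\<lambda>x. - sin (W x + r * T x) * (T x * h x))" for r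
    using integrable_cos_mult[OF _ h, of "\<lambda>x. W x + r * T x"] integrable_cos_mult[OF _ hT, of "\<lambda>x. W x + r * T x"] by auto
  have "\<bar>(LINT x|M. cos (W x + (s + d) * T x) * h x) - (LINT x|M. cos (W x + s * T x) * h x)
      - d * (LINT x|M. - sin (W x + s * T x) * (T x * h x))\<bar>
    = \<bar>LINT x|M. cos (W x + (s + d) * T x) * h x - cos (W x + s * T x) * h x - d * (- sin (W x + s * T x) * (T x * h x))\<bar>"
    using i by simp
  also have "\<dots> \<le> (LINT x|M. d\<^sup>2 * \<bar>(T x)\<^sup>2 * h x\<bar>)"
  proof (rule order_trans[OF integral_abs_bound integral_mono])
    fix x
    have "\<bar>cos (W x + (s + d) * T x) * h x - cos (W x + s * T x) * h x - d * (- sin (W x + s * T x) * (T x * h x))\<bar>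
      = \<bar>cos ((W x + s * T x) + d * T x) - cos (W x + s * T x) + (d * T x) * sin (W x + s * T x)\<bar> * \<bar>h x\<bar>"
      by (simp add: abs_mult[symmetric] algebra_simps)
    also have "\<dots> \<le> (d * T x)\<^sup>2 * \<bar>h x\<bar>" by (intro mult_right_mono cos_first_order) auto
    finally show "\<bar>cos (W x + (s + d) * T x) * h x - cos (W x + s * T x) * h x - d * (- sin (W x + s * T x) * (T x * h x))\<bar>
      \<le> d\<^sup>2 * \<bar>(T x)\<^sup>2 * h x\<bar>" by (simp add: abs_mult power_mult_distrib)
  qed (use i hT2 in auto)
  also have "\<dots> = (LINT x|M. \<bar>(T x)\<^sup>2 * h x\<bar>) * d\<^sup>2"
    unfolding integral_mult_right_zero by (rule mult.commute)
  finally show "\<bar>(LINT x|M. cos (W x + (s + d) * T x) * h x) - (LINT x|M. cos (W x + s * T x) * h x)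
      - d * (LINT x|M. - sin (W x + s * T x) * (T x * h x))\<bar> \<le> (LINT x|M. \<bar>(T x)\<^sup>2 * h x\<bar>) * d\<^sup>2" .
qed

lemma integrable_power_herm:
  assumes int: "\<And>k. integrable M (\<lambda>x. T x ^ k :: real)"
  shows "integrable M (\<lambda>x. T x ^ k * herm v (T x) n)"
\<comment> \<open>The recursion multiplies by the point, hence the general power \<open>k\<close>.
  It never changes the point itself, so \<open>0\<close> only fills that argument of the induction
  rule.\<close>
proof (induction v "0::real" n arbitrary: k rule: herm.induct)
  case (3 v n)
  have "integrable M (\<lambda>x. T x ^ Suc k * herm v (T x) (Suc n) - real (Suc n) * v * (T x ^ k * herm v (T x) n))"
    by (intro Bochner_Integration.integrable_diff integrable_mult_right 3)
  thus ?case by (simp add: algebra_simps)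
next
  case 2
  show ?case using int[of "Suc k"] by (simp add: mult.commute)
qed (use int in simp)

text \<open>Differentiating in \<open>s\<close> multiplies the integrand by \<open>T\<close> and
  shifts \<open>j\<close>. On the right-hand side it turns (c + s v)^n E into (n v (c + s v)^(n-1) -
  (c + s v)^(n+1)) E, where E is the exponential, and the Hermite recursion removes exactly the term
  of lower degree. The parameter \<open>s\<close> is kept free for this differentiation; later only
  s = 0 is used.\<close>

lemma expectation_cos_herm:
  fixes W T :: "'a \<Rightarrow> real"
  assumes [measurable]: "W \<in> borel_measurable M" "T \<in> borel_measurable M"
    and int: "\<And>k. integrable M (\<lambda>x. T x ^ k)"
    and h: "\<And>s j::nat. (LINT x|M. cosj j (W x + s * T x)) =
      cos (real j * (pi/2)) * exp (- (a + 2 * s * c + s\<^sup>2 * v) / 2)"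
  shows "(LINT x|M. cosj j (W x + s * T x) * herm v (T x) n) =
      cos (real (n + j) * (pi/2)) * (c + s * v) ^ n * exp (- (a + 2 * s * c + s\<^sup>2 * v) / 2)"
proof -
  have shift4: "cosj (j + 4) y = cosj j y" for y j
    using cos_periodic[of "y + real j * (pi/2)"] by (simp add: algebra_simps)
  have shift2: "cosj (j + 2) y = - cosj j y" for y j
    using cos_periodic_pi[of "y + real j * (pi/2)"] by (simp add: algebra_simps)
  \<comment> \<open>Differentiation shifts by 1, so starting at \<open>j + 3\<close> returns to
    \<open>j\<close> modulo the period 4.\<close>
  have shift3: "- sin (y + real (j + 3) * (pi/2)) = cosj j y" for y j
  proof -
    have "- sin (y + real (j + 3) * (pi/2)) = cos (y + real (j + 3) * (pi/2) + pi/2)"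
      by (simp add: cos_add)
    also have "y + real (j + 3) * (pi/2) + pi/2 = y + real (j + 4) * (pi/2)" by (simp add: algebra_simps)
    finally show ?thesis using shift4 by simp
  qed
  have E: "((\<lambda>s. exp (- (a + 2 * s * c + s\<^sup>2 * v) / 2)) has_field_derivative
      - (c + s * v) * exp (- (a + 2 * s * c + s\<^sup>2 * v) / 2)) (at s)" for s
    by (auto intro!: derivative_eq_intros simp: field_simps)
  have T: "(LINT x|M. cosj j (W x + s * T x) * (T x * herm v (T x) n)) = D"
    if "((\<lambda>s. LINT x|M. cosj (j+3) (W x + s * T x) * herm v (T x) n) has_field_derivative D) (at s)" for n j D s
  proof -
    have "((\<lambda>s. LINT x|M. cos ((W x + real (j+3) * (pi/2)) + s * T x) * herm v (T x) n) has_field_derivative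
      (LINT x|M. - sin ((W x + real (j+3) * (pi/2)) + s * T x) * (T x * herm v (T x) n))) (at s)"
      using integrable_power_herm[OF int, of 0 v n] integrable_power_herm[OF int, of 1 v n] integrable_power_herm[OF int, of 2 v n]
      by (intro DERIV_integral_cos) auto
    hence "((\<lambda>s. LINT x|M. cosj (j+3) (W x + s * T x) * herm v (T x) n) has_field_derivative
      (LINT x|M. - sin (W x + s * T x + real (j+3) * (pi/2)) * (T x * herm v (T x) n))) (at s)"
      by (simp only: add_ac)
    thus ?thesis using DERIV_unique[OF that] unfolding shift3 by simp
  qed
  define P where "P n \<longleftrightarrow> (\<forall>s j. (LINT x|M. cosj j (W x + s * T x) * herm v (T x) n) =
      cos (real (n + j) * (pi/2)) * (c + s * v) ^ n * exp (- (a + 2 * s * c + s\<^sup>2 * v) / 2))" for n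
  have T': "(LINT x|M. cosj j (W x + s * T x) * (T x * herm v (T x) n)) =
      cos (real (n + (j + 3)) * (pi/2)) * (real n * v * (c + s * v) ^ (n - 1) - (c + s * v) ^ Suc n)
        * exp (- (a + 2 * s * c + s\<^sup>2 * v) / 2)" if "P n" for n s j
  proof (rule T)
    let ?K = "cos (real (n + (j + 3)) * (pi/2))" and ?E = "\<lambda>s. exp (- (a + 2 * s * c + s\<^sup>2 * v) / 2)"
    have p: "((\<lambda>s. (c + s * v) ^ n) has_field_derivative real n * v * (c + s * v) ^ (n - 1)) (at s)"
      by (auto intro!: derivative_eq_intros)
    have f: "(\<lambda>s. LINT x|M. cosj (j+3) (W x + s * T x) * herm v (T x) n)
        = (\<lambda>s. ?K * ((c + s * v) ^ n * ?E s))"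
      using that unfolding P_def by (simp only: mult.assoc)
    have e: "C * (N * F + - X * F * q) = C * (N - X * q) * F" for C N F X q :: real
      by (simp add: algebra_simps)
    show "((\<lambda>s. LINT x|M. cosj (j+3) (W x + s * T x) * herm v (T x) n) has_field_derivative
       ?K * (real n * v * (c + s * v) ^ (n - 1) - (c + s * v) ^ Suc n) * ?E s) (at s)"
      using DERIV_cmult[OF DERIV_mult[OF p E], of ?K] unfolding f e power_Suc .
  qed
  have "P n"
  proof (induction n rule: less_induct)
    case (less n)
    consider "n = 0" | "n = 1" | m where "n = Suc (Suc m)" by (metis One_nat_def not0_implies_Suc)
    thus ?case
    proof cases
      case 1
      thus ?thesis using h by (simp add: P_def)
    next
      case 2
      have "P 0" using less.IH[of 0] 2 by simp
      have e: "cos (real (0 + (j + 3)) * (pi/2)) = - cos (real (1 + j) * (pi/2))" for j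
        using shift2[of 0 "j + 1"] by (simp add: add_ac)
      show ?thesis
        using T'[OF \<open>P 0\<close>] unfolding P_def 2 e by (simp, simp add: algebra_simps)
    next
      case (3 m)
      have P: "P m" "P (Suc m)" using less.IH[of m] less.IH[of "Suc m"] 3 by simp_all
      show ?thesis unfolding P_def
      proof (intro allI)
        fix s j
        let ?C = "\<lambda>x. cosj j (W x + s * T x)"
        let ?E = "exp (- (a + 2 * s * c + s\<^sup>2 * v) / 2)"
        have i: "integrable M (\<lambda>x. ?C x * (T x * herm v (T x) (Suc m)))" "integrable M (\<lambda>x. ?C x * herm v (T x) m)"
          using integrable_power_herm[OF int, of 1 v "Suc m"] integrable_power_herm[OF int, of 0 v m]
          by (auto intro!: integrable_cos_mult)
        have "(LINT x|M. ?C x * herm v (T x) n)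
          = (LINT x|M. ?C x * (T x * herm v (T x) (Suc m)) - real (Suc m) * v * (?C x * herm v (T x) m))"
          unfolding 3 by (intro Bochner_Integration.integral_cong) (simp_all add: right_diff_distrib mult_ac)
        also have "\<dots> = (LINT x|M. ?C x * (T x * herm v (T x) (Suc m))) - real (Suc m) * v * (LINT x|M. ?C x * herm v (T x) m)"
          using i by simp
        also have "(LINT x|M. ?C x * (T x * herm v (T x) (Suc m)))
          = cos (real (m + j) * (pi/2)) * (real (Suc m) * v * (c + s * v) ^ m - (c + s * v) ^ Suc (Suc m)) * ?E"
        proof -
          have e: "cos (real (Suc m + (j + 3)) * (pi/2)) = cos (real (m + j) * (pi/2))"
            using shift4[of 0 "m + j"] by (simp add: add_ac)
          show ?thesis using T'[OF P(2), of s j] unfolding e by simp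
        qed
        also have "(LINT x|M. ?C x * herm v (T x) m) = cos (real (m + j) * (pi/2)) * (c + s * v) ^ m * ?E"
          using P(1) unfolding P_def by blast
        also have "cos (real (m + j) * (pi/2)) * (real (Suc m) * v * (c + s * v) ^ m - (c + s * v) ^ Suc (Suc m)) * ?E
           - real (Suc m) * v * (cos (real (m + j) * (pi/2)) * (c + s * v) ^ m * ?E)
          = - cos (real (m + j) * (pi/2)) * (c + s * v) ^ Suc (Suc m) * ?E"
          by (simp only: algebra_simps)
        also have "- cos (real (m + j) * (pi/2)) = cos (real (n + j) * (pi/2))"
          using shift2[of 0 "m + j"] 3 by (simp add: add_ac)
        finally show "(LINT x|M. ?C x * herm v (T x) n) = cos (real (n + j) * (pi/2)) * (c + s * v) ^ n * ?E"
          unfolding 3 .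
      qed
    qed
  qed
  thus ?thesis by (simp add: P_def)
qed

lemma integral_distr_density:
  fixes g :: "real \<Rightarrow> 'b::{banach, second_countable_topology}" and T w :: "'a \<Rightarrow> real"
  assumes [measurable]: "T \<in> borel_measurable M" "w \<in> borel_measurable M" "g \<in> borel_measurable borel"
    and "\<And>x. 0 \<le> w x"
  shows "(LINT x|distr (density M (\<lambda>x. ennreal (w x))) borel T. g x) = (LINT x|M. w x *\<^sub>R g (T x))"
  using assms by (subst integral_distr) (auto simp: integral_density)

text \<open>The signed measure with density \<open>Z\<close>, pushed forward by \<open>T\<close>,
  has vanishing Fourier transform. Levy uniqueness speaks of probability laws only, so it is applied
  to the two densities (|Z| + Z) / m and |Z| / m, which differ by a multiple of
  \<open>Z\<close>.\<close>

lemma integral_indicator_eq_0_if_char_0: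
  fixes T Z :: "'a \<Rightarrow> real"
  assumes [measurable]: "T \<in> borel_measurable M" and Z: "integrable M Z"
    and c: "\<And>s. (LINT x|M. cos (s * T x) * Z x) = 0"
    and s: "\<And>s. (LINT x|M. sin (s * T x) * Z x) = 0"
    and A: "A \<in> sets borel"
  shows "(LINT x|M. indicator A (T x) * Z x) = 0"
proof -
  define m where "m = (LINT x|M. \<bar>Z x\<bar>)"
  have [measurable]: "Z \<in> borel_measurable M" "A \<in> sets borel" using Z A by auto
  have m0: "0 \<le> m" by (simp add: m_def)
  show ?thesis
  proof (cases "m = 0")
    case True
    hence "AE x in M. \<bar>Z x\<bar> = 0"
      unfolding m_def using Z by (subst (asm) integral_nonneg_eq_0_iff_AE) auto
    hence "(LINT x|M. indicator A (T x) * Z x) = (LINT x|M. 0)"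
      by (intro integral_cong_AE) auto
    thus ?thesis by simp
  next
    case False
    hence m: "0 < m" using m0 by simp
    define w1 where "w1 x = (\<bar>Z x\<bar> + Z x) / m" for x
    define w2 where "w2 x = \<bar>Z x\<bar> / m" for x
    have [measurable]: "w1 \<in> borel_measurable M" "w2 \<in> borel_measurable M" unfolding w1_def w2_def by auto
    have w0: "0 \<le> w1 x" "0 \<le> w2 x" for x using m unfolding w1_def w2_def by auto
    have wi: "integrable M w1" "integrable M w2" using Z unfolding w1_def w2_def by auto
    have w: "w1 x = w2 x + Z x / m" for x by (simp add: w1_def w2_def add_divide_distrib)
    \<comment> \<open>The hypothesis at s = 0; it gives \<open>w1\<close> the same total mass as
      \<open>w2\<close>.\<close>
    have "(LINT x|M. Z x) = 0" using c[of 0] by simp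
    hence one: "(LINT x|M. w1 x) = 1" "(LINT x|M. w2 x) = 1"
      using m Z unfolding w1_def w2_def by (auto simp: m_def)
    have rd: "real_distribution (distr (density M (\<lambda>x. ennreal (w x))) borel T)"
      if "w \<in> borel_measurable M" "\<And>x. 0 \<le> w x" "integrable M w" "(LINT x|M. w x) = 1" for w
    proof -
      have "emeasure (density M (\<lambda>x. ennreal (w x))) (space (density M (\<lambda>x. ennreal (w x)))) = (\<integral>\<^sup>+x. ennreal (w x) \<partial>M)"
        using that by (simp add: emeasure_density cong: nn_integral_cong_simp)
      also have "\<dots> = 1" using that by (simp add: nn_integral_eq_integral)
      finally interpret D: prob_space "density M (\<lambda>x. ennreal (w x))" by (rule prob_spaceI)
      show ?thesis by (rule D.real_distribution_distr) simp
    qed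
    let ?D = "\<lambda>w. distr (density M (\<lambda>x. ennreal (w x))) borel T"
    have Zc: "(LINT x|M. Z x *\<^sub>R iexp (t * T x)) = 0" for t
    proof -
      have "(LINT x|M. Z x *\<^sub>R iexp (t * T x)) = (LINT x|M. complex_of_real (cos (t * T x) * Z x) + \<i> * complex_of_real (sin (t * T x) * Z x))"
      proof (intro Bochner_Integration.integral_cong refl)
        fix x
        show "Z x *\<^sub>R iexp (t * T x) = complex_of_real (cos (t * T x) * Z x) + \<i> * complex_of_real (sin (t * T x) * Z x)"
          by (subst iexp_eq_cos_sin) (simp add: scaleR_conv_of_real distrib_left mult_ac)
      qed
      also have "\<dots> = (LINT x|M. complex_of_real (cos (t * T x) * Z x)) + (LINT x|M. \<i> * complex_of_real (sin (t * T x) * Z x))"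
        using integrable_cos_mult[OF _ Z, of "\<lambda>x. t * T x"]
        by (intro Bochner_Integration.integral_add integrable_mult_right integrable_of_real) auto
      also have "\<dots> = 0"
        unfolding integral_mult_right_zero integral_complex_of_real c s by simp
      finally show ?thesis .
    qed
    have wb: "integrable M (\<lambda>x. w x *\<^sub>R g (T x))"
      if "integrable M w" "g \<in> borel_measurable borel" "\<And>x. norm (g x) \<le> 1"
      for w and g :: "real \<Rightarrow> 'b::{banach, second_countable_topology}"
    proof (rule Bochner_Integration.integrable_bound[OF that(1)])
      have [measurable]: "w \<in> borel_measurable M" "g \<in> borel_measurable borel" using that by auto
      show "(\<lambda>x. w x *\<^sub>R g (T x)) \<in> borel_measurable M" by simp
      show "AE x in M. norm (w x *\<^sub>R g (T x)) \<le> norm (w x)"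
        using that(3) by (auto simp: mult_left_le)
    qed
    have "?D w1 = ?D w2"
    proof (rule Levy_uniqueness)
      show "char (?D w1) = char (?D w2)"
      proof
        fix t
        have "char (?D w1) t = (LINT x|M. w1 x *\<^sub>R iexp (t * T x))"
          unfolding char_def by (rule integral_distr_density) (use w0 in auto)
        also have "\<dots> = (LINT x|M. w2 x *\<^sub>R iexp (t * T x) + (Z x *\<^sub>R iexp (t * T x)) / complex_of_real m)"
          by (intro Bochner_Integration.integral_cong) (auto simp: w scaleR_conv_of_real algebra_simps)
        also have "\<dots> = (LINT x|M. w2 x *\<^sub>R iexp (t * T x)) + (LINT x|M. (Z x *\<^sub>R iexp (t * T x)) / complex_of_real m)"
          using wb[OF wi(2), of "\<lambda>x. iexp (t * x)"] wb[OF Z, of "\<lambda>x. iexp (t * x)"]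
          by (intro Bochner_Integration.integral_add) auto
        also have "\<dots> = (LINT x|M. w2 x *\<^sub>R iexp (t * T x))"
          using Zc by simp
        also have "\<dots> = char (?D w2) t"
          unfolding char_def by (rule integral_distr_density[symmetric]) (use w0 in auto)
        finally show "char (?D w1) t = char (?D w2) t" .
      qed
    qed (use rd w0 wi one in auto)
    hence "(LINT x|?D w1. indicator A x :: real) = (LINT x|?D w2. indicator A x)" by simp
    hence "(LINT x|M. w1 x *\<^sub>R (indicator A (T x) :: real)) = (LINT x|M. w2 x *\<^sub>R indicator A (T x))"
      by (subst (asm) (1 2) integral_distr_density) (use w0 in auto)
    hence "(LINT x|M. w1 x *\<^sub>R (indicator A (T x) :: real) - w2 x *\<^sub>R indicator A (T x)) = 0"
      using wb[OF wi(1), of "indicator A :: real \<Rightarrow> real"] wb[OF wi(2), of "indicator A :: real \<Rightarrow> real"]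
      by (subst Bochner_Integration.integral_diff) (auto simp: indicator_def)
    moreover have "w1 x *\<^sub>R (indicator A (T x) :: real) - w2 x *\<^sub>R indicator A (T x) = indicator A (T x) * Z x / m" for x
      by (simp add: w algebra_simps)
    ultimately show ?thesis using m by simp
  qed
qed

end

section \<open>The inner product\<close>

lemma discriminant_le_of_nonneg:
  fixes A B C :: real
  assumes q: "\<And>a b. 0 \<le> a\<^sup>2 * A + 2 * a * b * C + b\<^sup>2 * B"
  shows "C\<^sup>2 \<le> A * B"
proof (cases "B = 0")
  case True
  have "C = 0"
  proof (rule ccontr)
    assume n: "C \<noteq> 0"
    \<comment> \<open>With B = 0 the form is affine in \<open>b\<close>; this \<open>b\<close> is
      where it would take the value -1.\<close>
    have "0 \<le> A + 2 * (- (A + 1) / (2 * C)) * C"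
      using q[of 1 "- (A + 1) / (2 * C)"] True by simp
    also have "2 * (- (A + 1) / (2 * C)) * C = - (A + 1)" using n by (simp add: field_simps)
    finally show False by simp
  qed
  thus ?thesis using True by simp
next
  case False
  hence p: "0 < B" using q[of 0 1] by simp
  have "0 \<le> B\<^sup>2 * A - 2 * B * C * C + C\<^sup>2 * B"
    using q[of B "- C"] by simp
  also have "\<dots> = B * (A * B - C\<^sup>2)" by (simp add: power2_eq_square algebra_simps)
  finally show ?thesis using p by (simp add: zero_le_mult_iff)
qed

lemma ennreal_two_mult_le_squares: "2 * (x * y) \<le> x * x + y * (y::ennreal)"
proof (cases x; cases y)
  fix a b :: real assume "x = ennreal a" "y = ennreal b" "0 \<le> a" "0 \<le> b"
  moreover have "2 * (a * b) \<le> a * a + b * b" using sum_squares_bound[of a b] by (simp add: power2_eq_square)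
  ultimately show ?thesis
    by (simp flip: ennreal_mult ennreal_plus add: ennreal_mult[symmetric] ennreal_numeral[symmetric] del: ennreal_numeral)
qed auto

text \<open>A kernel of the form \<open>\<integral> k s p * k t p \<partial>N\<close> is positive definite.\<close>

lemma (in pair_sigma_finite) nn_integral_factorized_kernel:
  assumes [measurable]: "(\<lambda>(s, p). k s p) \<in> borel_measurable (M1 \<Otimes>\<^sub>M M2)"
    "a \<in> borel_measurable M1" "b \<in> borel_measurable M1"
  shows "(\<integral>\<^sup>+s. \<integral>\<^sup>+t. a s * b t * (\<integral>\<^sup>+p. k s p * k t p \<partial>M2) \<partial>M1 \<partial>M1)
    = (\<integral>\<^sup>+p. (\<integral>\<^sup>+s. a s * k s p \<partial>M1) * (\<integral>\<^sup>+t. b t * k t p \<partial>M1) \<partial>M2)"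
proof -
  have [measurable]: "(\<lambda>p. k s p) \<in> borel_measurable M2" if "s \<in> space M1" for s
    using that by measurable
  have [measurable]: "(\<lambda>s. k s p) \<in> borel_measurable M1" if "p \<in> space M2" for p
    using that by measurable
  have "(\<integral>\<^sup>+s. \<integral>\<^sup>+t. a s * b t * (\<integral>\<^sup>+p. k s p * k t p \<partial>M2) \<partial>M1 \<partial>M1)
    = (\<integral>\<^sup>+s. \<integral>\<^sup>+t. \<integral>\<^sup>+p. a s * k s p * (b t * k t p) \<partial>M2 \<partial>M1 \<partial>M1)"
    by (intro nn_integral_cong) (simp add: nn_integral_cmult[symmetric] mult_ac)
  also have "\<dots> = (\<integral>\<^sup>+s. \<integral>\<^sup>+p. \<integral>\<^sup>+t. a s * k s p * (b t * k t p) \<partial>M1 \<partial>M2 \<partial>M1)"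
    by (intro nn_integral_cong Fubini'[symmetric]) measurable
  also have "\<dots> = (\<integral>\<^sup>+s. \<integral>\<^sup>+p. a s * k s p * (\<integral>\<^sup>+t. b t * k t p \<partial>M1) \<partial>M2 \<partial>M1)"
    by (intro nn_integral_cong nn_integral_cmult) measurable
  also have "\<dots> = (\<integral>\<^sup>+p. \<integral>\<^sup>+s. a s * k s p * (\<integral>\<^sup>+t. b t * k t p \<partial>M1) \<partial>M1 \<partial>M2)"
    by (intro Fubini'[symmetric]) measurable
  also have "\<dots> = (\<integral>\<^sup>+p. (\<integral>\<^sup>+s. a s * k s p \<partial>M1) * (\<integral>\<^sup>+t. b t * k t p \<partial>M1) \<partial>M2)"
    by (intro nn_integral_cong nn_integral_multc) measurable
  finally show ?thesis .
qed

section \<open>The form with values in [0, \<infinity>] and the factorization of the kernel\<close>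

abbreviation lborel2 :: "(real \<times> real) measure" where
  "lborel2 \<equiv> lborel \<Otimes>\<^sub>M lborel"

text \<open>Extended nonnegative values let Tonelli apply without any finiteness. The integrals run
  over the whole line, and restriction to the half line is left to the arguments.\<close>

definition theta_nn :: "real \<Rightarrow> (real \<Rightarrow> ennreal) \<Rightarrow> (real \<Rightarrow> ennreal) \<Rightarrow> ennreal" where
  "theta_nn H a b = (\<integral>\<^sup>+s. \<integral>\<^sup>+t. a s * b t * ennreal (theta H s t) \<partial>lborel \<partial>lborel)"

lemma theta_measurable [measurable]: "(\<lambda>(s, t). theta H s t) \<in> borel_measurable (borel \<Otimes>\<^sub>M borel)"
  unfolding theta_def by measurable

lemma theta_sym: "theta H s t = theta H t s"
  unfolding theta_def by (simp add: abs_minus_commute)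

locale hurst =
  fixes H :: real
  assumes H: "1/2 < H" "H < 1"
begin

lemma theta_nonneg: "0 \<le> theta H s t"
  unfolding theta_def using H by (intro mult_nonneg_nonneg) auto

text \<open>With \<alpha> = 2 - 2 H, the power |s - t|^(-\<alpha>) is a mixture of triangle
  functions: the integral of max 0 (r - |s - t|) r^(-\<alpha> - 2) over r > 0 equals |s -
  t|^(-\<alpha>) / (\<alpha> (\<alpha> + 1)). Each triangle is the overlap, over x, of the
  conditions that s and t lie in [x, x + r]. The factor (2 - 2 H) (3 - 2 H) is \<alpha> (\<alpha> +
  1), and the square root splits the weight evenly between s and t.\<close>

definition theta_sqrt :: "real \<Rightarrow> real \<times> real \<Rightarrow> real" where
  "theta_sqrt s = (\<lambda>(r, x). sqrt (H * (2 * H - 1) * ((2 - 2 * H) * (3 - 2 * H)) * r powr (2 * H - 4)) * indicator {0<..} r * indicator {x..x + r} s)"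

lemma theta_sqrt_measurable [measurable]:
  "(\<lambda>(s, p). theta_sqrt s p) \<in> borel_measurable (lborel \<Otimes>\<^sub>M lborel2)"
  unfolding theta_sqrt_def indicator_def atLeastAtMost_iff by measurable

text \<open>The set of \<open>x\<close> with \<open>{s, t} \<subseteq> {x..x + r}\<close> has measure \<open>max 0 (r - \<bar>s - t\<bar>)\<close>.\<close>

lemma theta_factorization:
  assumes "s \<noteq> t"
  shows "ennreal (theta H s t) = (\<integral>\<^sup>+p. ennreal (theta_sqrt s p) * ennreal (theta_sqrt t p) \<partial>lborel2)"
proof -
  define d where "d = \<bar>s - t\<bar>"
  define \<alpha> where "\<alpha> = 2 - 2 * H"
  define C where "C = H * (2 * H - 1) * (\<alpha> * (\<alpha> + 1))"
  have d: "0 < d" using assms by (simp add: d_def)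
  have \<alpha>: "0 < \<alpha>" using H by (simp add: \<alpha>_def)
  have C0: "0 \<le> H * (2 * H - 1)" "0 \<le> C" using H \<alpha> by (auto simp: C_def)
  let ?f = "\<lambda>r. C * (r - d) * r powr (-\<alpha> - 2)"
  let ?F = "\<lambda>r. C * (d * r powr (-\<alpha> - 1) / (\<alpha> + 1) - r powr (-\<alpha>) / \<alpha>)"
  have sq: "theta_sqrt s (r, x) = sqrt (C * r powr (-\<alpha> - 2)) * indicator {0<..} r * indicator {x..x + r} s" for s r x
    by (simp add: theta_sqrt_def C_def \<alpha>_def)
  have prod: "ennreal (theta_sqrt s (r, x)) * ennreal (theta_sqrt t (r, x)) =
      ennreal (C * r powr (-\<alpha> - 2)) * indicator {0<..} r * indicator {max s t - r..min s t} x" for r x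
  proof -
    have "ennreal (theta_sqrt s (r, x)) * ennreal (theta_sqrt t (r, x)) = ennreal (theta_sqrt s (r, x) * theta_sqrt t (r, x))"
      using C0 by (intro ennreal_mult[symmetric]) (auto simp: sq)
    also have "theta_sqrt s (r, x) * theta_sqrt t (r, x) = C * r powr (-\<alpha> - 2) * indicator {0<..} r * indicator {max s t - r..min s t} x"
      using C0 by (auto simp: sq indicator_def)
    also have "ennreal \<dots> = ennreal (C * r powr (-\<alpha> - 2)) * indicator {0<..} r * indicator {max s t - r..min s t} x"
      by (auto simp: indicator_def)
    finally show ?thesis .
  qed
  have "(\<integral>\<^sup>+p. ennreal (theta_sqrt s p) * ennreal (theta_sqrt t p) \<partial>lborel2)
    = (\<integral>\<^sup>+r. \<integral>\<^sup>+x. ennreal (theta_sqrt s (r, x)) * ennreal (theta_sqrt t (r, x)) \<partial>lborel \<partial>lborel)"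
    by (rule lborel.nn_integral_fst[symmetric]) measurable
  also have "\<dots> = (\<integral>\<^sup>+r. ennreal (?f r) * indicator {d..} r \<partial>lborel)"
  proof (intro nn_integral_cong)
    fix r :: real
    have "(\<integral>\<^sup>+x. ennreal (theta_sqrt s (r, x)) * ennreal (theta_sqrt t (r, x)) \<partial>lborel)
      = ennreal (C * r powr (-\<alpha> - 2)) * indicator {0<..} r * emeasure lborel {max s t - r..min s t}"
      unfolding prod by (subst nn_integral_cmult) auto
    also have "\<dots> = ennreal (?f r) * indicator {d..} r"
    proof (cases "d \<le> r")
      case True
      hence "max s t - r \<le> min s t" "min s t - (max s t - r) = r - d" by (auto simp: d_def max_def min_def abs_if split: if_splits)
      thus ?thesis using True d C0 by (simp add: ennreal_mult[symmetric] mult_ac)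
    next
      case False
      hence "\<not> max s t - r \<le> min s t" by (auto simp: d_def max_def min_def abs_if split: if_splits)
      thus ?thesis using False by simp
    qed
    finally show "(\<integral>\<^sup>+x. ennreal (theta_sqrt s (r, x)) * ennreal (theta_sqrt t (r, x)) \<partial>lborel) = ennreal (?f r) * indicator {d..} r" .
  qed
  \<comment> \<open>\<open>?F\<close> is an antiderivative of \<open>?f\<close>; both of its powers
    are negative, so it vanishes at infinity and only the endpoint \<open>d\<close>
    contributes.\<close>
  also have "\<dots> = ennreal (0 - ?F d)"
  proof (rule nn_integral_FTC_atLeast[where F="?F"])
    fix r assume r: "d \<le> r"
    have r0: "0 < r" using d r by simp
    have e: "r powr (-\<alpha> - 1) = r * r powr (-\<alpha> - 2)"
    proof -
      have e: "1 + (-\<alpha> - 2) = -\<alpha> - 1" by simp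
      show ?thesis using r0 powr_add[of r 1 "-\<alpha> - 2"] unfolding e by simp
    qed
    have D: "((\<lambda>r. r powr (-\<alpha> - 1)) has_field_derivative (-\<alpha> - 1) * r powr (-\<alpha> - 2)) (at r)"
       "((\<lambda>r. r powr (-\<alpha>)) has_field_derivative (-\<alpha>) * r powr (-\<alpha> - 1)) (at r)"
      using has_real_derivative_powr[OF r0, of "-\<alpha> - 1"] has_real_derivative_powr[OF r0, of "-\<alpha>"] by (simp_all add: diff_diff_eq)
    have "(?F has_field_derivative C * (d * ((-\<alpha> - 1) * r powr (-\<alpha> - 2)) / (\<alpha> + 1) - (-\<alpha>) * r powr (-\<alpha> - 1) / \<alpha>)) (at r)"
      by (intro DERIV_cmult DERIV_diff DERIV_cdivide D)
    moreover have "d * ((-\<alpha> - 1) * r powr (-\<alpha> - 2)) / (\<alpha> + 1) = - (d * r powr (-\<alpha> - 2))"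
      using \<alpha> by (simp add: field_simps)
    moreover have "(-\<alpha>) * r powr (-\<alpha> - 1) / \<alpha> = - (r * r powr (-\<alpha> - 2))"
      using \<alpha> unfolding e by simp
    moreover have "C * (- (d * q) - (- (r * q))) = C * (r - d) * q" for q
      by (simp add: algebra_simps)
    ultimately show "(?F has_field_derivative ?f r) (at r)" by (simp only:)
    show "0 \<le> ?f r" using r C0 by (intro mult_nonneg_nonneg) auto
  next
    show "(?F \<longlongrightarrow> 0) at_top" using \<alpha> by real_asymp
  qed simp
  also have "0 - ?F d = theta H s t"
  proof -
    have e: "d powr (-\<alpha> - 1) * d = d powr (-\<alpha>)" using d powr_add[of d "-\<alpha> - 1" 1] by simp
    have "0 - ?F d = C * (d powr (-\<alpha>) / \<alpha> - (d powr (-\<alpha> - 1) * d) / (\<alpha> + 1))" by (simp add: algebra_simps)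
    also have "\<dots> = C / (\<alpha> * (\<alpha> + 1)) * d powr (-\<alpha>)" unfolding e using \<alpha> by (simp add: field_simps)
    also have "C / (\<alpha> * (\<alpha> + 1)) = H * (2 * H - 1)" using \<alpha> unfolding C_def by simp
    finally show ?thesis by (simp add: theta_def d_def \<alpha>_def)
  qed
  finally show ?thesis ..
qed

lemma theta_nn_factorized:
  assumes [measurable]: "a \<in> borel_measurable borel" "b \<in> borel_measurable borel"
  shows "theta_nn H a b = (\<integral>\<^sup>+p. (\<integral>\<^sup>+s. a s * ennreal (theta_sqrt s p) \<partial>lborel) * (\<integral>\<^sup>+t. b t * ennreal (theta_sqrt t p) \<partial>lborel) \<partial>lborel2)"
proof -
  interpret P: pair_sigma_finite lborel "lborel2"
    unfolding lborel_prod ..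
  have "theta_nn H a b = (\<integral>\<^sup>+s. \<integral>\<^sup>+t. a s * b t * (\<integral>\<^sup>+p. ennreal (theta_sqrt s p) * ennreal (theta_sqrt t p) \<partial>lborel2) \<partial>lborel \<partial>lborel)"
    unfolding theta_nn_def
  proof (rule nn_integral_cong, rule nn_integral_cong_AE)
    fix s :: real
    \<comment> \<open>The factorization is available off the diagonal, and for fixed
      \<open>s\<close> the diagonal is a single point.\<close>
    show "AE t in lborel. a s * b t * ennreal (theta H s t) = a s * b t * (\<integral>\<^sup>+p. ennreal (theta_sqrt s p) * ennreal (theta_sqrt t p) \<partial>lborel2)"
      using AE_lborel_singleton[of s] by eventually_elim (simp add: theta_factorization)
  qed
  also have "\<dots> = (\<integral>\<^sup>+p. (\<integral>\<^sup>+s. a s * ennreal (theta_sqrt s p) \<partial>lborel) * (\<integral>\<^sup>+t. b t * ennreal (theta_sqrt t p) \<partial>lborel) \<partial>lborel2)"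
    by (rule P.nn_integral_factorized_kernel) measurable
  finally show ?thesis .
qed

text \<open>After factorization all three terms are integrals over the same parameter
  \<open>p\<close>, where 2 x y \<le> x^2 + y^2 holds pointwise. This plays the role of
  Cauchy-Schwarz before finiteness is known.\<close>

lemma theta_nn_amgm:
  assumes [measurable]: "a \<in> borel_measurable borel" "b \<in> borel_measurable borel"
  shows "2 * theta_nn H a b \<le> theta_nn H a a + theta_nn H b b"
proof -
  let ?\<Phi> = "\<lambda>a p. \<integral>\<^sup>+s. a s * ennreal (theta_sqrt s p) \<partial>lborel"
  have [measurable]: "?\<Phi> a \<in> borel_measurable lborel2" if [measurable]: "a \<in> borel_measurable borel" for a
    by measurable
  have "2 * theta_nn H a b = (\<integral>\<^sup>+p. 2 * (?\<Phi> a p * ?\<Phi> b p) \<partial>lborel2)"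
    by (subst nn_integral_cmult) (simp_all add: theta_nn_factorized)
  also have "\<dots> \<le> (\<integral>\<^sup>+p. ?\<Phi> a p * ?\<Phi> a p + ?\<Phi> b p * ?\<Phi> b p \<partial>lborel2)"
    by (intro nn_integral_mono ennreal_two_mult_le_squares)
  also have "\<dots> = theta_nn H a a + theta_nn H b b"
    by (subst nn_integral_add) (simp_all add: theta_nn_factorized)
  finally show ?thesis .
qed

section \<open>The signed form as a semi-inner product\<close>

abbreviation theta_abs :: "(real \<Rightarrow> real) \<Rightarrow> (real \<Rightarrow> real) \<Rightarrow> ennreal" where
  "theta_abs u v \<equiv> theta_nn H (\<lambda>s. ennreal \<bar>u s\<bar>) (\<lambda>s. ennreal \<bar>v s\<bar>)"

definition theta_fin :: "(real \<Rightarrow> real) set" where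
  "theta_fin = {u \<in> borel_measurable borel. theta_abs u u < \<infinity>}"

text \<open>A single integral over the plane reduces bilinearity and symmetry to integrability;
  \<open>theta_inner_on\<close> is recovered by Fubini.\<close>

definition ip :: "(real \<Rightarrow> real) \<Rightarrow> (real \<Rightarrow> real) \<Rightarrow> real" where
  "ip u v = integral\<^sup>L lborel2 (\<lambda>(s, t). u s * v t * theta H s t)"

lemma theta_fin_measurable [measurable_dest]: "u \<in> theta_fin \<Longrightarrow> u \<in> borel_measurable borel"
  by (simp add: theta_fin_def)

lemma theta_nn_abs:
  assumes [measurable]: "u \<in> borel_measurable borel" "v \<in> borel_measurable borel"
  shows "(\<integral>\<^sup>+p. ennreal (norm ((\<lambda>(s, t). u s * v t * theta H s t) p)) \<partial>lborel2) = theta_abs u v"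
  unfolding theta_nn_def using theta_nonneg
  by (subst lborel.nn_integral_fst[symmetric]) (auto simp: abs_mult ennreal_mult)

lemma integrable_theta:
  assumes u: "u \<in> theta_fin" and v: "v \<in> theta_fin"
  shows "integrable lborel2 (\<lambda>(s, t). u s * v t * theta H s t)"
proof (rule integrableI_bounded)
  have [measurable]: "u \<in> borel_measurable borel" "v \<in> borel_measurable borel" using u v by auto
  show "(\<lambda>(s, t). u s * v t * theta H s t) \<in> borel_measurable lborel2" by measurable
  have "2 * theta_abs u v < \<infinity>"
    using u v by (intro le_less_trans[OF theta_nn_amgm]) (auto simp: theta_fin_def)
  hence "theta_abs u v < \<infinity>"
    by (auto simp: ennreal_mult_less_top)
  thus "(\<integral>\<^sup>+p. ennreal (norm ((\<lambda>(s, t). u s * v t * theta H s t) p)) \<partial>lborel2) < \<infinity>"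
    by (subst theta_nn_abs) auto
qed

lemma theta_finI:
  assumes [measurable]: "u \<in> borel_measurable borel"
    and "integrable lborel2 (\<lambda>(s, t). u s * u t * theta H s t)"
  shows "u \<in> theta_fin"
  using assms(2) theta_nn_abs[of u u] unfolding theta_fin_def integrable_iff_bounded by simp

lemma theta_fin_mono:
  assumes "v \<in> theta_fin" and [measurable]: "u \<in> borel_measurable borel" and le: "\<And>s. \<bar>u s\<bar> \<le> \<bar>v s\<bar>"
  shows "u \<in> theta_fin"
proof -
  have "theta_abs u u \<le> theta_abs v v"
    unfolding theta_nn_def using le by (intro nn_integral_mono mult_mono ennreal_leI) auto
  also have "\<dots> < \<infinity>" using assms(1) by (simp add: theta_fin_def)
  finally show ?thesis by (simp add: theta_fin_def)
qed

lemma theta_fin_lincomb: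
  assumes u: "u \<in> theta_fin" and v: "v \<in> theta_fin"
  shows "(\<lambda>x. a * u x + b * v x) \<in> theta_fin"
proof (rule theta_finI)
  have [measurable]: "u \<in> borel_measurable borel" "v \<in> borel_measurable borel" using u v by auto
  show "(\<lambda>x. a * u x + b * v x) \<in> borel_measurable borel" by measurable
  have "integrable lborel2 (\<lambda>p. a * a * (\<lambda>(s, t). u s * u t * theta H s t) p + a * b * (\<lambda>(s, t). u s * v t * theta H s t) p
      + (b * a * (\<lambda>(s, t). v s * u t * theta H s t) p + b * b * (\<lambda>(s, t). v s * v t * theta H s t) p))"
    using u v by (intro Bochner_Integration.integrable_add integrable_mult_right integrable_theta)
  thus "integrable lborel2 (\<lambda>(s, t). (a * u s + b * v s) * (a * u t + b * v t) * theta H s t)"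
    by (rule Bochner_Integration.integrable_cong[THEN iffD1, rotated -1]) (auto simp: algebra_simps)
qed

lemma theta_fin_diff: "u \<in> theta_fin \<Longrightarrow> v \<in> theta_fin \<Longrightarrow> (\<lambda>x. u x - v x) \<in> theta_fin"
  using theta_fin_lincomb[of u v 1 "-1"] by simp

lemma ip_sym: "u \<in> borel_measurable borel \<Longrightarrow> v \<in> borel_measurable borel \<Longrightarrow> ip u v = ip v u"
proof -
  assume [measurable]: "u \<in> borel_measurable borel" "v \<in> borel_measurable borel"
  have "ip u v = integral\<^sup>L lborel2 (\<lambda>(x, y). (\<lambda>(s, t). u s * v t * theta H s t) (y, x))"
    unfolding ip_def by (intro lborel_pair.integral_product_swap[symmetric]) measurable
  also have "\<dots> = ip v u"
    unfolding ip_def by (intro Bochner_Integration.integral_cong) (auto simp: theta_sym[of H])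
  finally show "ip u v = ip v u" .
qed

lemma ip_lincomb_right:
  assumes u: "u \<in> theta_fin" and v: "v \<in> theta_fin" and w: "w \<in> theta_fin"
  shows "ip w (\<lambda>x. a * u x + b * v x) = a * ip w u + b * ip w v"
proof -
  have "ip w (\<lambda>x. a * u x + b * v x) = (LINT p|lborel2. a * (\<lambda>(s, t). w s * u t * theta H s t) p + b * (\<lambda>(s, t). w s * v t * theta H s t) p)"
    unfolding ip_def by (intro Bochner_Integration.integral_cong) (auto simp: algebra_simps)
  also have "\<dots> = (LINT p|lborel2. a * (\<lambda>(s, t). w s * u t * theta H s t) p) + (LINT p|lborel2. b * (\<lambda>(s, t). w s * v t * theta H s t) p)"
    using u v w by (intro Bochner_Integration.integral_add integrable_mult_right integrable_theta)
  also have "\<dots> = a * ip w u + b * ip w v"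
    unfolding integral_mult_right_zero ip_def ..
  finally show ?thesis .
qed

lemma ip_lincomb_left:
  assumes u: "u \<in> theta_fin" and v: "v \<in> theta_fin" and w: "w \<in> theta_fin"
  shows "ip (\<lambda>x. a * u x + b * v x) w = a * ip u w + b * ip v w"
proof -
  have [measurable]: "u \<in> borel_measurable borel" "v \<in> borel_measurable borel" "w \<in> borel_measurable borel" using u v w by auto
  show ?thesis using ip_lincomb_right[OF assms, of a b] ip_sym[of w u] ip_sym[of w v] ip_sym[of w "\<lambda>x. a * u x + b * v x"] by simp
qed

lemma ip_lincomb_self:
  assumes u: "u \<in> theta_fin" and v: "v \<in> theta_fin"
  shows "ip (\<lambda>x. a * u x + b * v x) (\<lambda>x. a * u x + b * v x) = a\<^sup>2 * ip u u + 2 * a * b * ip u v + b\<^sup>2 * ip v v"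
  using ip_lincomb_left[OF u v theta_fin_lincomb[OF u v], of a b a b]
    ip_lincomb_right[OF u v u, of a b] ip_lincomb_right[OF u v v, of a b] ip_sym[of v u] u v
  by (simp add: theta_fin_measurable algebra_simps power2_eq_square)

text \<open>The factorization treats nonnegative functions only. For the positive part
  \<open>p\<close> and negative part \<open>n\<close> of \<open>u\<close>, the claim is precisely
  the inequality 2 \<open>ip p n\<close> \<le> \<open>ip p p\<close> + \<open>ip n n\<close>,
  available from \<open>theta_nn_amgm\<close>.\<close>

lemma ip_nonneg:
  assumes u: "u \<in> theta_fin"
  shows "0 \<le> ip u u"
proof -
  define p where "p x = max (u x) 0" for x
  define n where "n x = max (- u x) 0" for x
  have [measurable]: "u \<in> borel_measurable borel" using u by auto
  have [measurable]: "p \<in> borel_measurable borel" "n \<in> borel_measurable borel" unfolding p_def n_def by measurable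
  have pn: "p \<in> theta_fin" "n \<in> theta_fin"
    by (rule theta_fin_mono[OF u]; simp add: p_def n_def)+
  have nn: "ennreal (ip a b) = theta_nn H (\<lambda>s. ennreal (a s)) (\<lambda>s. ennreal (b s))" "0 \<le> ip a b"
    if ab: "a \<in> theta_fin" "b \<in> theta_fin" and nn: "\<And>x. 0 \<le> a x" "\<And>x. 0 \<le> b x" for a b
  proof -
    have [measurable]: "a \<in> borel_measurable borel" "b \<in> borel_measurable borel" using ab by auto
    have "ennreal (ip a b) = (\<integral>\<^sup>+p. ennreal ((\<lambda>(s, t). a s * b t * theta H s t) p) \<partial>lborel2)"
      unfolding ip_def using nn theta_nonneg
      by (intro nn_integral_eq_integral[symmetric] integrable_theta ab) auto
    also have "\<dots> = (\<integral>\<^sup>+p. ennreal (norm ((\<lambda>(s, t). a s * b t * theta H s t) p)) \<partial>lborel2)"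
      using nn theta_nonneg by (intro nn_integral_cong) (auto simp: abs_mult)
    also have "\<dots> = theta_nn H (\<lambda>s. ennreal (a s)) (\<lambda>s. ennreal (b s))"
      using nn by (subst theta_nn_abs) auto
    finally show "ennreal (ip a b) = theta_nn H (\<lambda>s. ennreal (a s)) (\<lambda>s. ennreal (b s))" .
    show "0 \<le> ip a b" unfolding ip_def using nn theta_nonneg by (intro Bochner_Integration.integral_nonneg) auto
  qed
  have p0: "0 \<le> p x" "0 \<le> n x" for x by (auto simp: p_def n_def)
  have "2 * ennreal (ip p n) \<le> ennreal (ip p p) + ennreal (ip n n)"
    using pn p0 by (simp add: nn theta_nn_amgm)
  hence "ennreal (2 * ip p n) \<le> ennreal (ip p p + ip n n)"
    using nn(2) pn p0 by (simp add: ennreal_mult)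
  hence "2 * ip p n \<le> ip p p + ip n n"
    using nn(2) pn p0 by (subst (asm) ennreal_le_iff) (auto intro!: add_nonneg_nonneg)
  moreover have "u = (\<lambda>x. 1 * p x + (-1) * n x)" by (auto simp: p_def n_def max_def)
  hence "ip u u = ip p p - 2 * ip p n + ip n n"
    using ip_lincomb_self[OF pn, of 1 "-1"] by simp
  ultimately show ?thesis by simp
qed

lemma ip_Cauchy_Schwarz:
  assumes u: "u \<in> theta_fin" and v: "v \<in> theta_fin"
  shows "(ip u v)\<^sup>2 \<le> ip u u * ip v v"
proof -
  have q: "0 \<le> a\<^sup>2 * ip u u + 2 * a * b * ip u v + b\<^sup>2 * ip v v" for a b
    using ip_nonneg[OF theta_fin_lincomb[OF u v, of a b]] unfolding ip_lincomb_self[OF u v] .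
  show ?thesis using q by (rule discriminant_le_of_nonneg)
qed

abbreviation ip_dist :: "(real \<Rightarrow> real) \<Rightarrow> (real \<Rightarrow> real) \<Rightarrow> real" where
  "ip_dist u v \<equiv> ip (\<lambda>x. u x - v x) (\<lambda>x. u x - v x)"

text \<open>Expanding around \<open>u\<close> leaves a term linear in the error, controlled by
  Cauchy-Schwarz, and the squared distance itself.\<close>

lemma ip_tendsto:
  assumes u: "u \<in> theta_fin" and g: "\<And>k. g k \<in> theta_fin"
    and lim: "(\<lambda>k. ip_dist (g k) u) \<longlonglongrightarrow> 0"
  shows "v \<in> theta_fin \<Longrightarrow> (\<lambda>k. ip v (g k)) \<longlonglongrightarrow> ip v u"
    and "(\<lambda>k. ip (g k) (g k)) \<longlonglongrightarrow> ip u u"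
proof -
  let ?e = "\<lambda>k x. g k x - u x"
  have e: "?e k \<in> theta_fin" for k using g u by (rule theta_fin_diff)
  have *: "(\<lambda>k. ip v (?e k)) \<longlonglongrightarrow> 0" if v: "v \<in> theta_fin" for v
  proof (rule Lim_null_comparison)
    have "\<bar>ip v (?e k)\<bar> \<le> sqrt (ip v v * ip (?e k) (?e k))" for k
      using ip_Cauchy_Schwarz[OF v e] by (intro real_le_rsqrt) simp
    thus "\<forall>\<^sub>F k in sequentially. norm (ip v (?e k)) \<le> sqrt (ip v v * ip (?e k) (?e k))" by simp
    show "(\<lambda>k. sqrt (ip v v * ip (?e k) (?e k))) \<longlonglongrightarrow> 0"
      using tendsto_real_sqrt[OF tendsto_mult_left[OF lim, of "ip v v"]] by simp
  qed
  have v: "ip v (g k) = ip v u + ip v (?e k)" if "v \<in> theta_fin" for v k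
    using ip_lincomb_right[OF u e that, of 1 1 k] by simp
  show "(\<lambda>k. ip v (g k)) \<longlonglongrightarrow> ip v u" if "v \<in> theta_fin"
    unfolding v[OF that] using tendsto_add[OF tendsto_const *[OF that]] by simp
  have "ip (g k) (g k) = ip u u + 2 * ip u (?e k) + ip (?e k) (?e k)" for k
    using ip_lincomb_self[OF u e, of 1 1 k] by simp
  moreover have "(\<lambda>k. ip u u + 2 * ip u (?e k) + ip (?e k) (?e k)) \<longlonglongrightarrow> ip u u + 2 * 0 + 0"
    by (intro tendsto_intros * u lim)
  ultimately show "(\<lambda>k. ip (g k) (g k)) \<longlonglongrightarrow> ip u u" by simp
qed

lemma theta_inner_on_eq_ip:
  assumes "(\<lambda>s. indicator A s * f s) \<in> theta_fin" "(\<lambda>s. indicator A s * g s) \<in> theta_fin"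
  shows "theta_inner_on H A f g = ip (\<lambda>s. indicator A s * f s) (\<lambda>s. indicator A s * g s)"
proof -
  have "ip (\<lambda>s. indicator A s * f s) (\<lambda>s. indicator A s * g s)
    = (LINT s|lborel. LINT t|lborel. (indicator A s * f s) * (indicator A t * g t) * theta H s t)"
    unfolding ip_def using lborel_pair.integral_fst'[OF integrable_theta[OF assms]] by simp
  also have "\<dots> = theta_inner_on H A f g"
    unfolding theta_inner_on_def set_lebesgue_integral_def
    by (intro Bochner_Integration.integral_cong refl, subst Bochner_Integration.integral_scaleR_right[symmetric])
       (auto simp: mult_ac)
  finally show ?thesis ..
qed

lemma theta_functions_indicator:
  assumes "f \<in> theta_functions H" "A \<subseteq> {0..}" "A \<in> sets borel"
  shows "(\<lambda>s. indicator A s * f s) \<in> theta_fin"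
proof (rule theta_fin_mono)
  have [measurable]: "f \<in> borel_measurable borel" "A \<in> sets borel" using assms by (auto simp: theta_functions_def)
  show "(\<lambda>s. indicator {0..} s * f s) \<in> theta_fin"
  proof -
    have "theta_nn H (\<lambda>s. ennreal \<bar>indicator {0..} s * f s\<bar>) (\<lambda>s. ennreal \<bar>indicator {0..} s * f s\<bar>)
      = (\<integral>\<^sup>+s\<in>{0..}. (\<integral>\<^sup>+t\<in>{0..}. ennreal (\<bar>f s\<bar> * \<bar>f t\<bar> * theta H s t) \<partial>lborel) \<partial>lborel)"
      unfolding theta_nn_def
    proof (rule nn_integral_cong)
      fix s :: real
      show "(\<integral>\<^sup>+t. ennreal \<bar>indicator {0..} s * f s\<bar> * ennreal \<bar>indicator {0..} t * f t\<bar> * ennreal (theta H s t) \<partial>lborel)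
        = (\<integral>\<^sup>+t\<in>{0..}. ennreal (\<bar>f s\<bar> * \<bar>f t\<bar> * theta H s t) \<partial>lborel) * indicator {0..} s"
        using theta_nonneg by (cases "0 \<le> s") (auto intro!: nn_integral_cong simp: indicator_def ennreal_mult)
    qed
    also have "\<dots> < \<infinity>" using assms by (simp add: theta_functions_def)
    finally show ?thesis by (simp add: theta_fin_def)
  qed
  show "(\<lambda>s. indicator A s * f s) \<in> borel_measurable borel" by measurable
qed (use assms in \<open>auto simp: indicator_def\<close>)

end

section \<open>Schwartz functions on the half line\<close>

lemma at_within_Ici_neq_bot: "0 \<le> x \<Longrightarrow> at x within {0..} \<noteq> (bot :: real filter)"
proof -
  assume "0 \<le> x"
  hence "at_right x \<le> at x within {0..}" by (intro at_le) auto
  thus ?thesis using trivial_limit_at_right_real[of x] by (metis bot.extremum_uniqueI)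
qed

lemma half_deriv_has_field_derivative:
  "f differentiable (at x within {0..}) \<Longrightarrow> (f has_field_derivative half_deriv f x) (at x within {0..})"
  unfolding half_deriv_def by (simp add: vector_derivative_works has_real_derivative_iff_has_vector_derivative)

lemma half_deriv_eqI:
  "0 \<le> x \<Longrightarrow> (f has_field_derivative D) (at x within {0..}) \<Longrightarrow> half_deriv f x = D"
  unfolding half_deriv_def
  by (intro vector_derivative_within at_within_Ici_neq_bot) (simp_all add: has_real_derivative_iff_has_vector_derivative)

text \<open>Iterated one-sided derivatives are only meaningful at nonnegative points. A family
  \<open>F\<close> that is closed under differentiation there identifies all of them at once,
  whatever happens on the negative axis.\<close>

lemma half_deriv_funpow_eqI:
  assumes "\<And>x. 0 \<le> x \<Longrightarrow> f x = F 0 x"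
    and "\<And>k x. 0 \<le> x \<Longrightarrow> (F k has_field_derivative F (Suc k) x) (at x within {0..})"
  shows "0 \<le> x \<Longrightarrow> (half_deriv ^^ k) f x = F k x"
    and "0 \<le> x \<Longrightarrow> (half_deriv ^^ k) f differentiable (at x within {0..})"
proof -
  have D: "((half_deriv ^^ k) f has_field_derivative F (Suc k) x) (at x within {0..})"
    if "\<And>x. 0 \<le> x \<Longrightarrow> (half_deriv ^^ k) f x = F k x" "0 \<le> x" for k x
    using that assms(2)[of x k] unfolding has_real_derivative_iff_has_vector_derivative
    by (intro has_vector_derivative_transform[of x "{0..}" "(half_deriv ^^ k) f" "F k"]) auto
  have *: "(half_deriv ^^ k) f x = F k x" if "0 \<le> x" for x k using that
  proof (induction k arbitrary: x)
    case (Suc k)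
    show ?case using half_deriv_eqI[OF Suc.prems D[OF Suc.IH Suc.prems]] by simp
  qed (use assms in simp)
  show "0 \<le> x \<Longrightarrow> (half_deriv ^^ k) f x = F k x" by (rule *)
  show "0 \<le> x \<Longrightarrow> (half_deriv ^^ k) f differentiable (at x within {0..})"
    unfolding real_differentiable_def using D[OF *] by blast
qed

lemma schwartz_has_field_derivative:
  "f \<in> schwartz \<Longrightarrow> 0 \<le> x \<Longrightarrow>
    ((half_deriv ^^ k) f has_field_derivative (half_deriv ^^ Suc k) f x) (at x within {0..})"
  using half_deriv_has_field_derivative[of "(half_deriv ^^ k) f" x] by (auto simp: schwartz_def)

lemma schwartz_neg: "f \<in> schwartz \<Longrightarrow> x < 0 \<Longrightarrow> f x = 0"
  by (simp add: schwartz_def)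

lemma schwartz_indicator: "f \<in> schwartz \<Longrightarrow> indicator {0..} x * f x = f x"
  by (cases "0 \<le> x") (auto simp: schwartz_neg)

lemma schwartz_bdd: "f \<in> schwartz \<Longrightarrow> bdd_above ((\<lambda>x. \<bar>x ^ m * (half_deriv ^^ k) f x\<bar>) ` {0..})"
proof -
  assume "f \<in> schwartz"
  then obtain a where "\<forall>y \<in> (\<lambda>x. x ^ m * (half_deriv ^^ k) f x) ` {0..}. norm y \<le> a"
    unfolding schwartz_def bounded_iff by blast
  thus ?thesis by (intro bdd_aboveI2[of _ _ a]) auto
qed

lemma schwartz_seminorm_upper:
  "f \<in> schwartz \<Longrightarrow> 0 \<le> x \<Longrightarrow> \<bar>x ^ m * (half_deriv ^^ k) f x\<bar> \<le> schwartz_seminorm m k f"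
  unfolding schwartz_seminorm_def by (intro cSUP_upper schwartz_bdd) auto

lemma schwartz_seminorm_nonneg: "f \<in> schwartz \<Longrightarrow> 0 \<le> schwartz_seminorm m k f"
  using schwartz_seminorm_upper[of f 0 m k] by (rule order_trans[OF abs_ge_zero]) auto

lemma schwartz_seminorm_le:
  "(\<And>x. 0 \<le> x \<Longrightarrow> \<bar>x ^ m * (half_deriv ^^ k) f x\<bar> \<le> C) \<Longrightarrow> schwartz_seminorm m k f \<le> C"
  unfolding schwartz_seminorm_def by (intro cSUP_least) auto

lemma schwartzI:
  assumes "\<And>x. x < 0 \<Longrightarrow> f x = 0" "\<And>x. 0 \<le> x \<Longrightarrow> f x = F 0 x"
    and "\<And>k x. 0 \<le> x \<Longrightarrow> (F k has_field_derivative F (Suc k) x) (at x within {0..})"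
    and "\<And>m k x. 0 \<le> x \<Longrightarrow> \<bar>x ^ m * F k x\<bar> \<le> C m k"
  shows "f \<in> schwartz"
proof -
  note F = half_deriv_funpow_eqI[of f F, OF assms(2,3)]
  have "bounded ((\<lambda>x. x ^ m * (half_deriv ^^ k) f x) ` {0..})" for m k
    unfolding bounded_iff using F(1) assms(4)[of _ m k] by (intro exI[of _ "C m k"]) auto
  thus ?thesis unfolding schwartz_def using F(2) assms(1) by blast
qed

lemma
  assumes f: "f \<in> schwartz" and g: "g \<in> schwartz"
  shows schwartz_lincomb: "(\<lambda>x. a * f x + b * g x) \<in> schwartz"
    and half_deriv_lincomb: "0 \<le> x \<Longrightarrow>
      (half_deriv ^^ k) (\<lambda>x. a * f x + b * g x) x = a * (half_deriv ^^ k) f x + b * (half_deriv ^^ k) g x"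
proof -
  let ?F = "\<lambda>k x. a * (half_deriv ^^ k) f x + b * (half_deriv ^^ k) g x"
  have D: "(?F k has_field_derivative ?F (Suc k) x) (at x within {0..})" if "0 \<le> x" for k x
    using that f g by (intro DERIV_add DERIV_cmult schwartz_has_field_derivative)
  show "(\<lambda>x. a * f x + b * g x) \<in> schwartz"
  proof (rule schwartzI[where F = ?F, OF _ _ D])
    fix m k and x :: real assume x: "0 \<le> x"
    have "\<bar>x ^ m * ?F k x\<bar> \<le> \<bar>a\<bar> * \<bar>x ^ m * (half_deriv ^^ k) f x\<bar> + \<bar>b\<bar> * \<bar>x ^ m * (half_deriv ^^ k) g x\<bar>"
      unfolding abs_mult[symmetric] by (rule order_trans[OF _ abs_triangle_ineq]) (simp add: algebra_simps)
    also have "\<dots> \<le> \<bar>a\<bar> * schwartz_seminorm m k f + \<bar>b\<bar> * schwartz_seminorm m k g"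
      using x f g by (intro add_mono mult_left_mono schwartz_seminorm_upper) auto
    finally show "\<bar>x ^ m * ?F k x\<bar> \<le> \<bar>a\<bar> * schwartz_seminorm m k f + \<bar>b\<bar> * schwartz_seminorm m k g" .
  qed (use f g in \<open>auto simp: schwartz_neg\<close>)
  show "0 \<le> x \<Longrightarrow> (half_deriv ^^ k) (\<lambda>x. a * f x + b * g x) x = a * (half_deriv ^^ k) f x + b * (half_deriv ^^ k) g x"
    by (rule half_deriv_funpow_eqI[where F = ?F, OF _ D]) auto
qed

lemma schwartz_scale: "f \<in> schwartz \<Longrightarrow> (\<lambda>x. a * f x) \<in> schwartz"
  using schwartz_lincomb[of f f a 0] by simp

lemma schwartz_add: "f \<in> schwartz \<Longrightarrow> g \<in> schwartz \<Longrightarrow> (\<lambda>x. f x + g x) \<in> schwartz"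
  using schwartz_lincomb[of f g 1 1] by simp

lemma schwartz_diff: "f \<in> schwartz \<Longrightarrow> g \<in> schwartz \<Longrightarrow> (\<lambda>x. f x - g x) \<in> schwartz"
  using schwartz_lincomb[of f g 1 "-1"] by simp

text \<open>The m-th power of 1 + y \<le> exp y at y = x / m.\<close>

lemma power_le_mult_exp: "0 \<le> x \<Longrightarrow> x ^ m \<le> real m ^ m * exp x" for x :: real
proof (cases "m = 0")
  case False
  assume x: "0 \<le> x"
  have "(x / real m) ^ m \<le> (exp (x / real m)) ^ m"
    using x exp_ge_add_one_self[of "x / real m"] by (intro power_mono) (linarith, simp)
  also have "\<dots> = exp x" using False by (simp add: exp_of_nat_mult[symmetric])
  finally show ?thesis using False by (simp add: power_divide divide_simps mult.commute)
qed auto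

text \<open>Linear combinations of these with integer rates, that is, polynomials in exp (- x)
  without constant term, are the approximants used for density.\<close>

lemma schwartz_exp:
  assumes "0 < c"
  shows "(\<lambda>x. if x < 0 then 0 else exp (- c * x)) \<in> schwartz"
proof (rule schwartzI[where F = "\<lambda>k x. (- c) ^ k * exp (- c * x)"])
  fix k and x :: real
  show "((\<lambda>x. (- c) ^ k * exp (- c * x)) has_field_derivative (- c) ^ Suc k * exp (- c * x)) (at x within {0..})"
    by (auto intro!: derivative_eq_intros)
next
  fix m k and x :: real assume x: "0 \<le> x"
  have "(c * x) ^ m \<le> real m ^ m * exp (c * x)" using x assms by (intro power_le_mult_exp) auto
  hence "x ^ m * exp (- c * x) \<le> real m ^ m / c ^ m"
    using assms by (simp add: power_mult_distrib exp_minus field_simps)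
  hence "c ^ k * (x ^ m * exp (- c * x)) \<le> c ^ k * (real m ^ m / c ^ m)"
    using assms by (intro mult_left_mono) auto
  thus "\<bar>x ^ m * ((- c) ^ k * exp (- c * x))\<bar> \<le> c ^ k * (real m ^ m / c ^ m)"
    using x assms by (simp add: abs_mult power_abs mult_ac)
qed auto

lemma schwartz_zero: "(\<lambda>x. 0) \<in> schwartz"
  using schwartz_scale[OF schwartz_exp[of 1], of 0] by simp

lemma schwartz_sum: "finite I \<Longrightarrow> (\<And>i. i \<in> I \<Longrightarrow> f i \<in> schwartz) \<Longrightarrow> (\<lambda>x. \<Sum>i\<in>I. f i x) \<in> schwartz"
  by (induction I rule: finite_induct) (simp_all add: schwartz_zero schwartz_add)

lemma schwartz_borel_measurable [measurable_dest]:
  assumes "f \<in> schwartz"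
  shows "f \<in> borel_measurable borel"
proof -
  have "continuous_on {0..} f"
    using schwartz_has_field_derivative[OF assms, of _ 0] by (auto simp: continuous_on_eq_continuous_within intro: DERIV_continuous)
  hence "(\<lambda>x. indicator {0..} x *\<^sub>R f x) \<in> borel_measurable borel"
    by (intro borel_measurable_continuous_on_indicator) auto
  thus ?thesis unfolding real_scaleR_def schwartz_indicator[OF assms] .
qed

text \<open>Expanding (1 + x)^2 |f| gives the seminorms of orders 0, 1 and 2. The quadratic weight
  provides an integrable majorant, and the same constant bounds the supremum.\<close>

lemma schwartz_abs_bound:
  assumes "f \<in> schwartz"
  obtains C where "0 \<le> C" "\<And>x. \<bar>f x\<bar> \<le> C * (1 / (1 + x)\<^sup>2) * indicator {0..} x" "\<And>x. \<bar>f x\<bar> \<le> C"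
proof -
  define b where "b m = schwartz_seminorm m 0 f" for m
  have b: "0 \<le> b m" for m using schwartz_seminorm_nonneg[OF assms] by (simp add: b_def)
  have u: "\<bar>x ^ m * f x\<bar> \<le> b m" if "0 \<le> x" for m x
    using schwartz_seminorm_upper[OF assms that, of m 0] by (simp add: b_def)
  show ?thesis
  proof (rule that[of "b 0 + 2 * b 1 + b 2"])
    show "0 \<le> b 0 + 2 * b 1 + b 2" using b[of 0] b[of 1] b[of 2] by simp
    show "\<bar>f x\<bar> \<le> (b 0 + 2 * b 1 + b 2) * (1 / (1 + x)\<^sup>2) * indicator {0..} x" for x
    proof (cases "0 \<le> x")
      case True
      have "(1 + x)\<^sup>2 * \<bar>f x\<bar> = \<bar>x ^ 0 * f x\<bar> + 2 * \<bar>x ^ 1 * f x\<bar> + \<bar>x ^ 2 * f x\<bar>"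
        using True by (simp add: abs_mult power2_eq_square algebra_simps)
      also have "\<dots> \<le> b 0 + 2 * b 1 + b 2" using True by (intro add_mono mult_left_mono u) auto
      finally show ?thesis using True by (simp add: field_simps add_pos_nonneg)
    qed (use schwartz_neg[OF assms] in auto)
    show "\<bar>f x\<bar> \<le> b 0 + 2 * b 1 + b 2" for x
      using u[of x 0] b[of 0] b[of 1] b[of 2] schwartz_neg[OF assms, of x] by (cases "0 \<le> x") auto
  qed
qed

lemma nn_integral_inverse_square: "(\<integral>\<^sup>+x. ennreal (1 / (1 + x)\<^sup>2) * indicator {0..} x \<partial>lborel) = 1"
proof -
  have "(\<integral>\<^sup>+x. ennreal (1 / (1 + x)\<^sup>2) * indicator {0..} x \<partial>lborel) = ennreal (0 - (- 1 / (1 + 0)))"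
  proof (rule nn_integral_FTC_atLeast[where F = "\<lambda>x. - 1 / (1 + x)"])
    show "((\<lambda>x. - 1 / (1 + x)) has_field_derivative 1 / (1 + x)\<^sup>2) (at x)" if "0 \<le> x" for x :: real
      using that by (auto intro!: derivative_eq_intros simp: power2_eq_square)
    show "((\<lambda>x::real. - 1 / (1 + x)) \<longlongrightarrow> 0) at_top" by real_asymp
  qed auto
  thus ?thesis by simp
qed

section \<open>Estimates of the form by supremum and L1 norms\<close>

context hurst
begin

text \<open>The mass of the kernel within distance 1 of the diagonal, the same at every point by
  translation invariance.\<close>

definition near_const :: ennreal where
  "near_const = (\<integral>\<^sup>+x. ennreal (theta H 0 x) * indicator {-1..1} x \<partial>lborel)"

text \<open>The singularity is integrable because 2 H - 2 > -1; both sides of 0 contribute the same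
  finite integral.\<close>

lemma near_const_finite: "near_const < \<infinity>"
proof -
  let ?c = "H * (2 * H - 1)"
  have c: "0 \<le> ?c" using H by simp
  define I where "I = integral {0..1} (\<lambda>x::real. x powr (2 * H - 2))"
  have "((\<lambda>x. x powr (2 * H - 2)) has_integral I) {0..1}"
    unfolding I_def using H by (intro integrable_integral integrable_on_powr_from_0) auto
  hence I: "(\<integral>\<^sup>+x. ennreal (indicator {0..1} x * x powr (2 * H - 2)) \<partial>lborel) = ennreal I"
    by (intro nn_integral_has_integral_lebesgue) auto
  hence I': "(\<integral>\<^sup>+x. ennreal (indicator {0..1} (- x) * (- x) powr (2 * H - 2)) \<partial>lborel) = ennreal I"
    using nn_integral_real_affine[of "\<lambda>x. ennreal (indicator {0..1} x * x powr (2 * H - 2))" "-1" 0] by simp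
  have "near_const \<le> (\<integral>\<^sup>+x. ennreal ?c * ennreal (indicator {0..1} x * x powr (2 * H - 2))
       + ennreal ?c * ennreal (indicator {0..1} (- x) * (- x) powr (2 * H - 2)) \<partial>lborel)"
    unfolding near_const_def
  proof (rule nn_integral_mono)
    fix x :: real
    show "ennreal (theta H 0 x) * indicator {-1..1} x \<le> ennreal ?c * ennreal (indicator {0..1} x * x powr (2 * H - 2))
       + ennreal ?c * ennreal (indicator {0..1} (- x) * (- x) powr (2 * H - 2))"
      using c by (cases "0 \<le> x") (auto simp: theta_def indicator_def ennreal_mult[symmetric])
  qed
  also have "\<dots> = ennreal ?c * ennreal I + ennreal ?c * ennreal I"
    by (subst nn_integral_add) (auto simp: nn_integral_cmult I I')
  also have "\<dots> < \<infinity>" by (simp add: ennreal_mult_less_top)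
  finally show ?thesis .
qed

text \<open>Within distance 1 of \<open>s\<close> the function is replaced by its bound
  \<open>M\<close>. Farther away the kernel is at most 1, since its exponent is negative and H (2 H
  - 1) < 1, and the L1 norm takes over.\<close>

lemma nn_integral_theta_le:
  assumes [measurable]: "u \<in> borel_measurable borel" and M: "\<And>x. \<bar>u x\<bar> \<le> M"
    and K: "(\<integral>\<^sup>+x. ennreal \<bar>u x\<bar> \<partial>lborel) \<le> K"
  shows "(\<integral>\<^sup>+t. ennreal \<bar>u t\<bar> * ennreal (theta H s t) \<partial>lborel) \<le> ennreal M * near_const + K"
proof -
  have near: "(\<integral>\<^sup>+t. ennreal (theta H s t) * indicator {-1..1} (s - t) \<partial>lborel) = near_const"
    unfolding near_const_def
    by (subst (2) nn_integral_real_affine[where c = "-1" and t = s]) (auto simp: theta_def abs_minus_commute)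
  have "(\<integral>\<^sup>+t. ennreal \<bar>u t\<bar> * ennreal (theta H s t) \<partial>lborel)
    \<le> (\<integral>\<^sup>+t. ennreal M * (ennreal (theta H s t) * indicator {-1..1} (s - t)) + ennreal \<bar>u t\<bar> \<partial>lborel)"
  proof (rule nn_integral_mono)
    fix t
    show "ennreal \<bar>u t\<bar> * ennreal (theta H s t) \<le> ennreal M * (ennreal (theta H s t) * indicator {-1..1} (s - t)) + ennreal \<bar>u t\<bar>"
    proof (cases "\<bar>s - t\<bar> \<le> 1")
      case True
      hence "s - t \<in> {-1..1}" by auto
      moreover have "ennreal \<bar>u t\<bar> * ennreal (theta H s t) \<le> ennreal M * ennreal (theta H s t)"
        using M by (intro mult_right_mono ennreal_leI) auto
      ultimately show ?thesis by (simp add: add_increasing2)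
    next
      case False
      have "\<bar>s - t\<bar> powr (2 * H - 2) \<le> \<bar>s - t\<bar> powr 0"
        using False H by (intro powr_mono) auto
      hence "theta H s t \<le> H * (2 * H - 1) * 1"
        unfolding theta_def using False H by (intro mult_left_mono) (auto split: if_splits)
      also have "H * (2 * H - 1) * 1 \<le> 1 * 1 * 1" using H by (intro mult_mono) auto
      finally have "ennreal \<bar>u t\<bar> * ennreal (theta H s t) \<le> ennreal \<bar>u t\<bar> * ennreal 1"
        by (intro mult_left_mono ennreal_leI) auto
      thus ?thesis by (simp add: add_increasing)
    qed
  qed
  also have "\<dots> = ennreal M * near_const + (\<integral>\<^sup>+x. ennreal \<bar>u x\<bar> \<partial>lborel)"
    by (subst nn_integral_add) (auto simp: nn_integral_cmult near)
  also have "\<dots> \<le> ennreal M * near_const + K" using K by (intro add_left_mono)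
  finally show ?thesis .
qed

lemma theta_nn_le:
  assumes [measurable]: "u \<in> borel_measurable borel" and M: "\<And>x. \<bar>u x\<bar> \<le> M"
    and K: "(\<integral>\<^sup>+x. ennreal \<bar>u x\<bar> \<partial>lborel) \<le> K"
  shows "theta_abs u u \<le> K * (ennreal M * near_const + K)"
proof -
  have "theta_abs u u
    = (\<integral>\<^sup>+s. ennreal \<bar>u s\<bar> * (\<integral>\<^sup>+t. ennreal \<bar>u t\<bar> * ennreal (theta H s t) \<partial>lborel) \<partial>lborel)"
    unfolding theta_nn_def by (simp add: nn_integral_cmult[symmetric] mult.assoc)
  also have "\<dots> \<le> (\<integral>\<^sup>+s. ennreal \<bar>u s\<bar> * (ennreal M * near_const + K) \<partial>lborel)"
    by (intro nn_integral_mono mult_left_mono nn_integral_theta_le[OF assms]) auto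
  also have "\<dots> = (\<integral>\<^sup>+s. ennreal \<bar>u s\<bar> \<partial>lborel) * (ennreal M * near_const + K)"
    by (rule nn_integral_multc) measurable
  also have "\<dots> \<le> K * (ennreal M * near_const + K)" using K by (intro mult_right_mono) auto
  finally show ?thesis .
qed

text \<open>The explicit bound matters as much as finiteness: a uniformly bounded sequence that
  tends to 0 in L1 also tends to 0 in the norm of the form.\<close>

lemma theta_finI_bounded:
  assumes [measurable]: "u \<in> borel_measurable borel" and M: "\<And>x. \<bar>u x\<bar> \<le> M"
    and K: "(\<integral>\<^sup>+x. ennreal \<bar>u x\<bar> \<partial>lborel) \<le> ennreal K"
  shows "u \<in> theta_fin" "0 \<le> M \<Longrightarrow> 0 \<le> K \<Longrightarrow> ip u u \<le> K * (M * enn2real near_const + K)"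
proof -
  have *: "ennreal K * (ennreal M * near_const + ennreal K) < \<infinity>"
    using near_const_finite by (simp add: ennreal_mult_less_top)
  have le: "theta_abs u u \<le> ennreal K * (ennreal M * near_const + ennreal K)"
    by (rule theta_nn_le[OF assms])
  show u: "u \<in> theta_fin"
    unfolding theta_fin_def using le_less_trans[OF le *] by simp
  assume p: "0 \<le> M" "0 \<le> K"
  have "ennreal (ip u u) \<le> ennreal (norm (ip u u))" by (intro ennreal_leI) simp
  also have "\<dots> \<le> (\<integral>\<^sup>+p. ennreal (norm ((\<lambda>(s, t). u s * u t * theta H s t) p)) \<partial>lborel2)"
    unfolding ip_def by (rule integral_norm_bound_ennreal[OF integrable_theta[OF u u]])
  also have "\<dots> = theta_abs u u" by (rule theta_nn_abs) auto
  also have "\<dots> \<le> ennreal K * (ennreal M * ennreal (enn2real near_const) + ennreal K)"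
    using le near_const_finite by simp
  also have "\<dots> = ennreal (K * (M * enn2real near_const + K))"
    using p by (simp add: ennreal_mult ennreal_plus)
  finally show "ip u u \<le> K * (M * enn2real near_const + K)"
    using p by (subst (asm) ennreal_le_iff) auto
qed

lemma schwartz_theta_fin:
  assumes "f \<in> schwartz"
  shows "f \<in> theta_fin"
proof -
  obtain C where C: "0 \<le> C" "\<And>x. \<bar>f x\<bar> \<le> C * (1 / (1 + x)\<^sup>2) * indicator {0..} x" "\<And>x. \<bar>f x\<bar> \<le> C"
    using schwartz_abs_bound[OF assms] by metis
  have "(\<integral>\<^sup>+x. ennreal \<bar>f x\<bar> \<partial>lborel) \<le> (\<integral>\<^sup>+x. ennreal C * (ennreal (1 / (1 + x)\<^sup>2) * indicator {0..} x) \<partial>lborel)"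
  proof (rule nn_integral_mono)
    fix x
    have "ennreal \<bar>f x\<bar> \<le> ennreal (C * (1 / (1 + x)\<^sup>2) * indicator {0..} x)" by (intro ennreal_leI C)
    also have "\<dots> = ennreal C * (ennreal (1 / (1 + x)\<^sup>2) * indicator {0..} x)"
      using C(1) by (auto simp: indicator_def ennreal_mult[symmetric])
    finally show "ennreal \<bar>f x\<bar> \<le> ennreal C * (ennreal (1 / (1 + x)\<^sup>2) * indicator {0..} x)" .
  qed
  also have "\<dots> = ennreal C" by (subst nn_integral_cmult) (auto simp: nn_integral_inverse_square)
  finally show ?thesis using assms C(3) by (intro theta_finI_bounded) auto
qed

lemma theta_inner_schwartz:
  assumes f: "f \<in> schwartz" and g: "g \<in> schwartz"
  shows "theta_inner H f g = ip f g"
  using theta_inner_on_eq_ip[of "{0..}" f g] f g unfolding schwartz_indicator[OF f] schwartz_indicator[OF g]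
  by (simp add: schwartz_theta_fin)

lemma schwartz_theta_functions:
  assumes "f \<in> schwartz"
  shows "f \<in> theta_functions H"
proof -
  have [measurable]: "f \<in> borel_measurable borel" using assms by auto
  have "(\<integral>\<^sup>+s\<in>{0..}. (\<integral>\<^sup>+t\<in>{0..}. ennreal (\<bar>f s\<bar> * \<bar>f t\<bar> * theta H s t) \<partial>lborel) \<partial>lborel)
    \<le> theta_abs f f"
    unfolding theta_nn_def using theta_nonneg
    by (intro nn_integral_mono) (auto intro!: nn_integral_mono simp: indicator_def ennreal_mult)
  also have "\<dots> < \<infinity>" using schwartz_theta_fin[OF assms] by (simp add: theta_fin_def)
  finally show ?thesis by (simp add: theta_functions_def)
qed

end

text \<open>In the variable \<open>y = exp (- x)\<close> this is the Weierstrass theorem for \<open>w (- ln y) / y\<close>.\<close>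

lemma schwartz_uniform_approx:
  fixes w :: "real \<Rightarrow> real"
  assumes cont: "continuous_on {0..} w" and neg: "\<And>x. x < 0 \<Longrightarrow> w x = 0"
    and big: "\<And>x. R \<le> x \<Longrightarrow> w x = 0" and R: "0 \<le> R" and e: "0 < e"
  obtains g where "g \<in> schwartz" "\<And>x. \<bar>w x - g x\<bar> \<le> e * (exp (- x) * indicator {0..} x)"
proof -
  define \<delta> where "\<delta> = exp (- R)"
  have \<delta>: "0 < \<delta>" "\<delta> \<le> 1" using R by (auto simp: \<delta>_def)
  \<comment> \<open>The maximum with \<delta> = exp (- R) keeps the logarithm and the division away
    from 0. Below \<delta> this changes nothing essential, because \<open>w\<close> vanishes from
    \<open>R\<close> on.\<close>
  define W where "W y = w (- ln (max y \<delta>)) / max y \<delta>" for y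
  have "continuous_on {0..1} (\<lambda>y. w (- ln (max y \<delta>)))"
  proof (rule continuous_on_compose2[OF cont])
    show "continuous_on {0..1} (\<lambda>y. - ln (max y \<delta>))"
      using \<delta> by (intro continuous_intros) auto
    show "(\<lambda>y. - ln (max y \<delta>)) ` {0..1} \<subseteq> {0..}" using \<delta> by (auto simp: max_def)
  qed
  hence W: "continuous_on {0..1} W"
    unfolding W_def using \<delta> by (intro continuous_intros) auto
  obtain p where "real_polynomial_function p" and p: "\<And>y. y \<in> {0..1} \<Longrightarrow> \<bar>W y - p y\<bar> < e"
    using Stone_Weierstrass_real_polynomial_function[OF _ W e] by auto
  then obtain a n where a: "p = (\<lambda>y. \<Sum>i\<le>n. a i * y ^ i)"
    unfolding real_polynomial_function_iff_sum by blast
  \<comment> \<open>The rate is \<open>i + 1\<close> rather than \<open>i\<close>: the additional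
    factor exp (- x) undoes the division by \<open>y\<close> and supplies the weight in the error
    bound.\<close>
  define g where "g x = (\<Sum>i\<le>n. a i * (if x < 0 then 0 else exp (- (real i + 1) * x)))" for x
  show ?thesis
  proof (rule that[of g])
    show "g \<in> schwartz" unfolding g_def by (intro schwartz_sum schwartz_scale schwartz_exp) auto
    fix x :: real
    show "\<bar>w x - g x\<bar> \<le> e * (exp (- x) * indicator {0..} x)"
    proof (cases "0 \<le> x")
      case True
      define y where "y = exp (- x)"
      have y: "y \<in> {0..1}" "0 < y" using True by (auto simp: y_def)
      have "w x = y * W y"
      proof (cases "x \<le> R")
        case True
        hence "max y \<delta> = y" by (simp add: y_def \<delta>_def)
        thus ?thesis using y by (simp add: W_def) (simp add: y_def)
      next
        case False
        hence "max y \<delta> = \<delta>" by (simp add: y_def \<delta>_def)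
        thus ?thesis using big[of x] big[of R] False by (simp add: W_def) (simp add: \<delta>_def)
      qed
      moreover have "g x = y * p y"
      proof -
        have "exp (- (real i + 1) * x) = y * y ^ i" for i
          by (simp add: y_def exp_of_nat_mult[symmetric] mult_exp_exp algebra_simps)
        thus ?thesis unfolding g_def a using True by (simp add: sum_distrib_left mult_ac)
      qed
      ultimately have "\<bar>w x - g x\<bar> = y * \<bar>W y - p y\<bar>"
        using y by (simp add: abs_mult right_diff_distrib[symmetric])
      also have "\<dots> \<le> y * e" using p[OF y(1)] y by (intro mult_left_mono) auto
      finally show ?thesis using True by (simp add: y_def mult.commute)
    qed (simp add: neg g_def)
  qed
qed

text \<open>A measurable function is an almost everywhere limit of continuous ones. Clamping to
  [-M, M] and cutting off keep the bound and a common bounded support, so dominated convergence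
  gives L1 convergence. Continuity is claimed only on the half line, as the indicator may jump at
  0.\<close>

lemma bounded_approx_continuous:
  fixes v :: "real \<Rightarrow> real"
  assumes [measurable]: "v \<in> borel_measurable borel" and M: "\<And>x. \<bar>v x\<bar> \<le> M"
    and supp: "\<And>x. x \<notin> {0..R} \<Longrightarrow> v x = 0"
  shows "\<exists>w. (\<forall>n::nat. w n \<in> borel_measurable borel \<and> continuous_on {0..} (w n)
      \<and> (\<forall>x. x \<notin> {0..R + 1} \<longrightarrow> w n x = 0) \<and> (\<forall>x. \<bar>w n x\<bar> \<le> M) \<and> integrable lborel (\<lambda>x. \<bar>w n x - v x\<bar>))
    \<and> (\<lambda>n. LINT x|lborel. \<bar>w n x - v x\<bar>) \<longlonglongrightarrow> 0"
proof -
  have "v \<in> borel_measurable lebesgue" by (rule measurable_completion) simp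
  hence "v measurable_on UNIV" by (rule lebesgue_measurable_imp_measurable_on_real) simp
  then obtain N G where N: "negligible N" and G: "\<And>n. continuous_on UNIV (G n)"
    and lim: "\<And>x. x \<notin> N \<Longrightarrow> (\<lambda>n. G n x) \<longlonglongrightarrow> v x"
    unfolding measurable_on_def by (auto simp: Ball_def)
  have M0: "0 \<le> M" using M[of 0] by simp
  \<comment> \<open>Equal to 1 up to \<open>R\<close> and linear down to 0 at
    \<open>R + 1\<close>.\<close>
  define cutoff where "cutoff x = max 0 (min 1 (R + 1 - x))" for x
  define w where "w n x = indicator {0..} x * (cutoff x * max (-M) (min M (G n x)))" for n x
  have [measurable]: "G n \<in> borel_measurable borel" for n using G by (intro borel_measurable_continuous_onI)
  have m[measurable]: "w n \<in> borel_measurable borel" for n unfolding w_def cutoff_def by measurable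
  have c: "continuous_on {0..} (w n)" for n
  proof -
    have "continuous_on {0..} (\<lambda>x. cutoff x * max (-M) (min M (G n x)))"
      unfolding cutoff_def by (intro continuous_intros continuous_on_subset[OF G]) auto
    thus ?thesis by (rule continuous_on_eq) (simp add: w_def)
  qed
  have s: "w n x = 0" if "x \<notin> {0..R + 1}" for n x
    using that by (auto simp: w_def cutoff_def indicator_def)
  have b: "\<bar>w n x\<bar> \<le> M" for n x
  proof -
    have "\<bar>w n x\<bar> \<le> 1 * (1 * M)" unfolding w_def abs_mult using M0
      by (intro mult_mono) (auto simp: cutoff_def indicator_def)
    thus ?thesis by simp
  qed
  have AE: "AE x in lborel. x \<notin> N"
    using AE_not_in[of N lebesgue] N by (simp add: negligible_iff_null_sets AE_completion_iff)
  have w: "(\<lambda>n. w n x) \<longlonglongrightarrow> v x" if "x \<notin> N" for x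
  proof -
    have "(\<lambda>n. w n x) \<longlonglongrightarrow> indicator {0..} x * (cutoff x * max (-M) (min M (v x)))"
      unfolding w_def by (intro tendsto_intros lim that)
    also have "indicator {0..} x * (cutoff x * max (-M) (min M (v x))) = v x"
    proof (cases "x \<in> {0..R}")
      case True
      thus ?thesis using M[of x] by (auto simp: cutoff_def)
    next
      case False
      thus ?thesis using supp[of x] M0 by simp
    qed
    finally show ?thesis .
  qed
  have i: "integrable lborel (\<lambda>x. 2 * M * indicator {0..R + 1} x)"
    by (intro integrable_mult_right integrable_real_indicator) (auto simp: emeasure_lborel_Icc_eq)
  have bd: "\<bar>w n x - v x\<bar> \<le> 2 * M * indicator {0..R + 1} x" for n x
    using b[of n x] M[of x] s[of x n] supp[of x] by (cases "x \<in> {0..R + 1}") auto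
  have "(\<lambda>n. LINT x|lborel. \<bar>w n x - v x\<bar>) \<longlonglongrightarrow> (LINT x|(lborel::real measure). 0)"
  proof (rule integral_dominated_convergence[OF _ _ i])
    show "AE x in lborel. (\<lambda>n. \<bar>w n x - v x\<bar>) \<longlonglongrightarrow> 0"
      using AE
    proof eventually_elim
      case (elim x)
      show ?case using tendsto_rabs[OF tendsto_diff[OF w[OF elim] tendsto_const[of "v x"]]] by simp
    qed
  qed (use bd in auto)
  moreover have "integrable lborel (\<lambda>x. \<bar>w n x - v x\<bar>)" for n
    by (rule Bochner_Integration.integrable_bound[OF i]) (use bd order_trans[OF bd abs_ge_self] in auto)
  ultimately show ?thesis using m c s b by (intro exI[of _ w]) simp
qed

section \<open>Density of the Schwartz functions\<close>

context hurst
begin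

text \<open>The parallelogram law with the square of the difference dropped.\<close>

lemma ip_add_le:
  assumes u: "u \<in> theta_fin" and v: "v \<in> theta_fin"
  shows "ip (\<lambda>x. u x + v x) (\<lambda>x. u x + v x) \<le> 2 * ip u u + 2 * ip v v"
  using ip_lincomb_self[OF u v, of 1 1] ip_lincomb_self[OF u v, of 1 "-1"]
    ip_nonneg[OF theta_fin_lincomb[OF u v, of 1 "-1"]] by simp

text \<open>At each pair of points the truncation error is eventually zero, and it is always
  dominated by |u|, so dominated convergence applies on the plane.\<close>

lemma ip_truncation_tendsto:
  assumes u: "u \<in> theta_fin"
  shows "(\<lambda>n. ip (\<lambda>x. (if \<bar>u x\<bar> \<le> real n then u x else 0) - u x) (\<lambda>x. (if \<bar>u x\<bar> \<le> real n then u x else 0) - u x)) \<longlonglongrightarrow> 0"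
proof -
  have [measurable]: "u \<in> borel_measurable borel" using u by auto
  let ?d = "\<lambda>n x. (if \<bar>u x\<bar> \<le> real n then u x else 0) - u x"
  have "(\<lambda>n. integral\<^sup>L lborel2 (\<lambda>(s, t). ?d n s * ?d n t * theta H s t)) \<longlonglongrightarrow> integral\<^sup>L lborel2 (\<lambda>_::real \<times> real. 0)"
  proof (rule integral_dominated_convergence[where w = "\<lambda>p. norm ((\<lambda>(s, t). u s * u t * theta H s t) p)"])
    show "integrable lborel2 (\<lambda>p. norm ((\<lambda>(s, t). u s * u t * theta H s t) p))"
      using integrable_theta[OF u u] by (rule integrable_norm)
    show "AE p in lborel2. (\<lambda>n. (\<lambda>(s, t). ?d n s * ?d n t * theta H s t) p) \<longlonglongrightarrow> 0"
    proof (rule AE_I2, safe)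
      fix s t :: real
      have "\<forall>\<^sub>F n in sequentially. ?d n s * ?d n t * theta H s t = 0"
        using eventually_ge_at_top[of "nat \<lceil>\<bar>u s\<bar>\<rceil>"] by eventually_elim (simp add: nat_ceiling_le_eq)
      thus "(\<lambda>n. ?d n s * ?d n t * theta H s t) \<longlonglongrightarrow> 0"
        by (rule tendsto_eventually)
    qed
    show "AE p in lborel2. norm ((\<lambda>(s, t). ?d n s * ?d n t * theta H s t) p) \<le> norm ((\<lambda>(s, t). u s * u t * theta H s t) p)" for n
      by (rule AE_I2) (auto simp: abs_mult intro!: mult_right_mono mult_mono)
  qed measurable
  thus ?thesis unfolding ip_def by simp
qed

text \<open>Two approximations are chained: by a continuous function, with L1 error small and
  supremum error at most 2 M, and then by a Schwartz function with exponentially weighted error.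
  Each gets \<open>e / 4\<close> because \<open>ip_add_le\<close> doubles both.\<close>

lemma schwartz_dense_bounded:
  assumes [measurable]: "v \<in> borel_measurable borel" and M: "\<And>x. \<bar>v x\<bar> \<le> M"
    and supp: "\<And>x. x \<notin> {0..R} \<Longrightarrow> v x = 0" and R: "0 \<le> R" and e: "0 < e"
  shows "v \<in> theta_fin" "\<exists>g\<in>schwartz. ip_dist g v < e"
proof -
  have M0: "0 \<le> M" using M[of 0] by simp
  have "(\<integral>\<^sup>+x. ennreal \<bar>v x\<bar> \<partial>lborel) \<le> (\<integral>\<^sup>+x. ennreal M * indicator {0..R} x \<partial>lborel)"
    using M supp by (intro nn_integral_mono) (auto simp: indicator_def intro: ennreal_leI)
  also have "\<dots> = ennreal (M * R)" using M0 R by (subst nn_integral_cmult) (auto simp: ennreal_mult)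
  finally show v: "v \<in> theta_fin" using M by (intro theta_finI_bounded) auto
  obtain w where w[measurable]: "\<And>n. w n \<in> borel_measurable borel" and wc: "\<And>n. continuous_on {0..} (w n)"
    and ws: "\<And>n x. x \<notin> {0..R + 1} \<Longrightarrow> w n x = 0" and wb: "\<And>n x. \<bar>w n x\<bar> \<le> M"
    and wl: "(\<lambda>n. LINT x|lborel. \<bar>w n x - v x\<bar>) \<longlonglongrightarrow> 0"
    and wi: "\<And>n. integrable lborel (\<lambda>x. \<bar>w n x - v x\<bar>)"
    using bounded_approx_continuous[OF assms(1) M supp] by blast
  define K where "K n = (LINT x|lborel. \<bar>w n x - v x\<bar>)" for n
  have K0: "0 \<le> K n" for n by (simp add: K_def)
  have bd: "\<bar>w n x - v x\<bar> \<le> 2 * M" for n x using wb[of n x] M[of x] by linarith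
  have nnK: "(\<integral>\<^sup>+x. ennreal \<bar>w n x - v x\<bar> \<partial>lborel) \<le> ennreal (K n)" for n
    using wi unfolding K_def by (subst nn_integral_eq_integral) auto
  have wv: "(\<lambda>x. w n x - v x) \<in> theta_fin" for n
    by (rule theta_finI_bounded(1)[OF _ bd nnK]) auto
  have "ip_dist (w n) v \<le> K n * (2 * M * enn2real near_const + K n)" for n
    by (rule theta_finI_bounded(2)[OF _ bd nnK]) (use M0 K0 in auto)
  moreover have "(\<lambda>n. K n * (2 * M * enn2real near_const + K n)) \<longlonglongrightarrow> 0 * (2 * M * enn2real near_const + 0)"
    using wl unfolding K_def by (intro tendsto_intros)
  hence "\<forall>\<^sub>F n in sequentially. K n * (2 * M * enn2real near_const + K n) < e / 4"
    using e by (intro order_tendstoD(2)) auto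
  then obtain n where "K n * (2 * M * enn2real near_const + K n) < e / 4"
    by (auto simp: eventually_sequentially)
  ultimately have 1: "ip_dist (w n) v < e / 4" using le_less_trans by blast
  \<comment> \<open>An error of supremum and L1 norm at most \<open>r\<close> has squared norm at
    most this expression.\<close>
  have "((\<lambda>r. r * (r * enn2real near_const + r)) \<longlongrightarrow> 0 * (0 * enn2real near_const + 0)) (at_right (0::real))"
    by (intro tendsto_intros)
  hence "\<forall>\<^sub>F r in at_right (0::real). r * (r * enn2real near_const + r) < e / 4"
    using e by (intro order_tendstoD(2)) auto
  moreover have "\<forall>\<^sub>F r in at_right (0::real). 0 < r" by (rule eventually_at_right_less)
  ultimately have "\<forall>\<^sub>F r in at_right (0::real). 0 < r \<and> r * (r * enn2real near_const + r) < e / 4"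
    by eventually_elim simp
  then obtain r where r: "0 < r" "r * (r * enn2real near_const + r) < e / 4"
    using eventually_happens'[OF trivial_limit_at_right_real] by blast
  have wn: "\<And>x. x < 0 \<Longrightarrow> w n x = 0" "\<And>x. R + 2 \<le> x \<Longrightarrow> w n x = 0" "0 \<le> R + 2"
    using ws[of _ n] R by auto
  obtain g where g: "g \<in> schwartz" "\<And>x. \<bar>w n x - g x\<bar> \<le> r * (exp (- x) * indicator {0..} x)"
    using schwartz_uniform_approx[OF wc wn r(1)] by blast
  have [measurable]: "g \<in> borel_measurable borel" using g by auto
  have gw: "(\<lambda>x. g x - w n x) \<in> theta_fin" "ip_dist g (w n) \<le> r * (r * enn2real near_const + r)"
  proof -
    have b: "\<bar>g x - w n x\<bar> \<le> r" for x
    proof -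
      have "\<bar>g x - w n x\<bar> \<le> r * (exp (- x) * indicator {0..} x)" using g(2)[of x] by (simp add: abs_minus_commute)
      also have "\<dots> \<le> r * (1 * 1)" using r by (intro mult_left_mono) (auto simp: indicator_def)
      finally show ?thesis by simp
    qed
    have "(\<integral>\<^sup>+x. ennreal \<bar>g x - w n x\<bar> \<partial>lborel) \<le> (\<integral>\<^sup>+x. ennreal r * (ennreal (exp (- x)) * indicator {0..} x) \<partial>lborel)"
    proof (rule nn_integral_mono)
      fix x
      have "ennreal \<bar>g x - w n x\<bar> \<le> ennreal (r * (exp (- x) * indicator {0..} x))"
        using g(2)[of x] by (intro ennreal_leI) (simp add: abs_minus_commute)
      also have "\<dots> = ennreal r * (ennreal (exp (- x)) * indicator {0..} x)"
        using r by (auto simp: indicator_def ennreal_mult)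
      finally show "ennreal \<bar>g x - w n x\<bar> \<le> ennreal r * (ennreal (exp (- x)) * indicator {0..} x)" .
    qed
    also have "\<dots> = ennreal r * (\<integral>\<^sup>+x. ennreal (exp (- x)) * indicator {0..} x \<partial>lborel)"
      by (rule nn_integral_cmult) measurable
    also have "(\<integral>\<^sup>+x. ennreal (exp (- x)) * indicator {0..} x \<partial>lborel) = ennreal (0 - (- exp (- 0)))"
    proof (rule nn_integral_FTC_atLeast[where F = "\<lambda>x. - exp (- x)"])
      show "((\<lambda>x::real. - exp (- x)) \<longlongrightarrow> 0) at_top" by real_asymp
    qed (auto intro!: derivative_eq_intros)
    finally have k: "(\<integral>\<^sup>+x. ennreal \<bar>g x - w n x\<bar> \<partial>lborel) \<le> ennreal r" by simp
    show "(\<lambda>x. g x - w n x) \<in> theta_fin" by (rule theta_finI_bounded(1)[OF _ b k]) auto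
    show "ip_dist g (w n) \<le> r * (r * enn2real near_const + r)"
      by (rule theta_finI_bounded(2)[OF _ b k]) (use r in auto)
  qed
  have "ip (\<lambda>x. (g x - w n x) + (w n x - v x)) (\<lambda>x. (g x - w n x) + (w n x - v x)) < e"
    using ip_add_le[OF gw(1) wv[of n]] gw(2) r(2) 1 by linarith
  thus "\<exists>g\<in>schwartz. ip_dist g v < e" using g(1) by auto
qed

lemma schwartz_dense:
  assumes u: "u \<in> theta_fin" and supp: "\<And>x. x \<notin> {0..R} \<Longrightarrow> u x = 0" and R: "0 \<le> R"
  obtains g where "\<And>k::nat. g k \<in> schwartz" "(\<lambda>k. ip_dist (g k) u) \<longlonglongrightarrow> 0"
proof -
  have [measurable]: "u \<in> borel_measurable borel" using u by auto
  have ex: "\<exists>g. g \<in> schwartz \<and> ip_dist g u < e" if e: "0 < e" for e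
  proof -
    let ?u = "\<lambda>n x. if \<bar>u x\<bar> \<le> real n then u x else 0"
    have "\<forall>\<^sub>F n in sequentially. ip_dist (?u n) u < e / 4"
      using ip_truncation_tendsto[OF u] e by (intro order_tendstoD(2)) auto
    then obtain n where n: "ip_dist (?u n) u < e / 4"
      by (auto simp: eventually_sequentially)
    have b: "(?u n) \<in> borel_measurable borel" "\<And>x. \<bar>?u n x\<bar> \<le> real n" "\<And>x. x \<notin> {0..R} \<Longrightarrow> ?u n x = 0"
      using supp by auto
    have e4: "0 < e / 4" using e by simp
    obtain g where g: "g \<in> schwartz" "ip_dist g (?u n) < e / 4"
      using schwartz_dense_bounded(2)[OF b R e4] by blast
    have f: "?u n \<in> theta_fin" by (rule schwartz_dense_bounded(1)[OF b R e4])
    have "ip (\<lambda>x. (g x - ?u n x) + (?u n x - u x)) (\<lambda>x. (g x - ?u n x) + (?u n x - u x)) < e"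
      using ip_add_le[OF theta_fin_diff[OF schwartz_theta_fin[OF g(1)] f] theta_fin_diff[OF f u]] g(2) n by linarith
    thus ?thesis using g(1) by (intro exI[of _ g]) simp
  qed
  have "\<exists>g. \<forall>k::nat. g k \<in> schwartz \<and> ip_dist (g k) u < 1 / real (Suc k)"
    by (intro choice allI ex) simp
  then obtain g where g: "\<And>k::nat. g k \<in> schwartz" "\<And>k. ip_dist (g k) u < 1 / real (Suc k)"
    by blast
  have "(\<lambda>k. ip_dist (g k) u) \<longlonglongrightarrow> 0"
  proof (rule Lim_null_comparison)
    show "\<forall>\<^sub>F k in sequentially. norm (ip_dist (g k) u) \<le> 1 / real (Suc k)"
      using g(2) ip_nonneg[OF theta_fin_diff[OF schwartz_theta_fin[OF g(1)] u]] by (auto intro!: always_eventually less_imp_le)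
    show "(\<lambda>k. 1 / real (Suc k)) \<longlonglongrightarrow> 0" by real_asymp
  qed
  thus ?thesis using that g(1) by blast
qed

end

section \<open>Borel sets of tempered distributions\<close>

definition schwartz_norm :: "nat \<Rightarrow> (real \<Rightarrow> real) \<Rightarrow> real" where
  "schwartz_norm N f = (\<Sum>m\<le>N. \<Sum>k\<le>N. schwartz_seminorm m k f)"

lemma schwartz_seminorm_lincomb_le:
  assumes f: "f \<in> schwartz" and g: "g \<in> schwartz"
  shows "schwartz_seminorm m k (\<lambda>x. a * f x + b * g x) \<le> \<bar>a\<bar> * schwartz_seminorm m k f + \<bar>b\<bar> * schwartz_seminorm m k g"
proof (rule schwartz_seminorm_le)
  fix x :: real assume x: "0 \<le> x"
  have "\<bar>x ^ m * (half_deriv ^^ k) (\<lambda>x. a * f x + b * g x) x\<bar>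
     = \<bar>a * (x ^ m * (half_deriv ^^ k) f x) + b * (x ^ m * (half_deriv ^^ k) g x)\<bar>"
    unfolding half_deriv_lincomb[OF f g x] by (simp add: algebra_simps)
  also have "\<dots> \<le> \<bar>a\<bar> * \<bar>x ^ m * (half_deriv ^^ k) f x\<bar> + \<bar>b\<bar> * \<bar>x ^ m * (half_deriv ^^ k) g x\<bar>"
    unfolding abs_mult[symmetric] by (rule abs_triangle_ineq)
  also have "\<dots> \<le> \<bar>a\<bar> * schwartz_seminorm m k f + \<bar>b\<bar> * schwartz_seminorm m k g"
    using x f g by (intro add_mono mult_left_mono schwartz_seminorm_upper) auto
  finally show "\<bar>x ^ m * (half_deriv ^^ k) (\<lambda>x. a * f x + b * g x) x\<bar> \<le> \<bar>a\<bar> * schwartz_seminorm m k f + \<bar>b\<bar> * schwartz_seminorm m k g" .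
qed

lemma schwartz_norm_nonneg: "f \<in> schwartz \<Longrightarrow> 0 \<le> schwartz_norm N f"
  unfolding schwartz_norm_def by (intro sum_nonneg schwartz_seminorm_nonneg)

lemma schwartz_norm_mono:
  assumes "f \<in> schwartz" "N \<le> N'"
  shows "schwartz_norm N f \<le> schwartz_norm N' f"
proof -
  have "schwartz_norm N f \<le> (\<Sum>m\<le>N. \<Sum>k\<le>N'. schwartz_seminorm m k f)"
    unfolding schwartz_norm_def using assms
    by (intro sum_mono sum_mono2) (auto simp: schwartz_seminorm_nonneg)
  also have "\<dots> \<le> schwartz_norm N' f"
    unfolding schwartz_norm_def using assms
    by (intro sum_mono2) (auto simp: schwartz_seminorm_nonneg intro!: sum_nonneg)
  finally show ?thesis .
qed

lemma schwartz_norm_diff_le: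
  assumes f: "f \<in> schwartz" and g: "g \<in> schwartz"
  shows "schwartz_norm N (\<lambda>x. f x - g x) \<le> schwartz_norm N f + schwartz_norm N g"
  unfolding schwartz_norm_def sum.distrib[symmetric]
  using schwartz_seminorm_lincomb_le[OF f g, of _ _ 1 "-1"] by (intro sum_mono) simp

text \<open>A finite fingerprint of a function: its weighted derivatives at the points j / q in
  [0, q], rounded down to multiples of 1 / q. Nested lists of integers form a countable type, so
  there are only countably many fingerprints.\<close>

definition grid_data :: "nat \<Rightarrow> nat \<Rightarrow> (real \<Rightarrow> real) \<Rightarrow> int list list list" where
  "grid_data N q f = map (\<lambda>m. map (\<lambda>k. map (\<lambda>j. \<lfloor>real q * ((real j / real q) ^ m * (half_deriv ^^ k) f (real j / real q))\<rfloor>)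
     [0..<Suc (q * q)]) [0..<Suc N]) [0..<Suc N]"

lemma grid_data_eqD:
  assumes "grid_data N q f = grid_data N q g" "m \<le> N" "k \<le> N" "j \<le> q * q"
  shows "\<lfloor>real q * ((real j / real q) ^ m * (half_deriv ^^ k) f (real j / real q))\<rfloor>
    = \<lfloor>real q * ((real j / real q) ^ m * (half_deriv ^^ k) g (real j / real q))\<rfloor>"
proof -
  have "grid_data N q f ! m ! k ! j = grid_data N q g ! m ! k ! j" using assms by simp
  thus ?thesis unfolding grid_data_def using assms by (simp del: upt_Suc)
qed

text \<open>The bounds extend one order beyond \<open>N\<close> in both indices: the additional
  derivative controls variation between grid points, the additional power controls decay beyond the
  grid.\<close>

definition schwartz_bounded :: "nat \<Rightarrow> real \<Rightarrow> (real \<Rightarrow> real) \<Rightarrow> bool" where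
  "schwartz_bounded N M f \<longleftrightarrow> f \<in> schwartz \<and> (\<forall>m\<le>Suc N. \<forall>k\<le>Suc N. schwartz_seminorm m k f \<le> M)"

lemma schwartz_bounded_nonneg: "schwartz_bounded N M f \<Longrightarrow> 0 \<le> M"
  using schwartz_seminorm_nonneg[of f 0 0] unfolding schwartz_bounded_def by force

lemma schwartz_bounded_exists:
  assumes "f \<in> schwartz"
  shows "\<exists>M. schwartz_bounded N (real M) f"
proof -
  obtain M where M: "schwartz_norm (Suc N) f \<le> real M" using real_arch_simple by blast
  have "schwartz_seminorm m k f \<le> real M" if "m \<le> Suc N" "k \<le> Suc N" for m k
  proof -
    have "schwartz_seminorm m k f \<le> (\<Sum>k\<le>Suc N. schwartz_seminorm m k f)"
      using that assms by (intro member_le_sum) (auto simp: schwartz_seminorm_nonneg)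
    also have "\<dots> \<le> schwartz_norm (Suc N) f"
      unfolding schwartz_norm_def using that assms
      by (intro member_le_sum[of m "{..Suc N}" "\<lambda>m. \<Sum>k\<le>Suc N. schwartz_seminorm m k f"]) (auto intro!: sum_nonneg simp: schwartz_seminorm_nonneg simp del: sum.atMost_Suc)
    finally show ?thesis using M by simp
  qed
  thus ?thesis using assms by (auto simp: schwartz_bounded_def)
qed

lemma schwartz_bounded_lipschitz:
  assumes f: "schwartz_bounded N M f" and mk: "m \<le> N" "k \<le> N" and xy: "0 \<le> x" "0 \<le> y"
  shows "\<bar>x ^ m * (half_deriv ^^ k) f x - y ^ m * (half_deriv ^^ k) f y\<bar> \<le> (real N + 1) * M * \<bar>x - y\<bar>"
proof -
  have S: "f \<in> schwartz" using f by (simp add: schwartz_bounded_def)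
  have M0: "0 \<le> M" using f by (rule schwartz_bounded_nonneg)
  have b: "\<bar>z ^ m * (half_deriv ^^ k) f z\<bar> \<le> M" if "m \<le> Suc N" "k \<le> Suc N" "0 \<le> z" for m k z
    using f that by (intro order_trans[OF schwartz_seminorm_upper[OF S]]) (auto simp: schwartz_bounded_def)
  have "norm (x ^ m * (half_deriv ^^ k) f x - y ^ m * (half_deriv ^^ k) f y) \<le> ((real N + 1) * M) * norm (x - y)"
  proof (rule field_differentiable_bound[of "{0..}"])
    fix z :: real assume z: "z \<in> {0..}"
    show "((\<lambda>z. z ^ m * (half_deriv ^^ k) f z) has_field_derivative
      real m * z ^ (m - 1) * (half_deriv ^^ k) f z + (half_deriv ^^ Suc k) f z * z ^ m) (at z within {0..})"
      using z by (intro DERIV_mult schwartz_has_field_derivative[OF S]) (auto intro!: derivative_eq_intros)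
    have "norm (real m * z ^ (m - 1) * (half_deriv ^^ k) f z + (half_deriv ^^ Suc k) f z * z ^ m)
      \<le> real m * \<bar>z ^ (m - 1) * (half_deriv ^^ k) f z\<bar> + \<bar>z ^ m * (half_deriv ^^ Suc k) f z\<bar>"
      by (simp add: abs_mult mult_ac order_trans[OF abs_triangle_ineq])
    also have "\<dots> \<le> real N * M + M"
      using mk z M0 by (intro add_mono mult_mono b) auto
    finally show "norm (real m * z ^ (m - 1) * (half_deriv ^^ k) f z + (half_deriv ^^ Suc k) f z * z ^ m) \<le> (real N + 1) * M"
      by (simp add: algebra_simps)
  qed (use xy in auto)
  thus ?thesis by simp
qed

text \<open>For x \<le> q the error consists of two Lipschitz errors to a grid point at distance at
  most 1 / q and one rounding error. For larger x the additional power makes each function at most M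
  / q.\<close>

lemma grid_data_close:
  assumes f: "schwartz_bounded N M f" and g: "schwartz_bounded N M g" and q: "0 < q"
    and e: "grid_data N q f = grid_data N q g" and mk: "m \<le> N" "k \<le> N"
  shows "schwartz_seminorm m k (\<lambda>x. f x - g x) \<le> (2 * (real N + 1) * M + 1) / real q"
proof (rule schwartz_seminorm_le)
  fix x :: real assume x: "0 \<le> x"
  have S: "f \<in> schwartz" "g \<in> schwartz" using f g by (auto simp: schwartz_bounded_def)
  have M0: "0 \<le> M" using f by (rule schwartz_bounded_nonneg)
  define \<phi> where "\<phi> h x = x ^ m * (half_deriv ^^ k) h x" for h :: "real \<Rightarrow> real" and x
  have "\<bar>\<phi> f x - \<phi> g x\<bar> \<le> (2 * (real N + 1) * M + 1) / real q"
  proof (cases "x \<le> real q")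
    case True
    define j where "j = nat \<lfloor>x * real q\<rfloor>"
    have j: "real j \<le> x * real q" "x * real q \<le> real j + 1" using x by (auto simp: j_def)
    have "x * real q \<le> real q * real q" using True by (intro mult_right_mono) auto
    hence "real j \<le> real (q * q)" using j(1) by simp
    hence jq: "j \<le> q * q" by (subst (asm) of_nat_le_iff)
    have "real j / real q \<le> x" "x \<le> (real j + 1) / real q"
      using j q by (simp_all add: pos_divide_le_eq pos_le_divide_eq)
    hence d: "\<bar>x - real j / real q\<bar> \<le> 1 / real q" by (simp add: add_divide_distrib)
    have "\<bar>real q * \<phi> f (real j / real q) - real q * \<phi> g (real j / real q)\<bar> \<le> 1"
      using grid_data_eqD[OF e mk jq] unfolding \<phi>_def by linarith
    hence mid: "\<bar>\<phi> f (real j / real q) - \<phi> g (real j / real q)\<bar> \<le> 1 / real q"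
      using q unfolding right_diff_distrib[symmetric] abs_mult by (simp add: pos_le_divide_eq mult.commute)
    have lip: "\<bar>\<phi> h x - \<phi> h (real j / real q)\<bar> \<le> (real N + 1) * M * (1 / real q)" if "schwartz_bounded N M h" for h
      using schwartz_bounded_lipschitz[OF that mk x, of "real j / real q"] mult_left_mono[OF d, of "(real N + 1) * M"] M0
      unfolding \<phi>_def by simp
    have "\<bar>\<phi> f x - \<phi> g x\<bar> \<le> 2 * ((real N + 1) * M * (1 / real q)) + 1 / real q"
      using lip[OF f] lip[OF g] mid by linarith
    also have "\<dots> = (2 * (real N + 1) * M + 1) / real q"
      by (simp add: add_divide_distrib algebra_simps)
    finally show ?thesis .
  next
    case False
    have b: "\<bar>\<phi> h x\<bar> \<le> M / real q" if "schwartz_bounded N M h" for h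
    proof -
      have "real q * \<bar>\<phi> h x\<bar> \<le> x * \<bar>\<phi> h x\<bar>" using False by (intro mult_right_mono) auto
      also have "\<dots> = \<bar>x ^ Suc m * (half_deriv ^^ k) h x\<bar>" using x by (simp add: \<phi>_def abs_mult)
      also have "\<dots> \<le> M"
        using that mk x by (intro order_trans[OF schwartz_seminorm_upper]) (auto simp: schwartz_bounded_def)
      finally show ?thesis using q by (simp add: field_simps)
    qed
    have "\<bar>\<phi> f x - \<phi> g x\<bar> \<le> M / real q + M / real q" using b[OF f] b[OF g] by linarith
    also have "\<dots> = (2 * M) / real q" by simp
    also have "\<dots> \<le> (2 * (real N + 1) * M + 1) / real q"
      using M0 by (intro divide_right_mono) (auto simp: algebra_simps)
    finally show ?thesis .
  qed
  thus "\<bar>x ^ m * (half_deriv ^^ k) (\<lambda>x. f x - g x) x\<bar> \<le> (2 * (real N + 1) * M + 1) / real q"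
    using half_deriv_lincomb[OF S x, of k 1 "-1"] by (simp add: \<phi>_def right_diff_distrib)
qed

text \<open>One function is chosen from every nonempty cell, a cell being given by an order, a
  bound, a mesh and a fingerprint. The cells are countable, and any function is close to the
  representative of its own cell once the mesh is fine.\<close>

lemma schwartz_separable:
  obtains d :: "nat \<Rightarrow> real \<Rightarrow> real" where "\<And>i. d i \<in> schwartz"
    "\<And>f N e. f \<in> schwartz \<Longrightarrow> 0 < e \<Longrightarrow> \<exists>i. schwartz_norm N (\<lambda>x. f x - d i x) < e"
proof -
  define P where "P = (\<lambda>(N, M::nat, q, l) f. schwartz_bounded N (real M) f \<and> grid_data N q f = l)"
  define pick where "pick p = (if \<exists>f. P p f then SOME f. P p f else (\<lambda>_. 0))" for p
  have pick: "P p (pick p)" if "P p f" for p f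
    using that someI_ex[of "P p"] unfolding pick_def by auto
  have S: "pick p \<in> schwartz" for p
  proof (cases "\<exists>f. P p f")
    case True
    thus ?thesis using pick by (cases p) (auto simp: P_def schwartz_bounded_def)
  qed (simp add: pick_def schwartz_zero)
  show ?thesis
  proof (rule that[of "\<lambda>i. pick (from_nat i)"])
    fix f N and e :: real assume f: "f \<in> schwartz" and e: "0 < e"
    obtain M where M: "schwartz_bounded N (real M) f" using schwartz_bounded_exists[OF f] by blast
    \<comment> \<open>The number (1 + N)^2 of seminorms in the sum times the numerator of the error
      for each.\<close>
    define B where "B = (1 + real N)\<^sup>2 * (2 * (real N + 1) * real M + 1)"
    obtain q where q: "B / e < real q" using reals_Archimedean2 by blast
    have B: "0 < B" by (auto simp: B_def intro!: mult_pos_pos add_nonneg_pos)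
    hence q0: "0 < q" using q e by (metis divide_pos_pos less_trans of_nat_0_less_iff)
    define p where "p = (N, M, q, grid_data N q f)"
    have "P p f" using M by (simp add: p_def P_def)
    hence g: "schwartz_bounded N (real M) (pick p)" "grid_data N q f = grid_data N q (pick p)"
      using pick[of p f] by (auto simp: p_def P_def)
    have "schwartz_norm N (\<lambda>x. f x - pick p x) \<le> (\<Sum>m\<le>N. \<Sum>k\<le>N. (2 * (real N + 1) * real M + 1) / real q)"
      unfolding schwartz_norm_def by (intro sum_mono grid_data_close[OF M g(1) q0 g(2)]) auto
    also have "\<dots> = B / real q" by (simp add: B_def power2_eq_square)
    also have "\<dots> < e" using q q0 e by (simp add: field_simps)
    finally show "\<exists>i. schwartz_norm N (\<lambda>x. f x - pick (from_nat i) x) < e"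
      by (intro exI[of _ "to_nat p"]) simp
  qed (rule S)
qed

section \<open>Cylinder sets generate the weak-* Borel sets\<close>

definition cylinder_sets :: "((real \<Rightarrow> real) \<Rightarrow> real) set set" where
  "cylinder_sets = {{w \<in> tempered. \<forall>g\<in>F. w g \<in> A g} | F A. finite F \<and> F \<subseteq> schwartz \<and> (\<forall>g\<in>F. A g \<in> sets borel)}"

lemma tempered_lincomb:
  "w \<in> tempered \<Longrightarrow> f \<in> schwartz \<Longrightarrow> g \<in> schwartz \<Longrightarrow> w (\<lambda>x. a * f x + b * g x) = a * w f + b * w g"
  unfolding tempered_def by blast

lemma tempered_diff:
  "w \<in> tempered \<Longrightarrow> f \<in> schwartz \<Longrightarrow> g \<in> schwartz \<Longrightarrow> w (\<lambda>x. f x - g x) = w f - w g"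
  using tempered_lincomb[of w f g 1 "-1"] by simp

text \<open>An open set is in general an uncountable union of basic ones. The dual is, however, a
  countable union of the equicontinuous sets \<open>K N\<close>, and on each of them the weak-*
  topology is determined by evaluation at a dense sequence. There \<open>U\<close> becomes the
  preimage of an open set of real sequences, and arbitrary unions of open sets of sequences are
  still Borel.\<close>

lemma open_tempered_in_cylinder_sigma:
  assumes U: "openin tempered_topology U"
  shows "U \<in> sigma_sets tempered cylinder_sets"
proof -
  obtain T where T: "openin (product_topology (\<lambda>_. euclideanreal) schwartz) T" "U = T \<inter> tempered"
    using U unfolding tempered_topology_def openin_subtopology by blast
  obtain d :: "nat \<Rightarrow> real \<Rightarrow> real" where d: "\<And>i. d i \<in> schwartz"
    and dense: "\<And>f N e. f \<in> schwartz \<Longrightarrow> 0 < e \<Longrightarrow> \<exists>i. schwartz_norm N (\<lambda>x. f x - d i x) < e"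
    using schwartz_separable by blast
  define M where "M = sigma tempered cylinder_sets"
  have sub: "cylinder_sets \<subseteq> Pow tempered" by (auto simp: cylinder_sets_def)
  have [simp]: "space M = tempered" "sets M = sigma_sets tempered cylinder_sets"
    using sub by (auto simp: M_def)
  have eval[measurable]: "(\<lambda>w. w g) \<in> borel_measurable M" if "g \<in> schwartz" for g
  proof (rule measurableI)
    fix A :: "real set" assume A: "A \<in> sets borel"
    have "(\<lambda>w. w g) -` A \<inter> space M = {w \<in> tempered. \<forall>g\<in>{g}. w g \<in> A}" by auto
    also have "\<dots> \<in> cylinder_sets" unfolding cylinder_sets_def using A that
      by (intro CollectI exI[of _ "{g}"] exI[of _ "\<lambda>_. A"]) auto
    finally show "(\<lambda>w. w g) -` A \<inter> space M \<in> sets M" by simp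
  qed simp
  define R where "R w = (\<lambda>i. w (d i))" for w :: "(real \<Rightarrow> real) \<Rightarrow> real"
  have [measurable]: "R \<in> borel_measurable M"
    unfolding R_def by (rule measurable_coordinatewise_then_product) (use d in auto)
  define K where "K N = {w \<in> tempered. \<forall>f\<in>schwartz. \<bar>w f\<bar> \<le> real N * schwartz_norm N f}" for N
  \<comment> \<open>Measurability of \<open>K N\<close> requires countably many conditions. The
    bound extends from the dense sequence to all functions because \<open>w\<close> itself is
    continuous for some seminorm, possibly of higher order than \<open>N\<close>, whence the maximum
    \<open>L\<close>.\<close>
  have K_eq: "K N = {w \<in> space M. \<forall>i. \<bar>w (d i)\<bar> \<le> real N * schwartz_norm N (d i)}" for N
  proof (intro equalityI subsetI)
    fix w assume "w \<in> {w \<in> space M. \<forall>i. \<bar>w (d i)\<bar> \<le> real N * schwartz_norm N (d i)}"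
    hence w: "w \<in> tempered" and bd: "\<And>i. \<bar>w (d i)\<bar> \<le> real N * schwartz_norm N (d i)" by auto
    obtain C N' where C: "\<And>f. f \<in> schwartz \<Longrightarrow> \<bar>w f\<bar> \<le> C * schwartz_norm N' f"
      using w unfolding tempered_def schwartz_norm_def by blast
    have "\<bar>w f\<bar> \<le> real N * schwartz_norm N f" if f: "f \<in> schwartz" for f
    proof (rule field_le_epsilon)
      fix e :: real assume e: "0 < e"
      define L where "L = max N N'"
      have "0 < e / (real N + \<bar>C\<bar> + 1)" using e by (intro divide_pos_pos) auto
      then obtain i where i: "schwartz_norm L (\<lambda>x. f x - d i x) < e / (real N + \<bar>C\<bar> + 1)"
        using dense[OF f] by blast
      have h: "(\<lambda>x. f x - d i x) \<in> schwartz" using f d by (rule schwartz_diff)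
      have n: "schwartz_norm N (\<lambda>x. f x - d i x) \<le> schwartz_norm L (\<lambda>x. f x - d i x)"
        "schwartz_norm N' (\<lambda>x. f x - d i x) \<le> schwartz_norm L (\<lambda>x. f x - d i x)"
        using schwartz_norm_mono[OF h] by (auto simp: L_def)
      have "schwartz_norm N (d i) \<le> schwartz_norm N f + schwartz_norm N (\<lambda>x. f x - d i x)"
        using schwartz_norm_diff_le[OF f h, of N] by simp
      hence "real N * schwartz_norm N (d i) \<le> real N * (schwartz_norm N f + schwartz_norm L (\<lambda>x. f x - d i x))"
        using n by (intro mult_left_mono) auto
      moreover have "\<bar>w f - w (d i)\<bar> \<le> \<bar>C\<bar> * schwartz_norm L (\<lambda>x. f x - d i x)"
      proof -
        have "\<bar>w f - w (d i)\<bar> \<le> C * schwartz_norm N' (\<lambda>x. f x - d i x)"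
          using C[OF h] tempered_diff[OF w f d] by simp
        also have "\<dots> \<le> \<bar>C\<bar> * schwartz_norm L (\<lambda>x. f x - d i x)"
          using n schwartz_norm_nonneg[OF h] by (intro mult_mono) auto
        finally show ?thesis .
      qed
      ultimately have "\<bar>w f\<bar> \<le> real N * schwartz_norm N f + (real N + \<bar>C\<bar>) * schwartz_norm L (\<lambda>x. f x - d i x)"
        using bd[of i] by (simp add: algebra_simps)
      also have "(real N + \<bar>C\<bar>) * schwartz_norm L (\<lambda>x. f x - d i x) \<le> (real N + \<bar>C\<bar> + 1) * schwartz_norm L (\<lambda>x. f x - d i x)"
        using schwartz_norm_nonneg[OF h] by (intro mult_right_mono) auto
      also have "\<dots> \<le> e" using i by (simp add: field_simps)
      finally show "\<bar>w f\<bar> \<le> real N * schwartz_norm N f + e" by simp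
    qed
    thus "w \<in> K N" using w by (simp add: K_def)
  qed (use d in \<open>auto simp: K_def\<close>)
  have K[measurable]: "K N \<in> sets M" for N
    unfolding K_eq using d by measurable
  have UK: "tempered = (\<Union>N. K N)"
  proof (intro equalityI subsetI)
    fix w assume w: "w \<in> tempered"
    then obtain C N' where C: "\<And>f. f \<in> schwartz \<Longrightarrow> \<bar>w f\<bar> \<le> C * schwartz_norm N' f"
      unfolding tempered_def schwartz_norm_def by blast
    define N where "N = max N' (nat \<lceil>C\<rceil>)"
    have CN: "C \<le> real N" "N' \<le> N" unfolding N_def by linarith+
    have "\<bar>w f\<bar> \<le> real N * schwartz_norm N f" if f: "f \<in> schwartz" for f
    proof -
      have "\<bar>w f\<bar> \<le> C * schwartz_norm N' f" using f by (rule C)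
      also have "\<dots> \<le> real N * schwartz_norm N f"
        using CN schwartz_norm_mono[OF f CN(2)] schwartz_norm_nonneg[OF f] by (intro mult_mono) auto
      finally show ?thesis .
    qed
    thus "w \<in> (\<Union>N. K N)" using w by (auto simp: K_def)
  qed (auto simp: K_def)
  \<comment> \<open>The finitely many functions constrained by a basic neighbourhood are replaced by
    members of the dense sequence. On \<open>K N\<close> this costs at most \<open>e g / 4\<close>
    for \<open>w\<close> and for \<open>w'\<close> alike, leaving \<open>e g / 2\<close> for the
    condition on the sequences.\<close>
  have loc: "\<exists>V. open V \<and> R w \<in> V \<and> (\<forall>w'\<in>K N. R w' \<in> V \<longrightarrow> w' \<in> U)" if w: "w \<in> U" "w \<in> K N" for w N
  proof -
    obtain X where X: "finite {g \<in> schwartz. X g \<noteq> UNIV}" "\<And>g. g \<in> schwartz \<Longrightarrow> open (X g)"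
      "w \<in> Pi\<^sub>E schwartz X" "Pi\<^sub>E schwartz X \<subseteq> T"
      using T w(1) unfolding openin_product_topology_alt by auto
    define F where "F = {g \<in> schwartz. X g \<noteq> UNIV}"
    have F: "finite F" "F \<subseteq> schwartz" using X(1) by (auto simp: F_def)
    have "\<exists>e. 0 < e \<and> (\<forall>y. \<bar>y - w g\<bar> < e \<longrightarrow> y \<in> X g)" if "g \<in> F" for g
    proof -
      have "open (X g)" "w g \<in> X g" using that F X by auto
      thus ?thesis unfolding open_dist by (auto simp: dist_real_def)
    qed
    then obtain e where e: "\<And>g. g \<in> F \<Longrightarrow> 0 < e g" "\<And>g y. g \<in> F \<Longrightarrow> \<bar>y - w g\<bar> < e g \<Longrightarrow> y \<in> X g" by metis
    have "\<exists>i. schwartz_norm N (\<lambda>x. g x - d i x) < e g / (4 * (real N + 1))" if "g \<in> F" for g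
      using that F e(1)[OF that] by (intro dense) auto
    then obtain i where i: "\<And>g. g \<in> F \<Longrightarrow> schwartz_norm N (\<lambda>x. g x - d (i g) x) < e g / (4 * (real N + 1))" by metis
    define V where "V = (\<Inter>g\<in>F. {x :: nat \<Rightarrow> real. \<bar>x (i g) - w (d (i g))\<bar> < e g / 2})"
    have "open V" unfolding V_def using F(1)
      by (intro open_INT ballI open_Collect_less continuous_intros continuous_on_product_coordinates) auto
    moreover have "R w \<in> V" using e(1) by (auto simp: V_def R_def)
    moreover have "w' \<in> U" if w': "w' \<in> K N" "R w' \<in> V" for w'
    proof -
      have t: "w' \<in> tempered" "w \<in> tempered" using w' w by (auto simp: K_def)
      have "w' g \<in> X g" if g: "g \<in> F" for g
      proof (rule e(2)[OF g])
        have gS: "g \<in> schwartz" and h: "(\<lambda>x. g x - d (i g) x) \<in> schwartz" using g F d by (auto intro: schwartz_diff)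
        have c: "\<bar>\<eta> g - \<eta> (d (i g))\<bar> \<le> e g / 4" if \<eta>: "\<eta> \<in> K N" for \<eta>
        proof -
          have "\<bar>\<eta> g - \<eta> (d (i g))\<bar> = \<bar>\<eta> (\<lambda>x. g x - d (i g) x)\<bar>"
            using \<eta> gS d by (subst tempered_diff) (auto simp: K_def)
          also have "\<dots> \<le> real N * schwartz_norm N (\<lambda>x. g x - d (i g) x)" using \<eta> h by (auto simp: K_def)
          also have "\<dots> \<le> (real N + 1) * schwartz_norm N (\<lambda>x. g x - d (i g) x)"
            using schwartz_norm_nonneg[OF h] by (intro mult_right_mono) auto
          also have "\<dots> \<le> (real N + 1) * (e g / (4 * (real N + 1)))" using i[OF g] by (intro mult_left_mono) auto
          also have "\<dots> = e g / 4" by (simp add: field_simps)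
          finally show ?thesis .
        qed
        have "\<bar>w' (d (i g)) - w (d (i g))\<bar> < e g / 2" using w'(2) g by (auto simp: V_def R_def)
        thus "\<bar>w' g - w g\<bar> < e g" using c[OF w'(1)] c[OF w(2)] by linarith
      qed
      hence "w' g \<in> X g" if "g \<in> schwartz" for g using that by (cases "g \<in> F") (auto simp: F_def)
      moreover have "w' \<in> extensional schwartz" using t by (simp add: tempered_def)
      ultimately have "w' \<in> Pi\<^sub>E schwartz X" by (auto simp: PiE_def)
      thus ?thesis using X(4) T(2) t by auto
    qed
    ultimately show ?thesis by blast
  qed
  \<comment> \<open>Taking all suitable open sets avoids a choice for each \<open>w\<close>.\<close>
  define V where "V N = \<Union>{V. open V \<and> (\<forall>w'\<in>K N. R w' \<in> V \<longrightarrow> w' \<in> U)}" for N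
  have "open (V N)" for N unfolding V_def by (intro open_Union) auto
  hence [measurable]: "V N \<in> sets borel" for N by simp
  have "U = (\<Union>N. {w \<in> space M. w \<in> K N \<and> R w \<in> V N})"
  proof (intro equalityI subsetI)
    fix w assume w: "w \<in> U"
    hence "w \<in> tempered" using T by auto
    then obtain N where N: "w \<in> K N" using UK by auto
    show "w \<in> (\<Union>N. {w \<in> space M. w \<in> K N \<and> R w \<in> V N})"
      using loc[OF w N] N \<open>w \<in> tempered\<close> unfolding V_def by auto
  qed (auto simp: V_def)
  also have "\<dots> \<in> sets M" by measurable
  finally show ?thesis by simp
qed

lemma Int_stable_cylinder_sets: "Int_stable cylinder_sets"
proof (rule Int_stableI)
  fix a b assume "a \<in> cylinder_sets" "b \<in> cylinder_sets"
  then obtain F A F' A' where 1: "a = {w \<in> tempered. \<forall>g\<in>F. w g \<in> A g}" "finite F" "F \<subseteq> schwartz" "\<forall>g\<in>F. A g \<in> sets borel"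
    and 2: "b = {w \<in> tempered. \<forall>g\<in>F'. w g \<in> A' g}" "finite F'" "F' \<subseteq> schwartz" "\<forall>g\<in>F'. A' g \<in> sets borel"
    unfolding cylinder_sets_def by blast
  show "a \<inter> b \<in> cylinder_sets"
    unfolding cylinder_sets_def using 1 2
    by (intro CollectI exI[of _ "F \<union> F'"] exI[of _ "\<lambda>g. (if g \<in> F then A g else UNIV) \<inter> (if g \<in> F' then A' g else UNIV)"])
       auto
qed

section \<open>The white noise space\<close>

locale white_noise_space = hurst +
  fixes P :: "((real \<Rightarrow> real) \<Rightarrow> real) measure"
  assumes white_noise: "white_noise H P"
begin

sublocale prob_space P
  using white_noise by (simp add: white_noise_def)

lemma space_P: "space P = tempered"
  using white_noise by (simp add: white_noise_def)

lemma eval_measurable: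
  assumes "g \<in> schwartz"
  shows "(\<lambda>w. w g) \<in> borel_measurable P"
proof (rule borel_measurableI)
  fix S :: "real set" assume S: "open S"
  have "openin (product_topology (\<lambda>_. euclideanreal) schwartz) {w \<in> topspace (product_topology (\<lambda>_. euclideanreal) schwartz). w g \<in> S}"
    using continuous_map_product_projection[OF assms, of "\<lambda>_. euclideanreal"] S
    by (intro openin_continuous_map_preimage) auto
  hence "openin tempered_topology ({w \<in> topspace (product_topology (\<lambda>_. euclideanreal) schwartz). w g \<in> S} \<inter> tempered)"
    unfolding tempered_topology_def openin_subtopology by blast
  moreover have "{w \<in> topspace (product_topology (\<lambda>_. euclideanreal) schwartz). w g \<in> S} \<inter> tempered = (\<lambda>w. w g) -` S \<inter> space P"
    by (auto simp: space_P tempered_def PiE_def)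
  ultimately show "(\<lambda>w. w g) -` S \<inter> space P \<in> sets P"
    using white_noise by (auto simp: white_noise_def)
qed

lemma cylinder_sets_in_sets: "cylinder_sets \<subseteq> sets P"
proof
  fix E assume "E \<in> cylinder_sets"
  then obtain F A where E: "E = {w \<in> tempered. \<forall>g\<in>F. w g \<in> A g}" "finite F" "F \<subseteq> schwartz" "\<forall>g\<in>F. A g \<in> sets borel"
    unfolding cylinder_sets_def by blast
  have "{w \<in> space P. w g \<in> A g} \<in> sets P" if "g \<in> F" for g
  proof -
    have "(\<lambda>w. w g) -` A g \<inter> space P \<in> sets P"
      using that E(3,4) by (intro measurable_sets[OF eval_measurable]) auto
    moreover have "(\<lambda>w. w g) -` A g \<inter> space P = {w \<in> space P. w g \<in> A g}" by blast
    ultimately show ?thesis by simp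
  qed
  hence "{w \<in> space P. \<forall>g\<in>F. w g \<in> A g} \<in> sets P"
    using E(2) by (intro sets.sets_Collect_finite_All)
  thus "E \<in> sets P" using E(1) by (simp add: space_P)
qed

lemma sets_P_cylinder: "E \<in> sets P \<Longrightarrow> E \<in> sigma_sets tempered cylinder_sets"
proof -
  assume "E \<in> sets P"
  hence "E \<in> sigma_sets tempered {U. openin tempered_topology U}"
    using white_noise by (simp add: white_noise_def)
  thus ?thesis using sigma_sets_mono[of "{U. openin tempered_topology U}" tempered cylinder_sets]
    open_tempered_in_cylinder_sigma by blast
qed

lemma eval_lincomb: "w \<in> space P \<Longrightarrow> f \<in> schwartz \<Longrightarrow> g \<in> schwartz \<Longrightarrow> w (\<lambda>x. a * f x + b * g x) = a * w f + b * w g"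
  by (simp add: space_P tempered_lincomb)

lemma eval_zero: "w \<in> space P \<Longrightarrow> w (\<lambda>x. 0) = 0"
  using eval_lincomb[OF _ schwartz_zero schwartz_zero, of w 0 0] by simp

section \<open>Injectivity of the Fourier transform on the dual space\<close>

definition fourier_null :: "(((real \<Rightarrow> real) \<Rightarrow> real) \<Rightarrow> real) \<Rightarrow> bool" where
  "fourier_null Z \<longleftrightarrow> integrable P Z \<and>
     (\<forall>g\<in>schwartz. (LINT w|P. cos (w g) * Z w) = 0 \<and> (LINT w|P. sin (w g) * Z w) = 0)"

text \<open>For fixed \<open>g\<close>, the transform at \<open>s h \<plusminus> g\<close> and the
  addition formulas give the Fourier transform of \<open>w h\<close> under the signed densities cos
  (w g) Z and sin (w g) Z. It vanishes, so indicators of \<open>w h\<close> may be inserted, one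
  cylinder coordinate at a time.\<close>

lemma fourier_null_indicator:
  assumes Z: "fourier_null Z" and h: "h \<in> schwartz" and A[measurable]: "A \<in> sets borel"
  shows "fourier_null (\<lambda>w. indicator A (w h) * Z w)"
proof -
  have Zi: "integrable P Z" using Z unfolding fourier_null_def by blast
  have [measurable]: "Z \<in> borel_measurable P" using Zi by (rule borel_measurable_integrable)
  have [measurable]: "(\<lambda>w. w h) \<in> borel_measurable P" using h by (rule eval_measurable)
  have "integrable P (\<lambda>w. indicator A (w h) * Z w)"
  proof (rule Bochner_Integration.integrable_bound[OF Zi])
    show "AE w in P. norm (indicator A (w h) * Z w) \<le> norm (Z w)"
      by (rule AE_I2) (auto simp: indicator_def)
  qed measurable
  moreover have "(LINT w|P. cos (w g) * (indicator A (w h) * Z w)) = 0 \<and> (LINT w|P. sin (w g) * (indicator A (w h) * Z w)) = 0"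
    if g: "g \<in> schwartz" for g
  proof -
    have [measurable]: "(\<lambda>w. w g) \<in> borel_measurable P" using g by (rule eval_measurable)
    have lc: "(\<lambda>x. s * h x + c * g x) \<in> schwartz" for s c using h g by (rule schwartz_lincomb)
    have ev: "w (\<lambda>x. s * h x + c * g x) = s * w h + c * w g" if "w \<in> space P" for w s c
      using that h g by (rule eval_lincomb)
    have z: "(LINT w|P. cos (s * w h + c * w g) * Z w) = 0" "(LINT w|P. sin (s * w h + c * w g) * Z w) = 0" for s c
    proof -
      have e: "(LINT w|P. cos (s * w h + c * w g) * Z w) = (LINT w|P. cos (w (\<lambda>x. s * h x + c * g x)) * Z w)"
        "(LINT w|P. sin (s * w h + c * w g) * Z w) = (LINT w|P. sin (w (\<lambda>x. s * h x + c * g x)) * Z w)"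
        by (intro Bochner_Integration.integral_cong refl; simp add: ev)+
      have n: "(LINT w|P. cos (w (\<lambda>x. s * h x + c * g x)) * Z w) = 0 \<and> (LINT w|P. sin (w (\<lambda>x. s * h x + c * g x)) * Z w) = 0"
        by (rule bspec[OF Z[unfolded fourier_null_def, THEN conjunct2] lc])
      show "(LINT w|P. cos (s * w h + c * w g) * Z w) = 0" by (rule trans[OF e(1) n[THEN conjunct1]])
      show "(LINT w|P. sin (s * w h + c * w g) * Z w) = 0" by (rule trans[OF e(2) n[THEN conjunct2]])
    qed
    have i: "integrable P (\<lambda>w. cos (s * w h + c * w g) * Z w)" "integrable P (\<lambda>w. sin (s * w h + c * w g) * Z w)" for s c
      using Zi by (auto intro!: integrable_cos_mult)
    have half: "(LINT w|P. (X w + Y w) / 2) = 0" if "integrable P X" "integrable P Y" "(LINT w|P. X w) = 0" "(LINT w|P. Y w) = 0"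
      for X Y :: "_ \<Rightarrow> real" using that by simp
    have half': "(LINT w|P. (X w - Y w) / 2) = 0" if "integrable P X" "integrable P Y" "(LINT w|P. X w) = 0" "(LINT w|P. Y w) = 0"
      for X Y :: "_ \<Rightarrow> real" using that by simp
    have cc: "(LINT w|P. cos (s * w h) * (cos (w g) * Z w)) = 0" for s
      using half[OF i(1)[of s "1"] i(1)[of s "-1"] z(1) z(1)] by (simp add: cos_add cos_diff algebra_simps)
    have sc: "(LINT w|P. sin (s * w h) * (cos (w g) * Z w)) = 0" for s
      using half[OF i(2)[of s "1"] i(2)[of s "-1"] z(2) z(2)] by (simp add: sin_add sin_diff algebra_simps)
    have cs: "(LINT w|P. cos (s * w h) * (sin (w g) * Z w)) = 0" for s
      using half'[OF i(2)[of s "1"] i(2)[of s "-1"] z(2) z(2)] by (simp add: sin_add sin_diff algebra_simps)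
    have ss: "(LINT w|P. sin (s * w h) * (sin (w g) * Z w)) = 0" for s
      using half'[OF i(1)[of s "-1"] i(1)[of s "1"] z(1) z(1)] by (simp add: cos_add cos_diff algebra_simps)
    have "(LINT w|P. indicator A (w h) * (cos (w g) * Z w)) = 0" "(LINT w|P. indicator A (w h) * (sin (w g) * Z w)) = 0"
      using Zi by (auto intro!: integral_indicator_eq_0_if_char_0 integrable_cos_mult cc sc cs ss)
    thus ?thesis by (simp add: mult_ac)
  qed
  ultimately show ?thesis unfolding fourier_null_def by blast
qed

text \<open>Inserting coordinates repeatedly shows that \<open>Z\<close> integrates to 0 over every
  cylinder set. These are stable under intersection and generate the sigma-algebra, so the same
  holds on the sets where \<open>Z\<close> is nonnegative or negative.\<close>

lemma fourier_null_AE_0: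
  assumes Z: "fourier_null Z"
  shows "AE w in P. Z w = 0"
proof -
  have Zi: "integrable P Z" using Z unfolding fourier_null_def by blast
  have [measurable]: "Z \<in> borel_measurable P" using Zi by (rule borel_measurable_integrable)
  have mean: "(LINT w|P. W w) = 0" if "fourier_null W" for W
  proof -
    have e: "(LINT w|P. W w) = (LINT w|P. cos (w (\<lambda>x. 0)) * W w)"
      by (intro Bochner_Integration.integral_cong) (auto simp: eval_zero)
    have "(LINT w|P. cos (w (\<lambda>x. 0)) * W w) = 0 \<and> (LINT w|P. sin (w (\<lambda>x. 0)) * W w) = 0"
      by (rule bspec[OF that[unfolded fourier_null_def, THEN conjunct2] schwartz_zero])
    thus ?thesis unfolding e by (rule conjunct1)
  qed
  have cyl: "fourier_null (\<lambda>w. indicator {w. \<forall>g\<in>F. w g \<in> A g} w * Z w)"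
    if "finite F" "F \<subseteq> schwartz" "\<forall>g\<in>F. A g \<in> sets borel" for F and A :: "_ \<Rightarrow> real set"
    using that
  proof (induction F rule: finite_induct)
    case (insert h F)
    have "fourier_null (\<lambda>w. indicator (A h) (w h) * (indicator {w. \<forall>g\<in>F. w g \<in> A g} w * Z w))"
      using insert by (intro fourier_null_indicator) auto
    moreover have "(\<lambda>w. indicator (A h) (w h) * (indicator {w. \<forall>g\<in>F. w g \<in> A g} w * Z w))
        = (\<lambda>w. indicator {w. \<forall>g\<in>insert h F. w g \<in> A g} w * Z w)"
      by (auto simp: indicator_def)
    ultimately show ?case by simp
  qed (use Z in simp)
  have sub: "cylinder_sets \<subseteq> Pow tempered" by (auto simp: cylinder_sets_def)
  have Zind: "integrable P (\<lambda>w. indicator E w * Z w)" if "E \<in> sets P" for E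
  proof (rule Bochner_Integration.integrable_bound[OF Zi])
    show "AE w in P. norm (indicator E w * Z w) \<le> norm (Z w)"
      by (rule AE_I2) (auto simp: indicator_def)
  qed (use that in measurable)
  have sets_eq: "sigma_sets tempered cylinder_sets \<subseteq> sets P"
    using sets.sigma_sets_subset[OF cylinder_sets_in_sets] by (simp add: space_P)
  have all: "(LINT w|P. indicator E w * Z w) = 0" if E: "E \<in> sets P" for E
    using Int_stable_cylinder_sets sub sets_P_cylinder[OF E]
  proof (induction rule: sigma_sets_induct_disjoint)
    case (basic E)
    then obtain F A where E: "E = {w \<in> tempered. \<forall>g\<in>F. w g \<in> A g}" "finite F" "F \<subseteq> schwartz" "\<forall>g\<in>F. A g \<in> sets borel"
      unfolding cylinder_sets_def by blast
    have "(LINT w|P. indicator E w * Z w) = (LINT w|P. indicator {w. \<forall>g\<in>F. w g \<in> A g} w * Z w)"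
      by (intro Bochner_Integration.integral_cong) (auto simp: E space_P indicator_def)
    thus ?case using mean[OF cyl[OF E(2-4)]] by simp
  next
    case (compl E)
    hence "E \<in> sets P" using sets_eq by auto
    have "(LINT w|P. indicator (tempered - E) w * Z w) = (LINT w|P. Z w - indicator E w * Z w)"
      by (intro Bochner_Integration.integral_cong) (auto simp: space_P indicator_def)
    also have "\<dots> = 0" using Zi Zind[OF \<open>E \<in> sets P\<close>] compl mean[OF Z] by simp
    finally show ?case .
  next
    case (union E)
    hence m[measurable]: "E i \<in> sets P" for i using sets_eq by auto
    have "(\<lambda>n. LINT w|P. (\<Sum>i<n. indicator (E i) w * Z w)) \<longlonglongrightarrow> (LINT w|P. indicator (\<Union>i. E i) w * Z w)"
    proof (rule integral_dominated_convergence[where w = "\<lambda>w. \<bar>Z w\<bar>"])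
      have ind: "(\<Sum>i<n. indicator (E i) w * Z w) = indicator (\<Union>i<n. E i) w * Z w" for n w
        using union(1) by (subst sum_distrib_right[symmetric], subst indicator_UN_disjoint)
          (auto simp: disjoint_family_on_def)
      show "AE w in P. (\<lambda>n. \<Sum>i<n. indicator (E i) w * Z w) \<longlonglongrightarrow> indicator (\<Union>i. E i) w * Z w"
      proof (rule AE_I2)
        fix w
        have "(\<lambda>n. indicator (\<Union>i<n. E i) w :: real) \<longlonglongrightarrow> indicator (\<Union>i. E i) w"
          by (rule LIMSEQ_indicator_UN)
        thus "(\<lambda>n. \<Sum>i<n. indicator (E i) w * Z w) \<longlonglongrightarrow> indicator (\<Union>i. E i) w * Z w"
          unfolding ind by (intro tendsto_intros)
      qed
      show "AE w in P. norm (\<Sum>i<n. indicator (E i) w * Z w) \<le> \<bar>Z w\<bar>" for n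
        unfolding ind by (rule AE_I2) (auto simp: indicator_def)
    qed (use Zi in auto)
    moreover have "(LINT w|P. (\<Sum>i<n. indicator (E i) w * Z w)) = 0" for n
      using union(3) by (subst Bochner_Integration.integral_sum) (auto intro: Zind)
    ultimately show ?case by (simp add: LIMSEQ_const_iff)
  qed simp
  have [measurable]: "{w \<in> space P. 0 \<le> Z w} \<in> sets P" "{w \<in> space P. Z w < 0} \<in> sets P" by measurable
  have "(LINT w|P. \<bar>Z w\<bar>) = (LINT w|P. indicator {w \<in> space P. 0 \<le> Z w} w * Z w - indicator {w \<in> space P. Z w < 0} w * Z w)"
    by (intro Bochner_Integration.integral_cong) (auto simp: indicator_def)
  also have "\<dots> = 0" by (simp add: Zind all)
  finally have "(LINT w|P. \<bar>Z w\<bar>) = 0" .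
  thus ?thesis using Zi by (subst (asm) integral_nonneg_eq_0_iff_AE) auto
qed

section \<open>Gaussian variables paired with functions\<close>

lemma expectation_cos_eval:
  assumes g: "g \<in> schwartz"
  shows "(LINT w|P. cosj j (w g)) = cos (real j * (pi/2)) * exp (- ip g g / 2)"
proof -
  have [measurable]: "(\<lambda>w. w g) \<in> borel_measurable P" using g by (rule eval_measurable)
  have "(LINT w|P. iexp (w g)) = complex_of_real (exp (- (1/2) * (theta_norm H g)\<^sup>2))"
    using white_noise g by (simp add: white_noise_def)
  also have "(theta_norm H g)\<^sup>2 = ip g g"
    unfolding theta_norm_def theta_inner_schwartz[OF g g] using ip_nonneg[OF schwartz_theta_fin[OF g]] by simp
  finally have "complex_of_real (LINT w|P. cos (w g)) + \<i> * complex_of_real (LINT w|P. sin (w g)) = complex_of_real (exp (- ip g g / 2))"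
    by (subst (asm) integral_iexp_cos_sin) auto
  hence c: "(LINT w|P. cos (w g)) = exp (- ip g g / 2)" and s: "(LINT w|P. sin (w g)) = 0"
    by (auto simp: complex_eq_iff)
  have i: "integrable P (\<lambda>w. cos (w g))" "integrable P (\<lambda>w. sin (w g))"
    by (auto intro!: integrable_const_bound[of _ 1])
  have "(LINT w|P. cosj j (w g)) = (LINT w|P. cos (real j * (pi/2)) * cos (w g) - sin (real j * (pi/2)) * sin (w g))"
    by (simp add: cos_add mult.commute)
  also have "\<dots> = cos (real j * (pi/2)) * exp (- ip g g / 2)" using i by (simp add: c s)
  finally show ?thesis .
qed

lemma expectation_cos_eval_lincomb:
  assumes g: "g \<in> schwartz" and h: "h \<in> schwartz"
  shows "(LINT w|P. cosj j (w g + s * w h)) =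
    cos (real j * (pi/2)) * exp (- (ip g g + 2 * s * ip g h + s\<^sup>2 * ip h h) / 2)"
proof -
  have "(LINT w|P. cosj j (w g + s * w h)) = (LINT w|P. cosj j (w (\<lambda>x. 1 * g x + s * h x)))"
    by (intro Bochner_Integration.integral_cong refl) (simp add: eval_lincomb[OF _ g h, of _ 1 s, simplified])
  also have "\<dots> = cos (real j * (pi/2)) * exp (- (ip g g + 2 * s * ip g h + s\<^sup>2 * ip h h) / 2)"
    unfolding expectation_cos_eval[OF schwartz_lincomb[OF g h]]
      ip_lincomb_self[OF schwartz_theta_fin[OF g] schwartz_theta_fin[OF h]] by simp
  finally show ?thesis .
qed

text \<open>Jointly with the evaluations, \<open>Z\<close> is centered Gaussian with variance
  \<open>ip u u\<close> and covariance \<open>ip g u\<close>. Expectations of cosines express this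
  in a form that passes to almost sure limits by bounded convergence and is what
  \<open>expectation_cos_herm\<close> requires.\<close>

definition gaussian_for :: "(real \<Rightarrow> real) \<Rightarrow> (((real \<Rightarrow> real) \<Rightarrow> real) \<Rightarrow> real) \<Rightarrow> bool" where
  "gaussian_for u Z \<longleftrightarrow> Z \<in> borel_measurable P \<and>
     (\<forall>g\<in>schwartz. \<forall>s. \<forall>j::nat. (LINT w|P. cosj j (w g + s * Z w)) =
        cos (real j * (pi/2)) * exp (- (ip g g + 2 * s * ip g u + s\<^sup>2 * ip u u) / 2))"

lemma gaussian_for_eval: "h \<in> schwartz \<Longrightarrow> gaussian_for h (\<lambda>w. w h)"
  unfolding gaussian_for_def using expectation_cos_eval_lincomb eval_measurable by blast

text \<open>Taking g = 0 yields the characteristic function of \<open>Z\<close>, hence all moments.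
  The Hermite expectations are the case s = 0 of the general formula, and the variance follows
  because the second Hermite polynomial x^2 - v has mean 0.\<close>

lemma gaussian_for_moments:
  assumes Z: "gaussian_for u Z" and u: "u \<in> theta_fin"
  shows "integrable P (\<lambda>w. Z w ^ k)"
    and "g \<in> schwartz \<Longrightarrow> (LINT w|P. cosj j (w g) * herm (ip u u) (Z w) n)
      = cos (real (n + j) * (pi/2)) * ip g u ^ n * exp (- ip g g / 2)"
    and "(LINT w|P. (Z w)\<^sup>2) = ip u u"
proof -
  have [measurable]: "Z \<in> borel_measurable P" using Z by (simp add: gaussian_for_def)
  have ip0: "ip (\<lambda>x. 0) w = 0" for w by (simp add: ip_def split_def)
  have zero: "(LINT w|P. cosj j (s * Z w)) = cos (real j * (pi/2)) * exp (- (s\<^sup>2 * ip u u) / 2)" for s and j :: nat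
  proof -
    have "(LINT w|P. cosj j (s * Z w)) = (LINT w|P. cosj j (w (\<lambda>x. 0) + s * Z w))"
      by (intro Bochner_Integration.integral_cong) (auto simp: eval_zero)
    also have "\<dots> = cos (real j * (pi/2)) * exp (- (ip (\<lambda>x. 0) (\<lambda>x. 0) + 2 * s * ip (\<lambda>x. 0) u + s\<^sup>2 * ip u u) / 2)"
      using Z schwartz_zero unfolding gaussian_for_def by blast
    finally show ?thesis by (simp add: ip0)
  qed
  have "(LINT w|P. sin (s * Z w)) = 0" for s
    using zero[of s 1] by (simp add: cos_add)
  moreover have "(LINT w|P. cos (s * Z w)) = exp (- (s\<^sup>2 * ip u u) / 2)" for s
    using zero[of s 0] by simp
  ultimately have int: "integrable P (\<lambda>w. Z w ^ k)" for k
    using ip_nonneg[OF u] by (intro gaussian_moments_integrable) auto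
  show "integrable P (\<lambda>w. Z w ^ k)" by (rule int)
  have main: "(LINT w|P. cosj j (w g + 0 * Z w) * herm (ip u u) (Z w) n)
      = cos (real (n + j) * (pi/2)) * (ip g u + 0 * ip u u) ^ n * exp (- (ip g g + 2 * 0 * ip g u + 0\<^sup>2 * ip u u) / 2)"
    if g: "g \<in> schwartz" for g j n
    using Z g unfolding gaussian_for_def by (intro expectation_cos_herm int eval_measurable) auto
  show *: "(LINT w|P. cosj j (w g) * herm (ip u u) (Z w) n)
      = cos (real (n + j) * (pi/2)) * ip g u ^ n * exp (- ip g g / 2)" if "g \<in> schwartz" for g j n
    using main[OF that, of j n] by simp
  have "(LINT w|P. (Z w)\<^sup>2 - ip u u) = (LINT w|P. cosj 0 (w (\<lambda>x. 0)) * herm (ip u u) (Z w) 2)"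
    by (intro Bochner_Integration.integral_cong) (auto simp: eval_zero numeral_2_eq_2)
  also have "\<dots> = 0" unfolding *[OF schwartz_zero] by (simp add: ip0)
  finally show "(LINT w|P. (Z w)\<^sup>2) = ip u u" using int[of 2] by (simp add: prob_space)
qed

text \<open>Evaluations at approximating Schwartz functions are Cauchy in L1, since the second
  moment of a difference is its squared distance in the form. An almost surely convergent
  subsequence then suffices, cosines being bounded.\<close>

lemma gaussian_for_exists:
  assumes u: "u \<in> theta_fin" and supp: "\<And>x. x \<notin> {0..R} \<Longrightarrow> u x = 0" and R: "0 \<le> R"
  shows "\<exists>Z. gaussian_for u Z"
proof -
  obtain g where g: "\<And>k::nat. g k \<in> schwartz" and lim: "(\<lambda>k. ip_dist (g k) u) \<longlonglongrightarrow> 0"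
    using schwartz_dense[OF u supp R] by blast
  have gf: "g k \<in> theta_fin" for k using g by (rule schwartz_theta_fin)
  have m[measurable]: "(\<lambda>w. w (g k)) \<in> borel_measurable P" for k using g by (rule eval_measurable)
  have int1: "integrable P (\<lambda>w. w (g k))" for k
    using gaussian_for_moments(1)[OF gaussian_for_eval[OF g] gf, of k 1] by simp
  let ?d = "\<lambda>k. ip_dist (g k) u"
  \<comment> \<open>Bounds |x| by (e + x^2 / e) / 2, which trades the first absolute moment for the
    second without a square root.\<close>
  have L1: "(LINT w|P. norm (w (g i) - w (g j))) \<le> (e + (2 * ?d i + 2 * ?d j) / e) / 2" if e: "0 < e" for i j e
  proof -
    have h: "(\<lambda>x. g i x - g j x) \<in> schwartz" using g by (intro schwartz_diff)
    have ev: "w (\<lambda>x. g i x - g j x) = w (g i) - w (g j)" if "w \<in> space P" for w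
      using tempered_diff[OF _ g g] that by (simp add: space_P)
    note G = gaussian_for_moments[OF gaussian_for_eval[OF h] schwartz_theta_fin[OF h]]
    have "(LINT w|P. norm (w (g i) - w (g j))) = (LINT w|P. \<bar>w (\<lambda>x. g i x - g j x)\<bar>)"
      by (intro Bochner_Integration.integral_cong) (auto simp: ev)
    also have "\<dots> \<le> (LINT w|P. (e + (w (\<lambda>x. g i x - g j x))\<^sup>2 / e) / 2)"
    proof (rule integral_mono)
      show "integrable P (\<lambda>w. \<bar>w (\<lambda>x. g i x - g j x)\<bar>)" using G(1)[of 1] by simp
      show "integrable P (\<lambda>w. (e + (w (\<lambda>x. g i x - g j x))\<^sup>2 / e) / 2)" using G(1)[of 2] by simp
      show "\<bar>w (\<lambda>x. g i x - g j x)\<bar> \<le> (e + (w (\<lambda>x. g i x - g j x))\<^sup>2 / e) / 2" for w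
        using sum_squares_bound[of e "\<bar>w (\<lambda>x. g i x - g j x)\<bar>"] e by (simp add: field_simps power2_eq_square)
    qed
    also have "\<dots> = (e + ip_dist (g i) (g j) / e) / 2"
      using G(1)[of 2] G(3) by (simp add: prob_space)
    also have "ip_dist (g i) (g j) \<le> 2 * ?d i + 2 * ?d j"
    proof -
      have "ip (\<lambda>x. (g i x - u x) + (u x - g j x)) (\<lambda>x. (g i x - u x) + (u x - g j x)) \<le> 2 * ?d i + 2 * ip_dist u (g j)"
        using gf u by (intro ip_add_le theta_fin_diff)
      moreover have "ip_dist u (g j) = ?d j"
        unfolding ip_def by (intro Bochner_Integration.integral_cong) (auto simp: algebra_simps)
      ultimately show ?thesis by simp
    qed
    finally show ?thesis using e by (simp add: divide_right_mono)
  qed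
  have C: "\<exists>N. \<forall>i\<ge>N. \<forall>j\<ge>N. (LINT w|P. norm (w (g i) - w (g j))) < e" if e: "0 < e" for e
  proof -
    \<comment> \<open>With e^2 / 8 the bound on the first absolute moment becomes at most (e + e /
      2) / 2, which is less than \<open>e\<close>.\<close>
    have "\<forall>\<^sub>F k in sequentially. ?d k < e\<^sup>2 / 8" using lim e by (intro order_tendstoD(2)) auto
    then obtain N where N: "\<And>k. k \<ge> N \<Longrightarrow> ?d k < e\<^sup>2 / 8" by (auto simp: eventually_sequentially)
    show ?thesis
    proof (intro exI[of _ N] allI impI)
      fix i j assume "N \<le> i" "N \<le> j"
      hence "2 * ?d i + 2 * ?d j \<le> e * (e / 2)" using N[of i] N[of j] by (simp add: power2_eq_square)
      hence "(2 * ?d i + 2 * ?d j) / e \<le> e / 2" using e by (simp add: pos_divide_le_eq mult.commute)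
      hence "(e + (2 * ?d i + 2 * ?d j) / e) / 2 \<le> (e + e / 2) / 2"
        by (intro divide_right_mono add_left_mono) auto
      also have "\<dots> < e" using e by simp
      finally show "(LINT w|P. norm (w (g i) - w (g j))) < e" by (rule le_less_trans[OF L1[OF e]])
    qed
  qed
  obtain r where r: "strict_mono r" "AE w in P. Cauchy (\<lambda>i. w (g (r i)))"
    using cauchy_L1_AE_cauchy_subseq[of P "\<lambda>k w. w (g k)", OF int1 C] by blast
  define Z where "Z w = lim (\<lambda>i. w (g (r i)))" for w :: "(real \<Rightarrow> real) \<Rightarrow> real"
  have [measurable]: "Z \<in> borel_measurable P" unfolding Z_def by measurable
  have Z: "AE w in P. (\<lambda>i. w (g (r i))) \<longlonglongrightarrow> Z w"
    using r(2) by eventually_elim (simp add: Z_def Cauchy_convergent_iff convergent_LIMSEQ_iff)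
  have "gaussian_for u Z"
    unfolding gaussian_for_def
  proof (intro conjI ballI allI)
    fix h s and j :: nat assume h: "h \<in> schwartz"
    have [measurable]: "(\<lambda>w. w h) \<in> borel_measurable P" using h by (rule eval_measurable)
    have "(\<lambda>i. LINT w|P. cos (w h + s * w (g (r i)) + real j * (pi/2))) \<longlonglongrightarrow> (LINT w|P. cosj j (w h + s * Z w))"
    proof (rule integral_dominated_convergence[where w = "\<lambda>_. 1"])
      show "AE w in P. (\<lambda>i. cos (w h + s * w (g (r i)) + real j * (pi/2))) \<longlonglongrightarrow> cosj j (w h + s * Z w)"
        using Z by eventually_elim (intro tendsto_intros)
    qed auto
    moreover have "(\<lambda>i. LINT w|P. cos (w h + s * w (g (r i)) + real j * (pi/2))) \<longlonglongrightarrow>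
      cos (real j * (pi/2)) * exp (- (ip h h + 2 * s * ip h u + s\<^sup>2 * ip u u) / 2)"
      unfolding expectation_cos_eval_lincomb[OF h g]
      using LIMSEQ_subseq_LIMSEQ[OF ip_tendsto(1)[OF u gf lim schwartz_theta_fin[OF h]] r(1)]
        LIMSEQ_subseq_LIMSEQ[OF ip_tendsto(2)[OF u gf lim] r(1)]
      by (intro tendsto_intros) (auto simp: o_def)
    ultimately show "(LINT w|P. cosj j (w h + s * Z w)) =
        cos (real j * (pi/2)) * exp (- (ip h h + 2 * s * ip h u + s\<^sup>2 * ip u u) / 2)"
      by (rule LIMSEQ_unique)
  qed simp
  thus ?thesis by blast
qed

end

section \<open>Iterated integrals\<close>

text \<open>As \<open>k\<close> is merely integrable, the power rule is obtained from Fubini: the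
  triangle v \<le> r \<le> t is integrated in both orders. Both contain the unknown integral, and
  the resulting linear equation is solved for it.\<close>

lemma integral_indefinite_power:
  fixes k :: "real \<Rightarrow> real"
  assumes k: "integrable lborel k"
  defines "K \<equiv> \<lambda>r. LINT x|lborel. indicator {0..r} x * k x"
  shows "(LINT r|lborel. indicator {0..t} r * (k r * K r ^ n)) = K t ^ Suc n / real (Suc n)"
proof -
  have [measurable]: "k \<in> borel_measurable borel" using borel_measurable_integrable[OF k] by simp
  have [measurable]: "(\<lambda>(r::real, x). indicator {0..r} x :: real) \<in> borel_measurable (borel \<Otimes>\<^sub>M borel)"
    unfolding indicator_def atLeastAtMost_iff by measurable
  have Km[measurable]: "K \<in> borel_measurable borel"
    unfolding K_def by measurable
  define B where "B = (LINT x|lborel. \<bar>k x\<bar>)"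
  have ik: "integrable lborel (\<lambda>x. indicator {0..r} x * k x)" for r
  proof (rule Bochner_Integration.integrable_bound[OF k])
    show "AE x in lborel. norm (indicator {0..r} x * k x) \<le> norm (k x)" by (rule AE_I2) (auto simp: indicator_def)
  qed measurable
  have KB: "\<bar>K r\<bar> \<le> B" for r
    unfolding K_def B_def
  proof (rule order_trans[OF integral_abs_bound integral_mono])
    show "integrable lborel (\<lambda>x. \<bar>indicator {0..r} x * k x\<bar>)" using ik by (rule integrable_abs)
    show "integrable lborel (\<lambda>x. \<bar>k x\<bar>)" using k by (rule integrable_abs)
    show "\<bar>indicator {0..r} x * k x\<bar> \<le> \<bar>k x\<bar>" for x by (auto simp: indicator_def)
  qed
  have ikK: "integrable lborel (\<lambda>v. k v * K v ^ n)" for n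
  proof (rule Bochner_Integration.integrable_bound)
    show "integrable lborel (\<lambda>v. B ^ n * k v)" using k by simp
    show "AE v in lborel. norm (k v * K v ^ n) \<le> norm (B ^ n * k v)"
    proof (rule AE_I2)
      fix v
      have "\<bar>k v\<bar> * \<bar>K v\<bar> ^ n \<le> \<bar>k v\<bar> * \<bar>B\<bar> ^ n"
        using KB[of v] by (intro mult_left_mono power_mono) auto
      thus "norm (k v * K v ^ n) \<le> norm (B ^ n * k v)" by (simp add: abs_mult power_abs mult.commute)
    qed
  qed measurable
  show ?thesis
  proof (induction n arbitrary: t)
    case (Suc n)
    define c where "c v = k v * K v ^ n" for v
    have c: "integrable lborel c" unfolding c_def by (rule ikK)
    have [measurable]: "c \<in> borel_measurable borel" unfolding c_def by measurable
    define f where "f r v = indicator {0..t} r * k r * (indicator {0..r} v * c v)" for r v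
    have f0: "integrable lborel2 (\<lambda>(r, v). k r * c v)"
    proof (rule lborel_pair.Fubini_integrable)
      have e: "(LINT v|lborel. norm ((\<lambda>(r, v). k r * c v) (r, v))) = \<bar>k r\<bar> * (LINT v|lborel. \<bar>c v\<bar>)" for r
        by (simp add: abs_mult)
      show "integrable lborel (\<lambda>r. LINT v|lborel. norm ((\<lambda>(r, v). k r * c v) (r, v)))"
        unfolding e using k by (intro integrable_mult_left integrable_abs)
      show "AE r in lborel. integrable lborel (\<lambda>v. (\<lambda>(r, v). k r * c v) (r, v))"
        using c by (intro AE_I2) simp
    qed measurable
    have f: "integrable lborel2 (case_prod f)"
    proof (rule Bochner_Integration.integrable_bound[OF f0])
      show "case_prod f \<in> borel_measurable lborel2" unfolding f_def by measurable
      show "AE p in lborel2. norm (case_prod f p) \<le> norm ((\<lambda>(r, v). k r * c v) p)"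
        by (rule AE_I2) (auto simp: f_def indicator_def)
    qed
    let ?J = "LINT r|lborel. indicator {0..t} r * (k r * K r ^ Suc n)"
    have "(LINT r|lborel. LINT v|lborel. f r v) = (LINT r|lborel. indicator {0..t} r * (k r * K r ^ Suc n) / real (Suc n))"
    proof (rule Bochner_Integration.integral_cong[OF refl])
      fix r
      have "(LINT v|lborel. f r v) = indicator {0..t} r * k r * (LINT v|lborel. indicator {0..r} v * c v)"
        unfolding f_def by (rule integral_mult_right_zero)
      also have "(LINT v|lborel. indicator {0..r} v * c v) = K r ^ Suc n / real (Suc n)"
        unfolding c_def by (rule Suc.IH)
      finally show "(LINT v|lborel. f r v) = indicator {0..t} r * (k r * K r ^ Suc n) / real (Suc n)" by simp
    qed
    hence 1: "(LINT r|lborel. LINT v|lborel. f r v) = ?J / real (Suc n)"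
      by (simp only: integral_divide_zero)
    have "(LINT v|lborel. LINT r|lborel. f r v) = (LINT v|lborel. K t * (indicator {0..t} v * c v) - indicator {0..t} v * (k v * K v ^ Suc n))"
    proof (rule Bochner_Integration.integral_cong[OF refl])
      fix v :: real
      have "(LINT r|lborel. f r v) = (LINT r|lborel. indicator {0..t} v * c v * (indicator {0..t} r * k r - indicator {0..v} r * k r))"
      proof (rule integral_cong_AE)
        show "(\<lambda>r. f r v) \<in> borel_measurable lborel" unfolding f_def by measurable
        show "AE r in lborel. f r v = indicator {0..t} v * c v * (indicator {0..t} r * k r - indicator {0..v} r * k r)"
          \<comment> \<open>The two integrands describe a half-open and a closed interval and differ
            only at r = v.\<close>
          using AE_lborel_singleton[of v] by eventually_elim (auto simp: f_def indicator_def)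
      qed measurable
      also have "\<dots> = indicator {0..t} v * c v * (K t - K v)"
        unfolding integral_mult_right_zero K_def using ik by simp
      finally show "(LINT r|lborel. f r v) = K t * (indicator {0..t} v * c v) - indicator {0..t} v * (k v * K v ^ Suc n)"
        by (simp add: c_def algebra_simps)
    qed
    also have "\<dots> = K t * (LINT v|lborel. indicator {0..t} v * c v) - ?J"
    proof -
      have ind: "integrable lborel (\<lambda>v. indicator {0..t} v * w v)" if w: "integrable lborel w" for w :: "real \<Rightarrow> real"
      proof (rule Bochner_Integration.integrable_bound[OF w])
        have [measurable]: "w \<in> borel_measurable borel" using borel_measurable_integrable[OF w] by simp
        show "(\<lambda>v. indicator {0..t} v * w v) \<in> borel_measurable lborel" by measurable
        show "AE x in lborel. norm (indicator {0..t} x * w x) \<le> norm (w x)" by (rule AE_I2) (auto simp: indicator_def)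
      qed
      show ?thesis
        using ind[OF c] ind[OF ikK[of "Suc n"]] by (simp only: Bochner_Integration.integral_diff integrable_mult_right integral_mult_right_zero)
    qed
    also have "(LINT v|lborel. indicator {0..t} v * c v) = K t ^ Suc n / real (Suc n)"
      unfolding c_def by (rule Suc.IH)
    finally have "?J / real (Suc n) = K t * (K t ^ Suc n / real (Suc n)) - ?J"
      using lborel_pair.Fubini_integral[OF f] 1 by simp
    hence "?J = (K t * K t ^ Suc n) - real (Suc n) * ?J" by (simp only: field_simps) (simp add: field_simps)
    hence "real (Suc (Suc n)) * ?J = K t ^ Suc (Suc n)" by (simp add: algebra_simps)
    thus ?case by (simp only: field_simps)
  qed (simp add: K_def)
qed

lemma cos_deriv_shift: "deriv (\<lambda>r. cosj j r) y = cosj (Suc j) y"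
proof (rule DERIV_imp_deriv)
  have "((\<lambda>r. cosj j r) has_field_derivative - sin (y + real j * (pi/2))) (at y)"
    by (auto intro!: derivative_eq_intros)
  also have "- sin (y + real j * (pi/2)) = cos (y + real j * (pi/2) + pi/2)" by (simp add: cos_add)
  also have "y + real j * (pi/2) + pi/2 = y + real (Suc j) * (pi/2)" by (simp add: algebra_simps)
  finally show "((\<lambda>r. cosj j r) has_field_derivative cosj (Suc j) y) (at y)" .
qed

lemma partial_deriv_cos: "partial_deriv 0 (\<lambda>x. cosj j (x 0)) = (\<lambda>x. cosj (Suc j) (x 0))"
  by (rule ext) (simp only: partial_deriv_def fun_upd_same cos_deriv_shift)

text \<open>With one coordinate, a list of partial derivatives only shifts \<open>j\<close> by its
  length.\<close>

lemma smooth_bounded_cos: "smooth_bounded 1 (\<lambda>x. cosj j (x 0))"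
proof -
  have "fold partial_deriv is (\<lambda>x. cosj j (x 0)) = (\<lambda>x. cos (x 0 + real (j + length is) * (pi/2)))"
    if "set is \<subseteq> {..<1}" for "is" j using that
  proof (induction "is" arbitrary: j)
    case (Cons i "is")
    hence i: "i = 0" and s: "set is \<subseteq> {..<1}" by auto
    show ?case unfolding fold_simps i partial_deriv_cos Cons.IH[OF s] by simp
  qed simp
  moreover have "bounded (range (\<lambda>x::nat \<Rightarrow> real. cos (x 0 + c)))" for c
    unfolding bounded_iff by (intro exI[of _ 1]) auto
  moreover have "(\<lambda>r. cos ((x(i := r)) 0 + c)) differentiable (at (x i))" if "i < 1" for i c and x :: "nat \<Rightarrow> real"
    unfolding real_differentiable_def using that by (intro exI) (auto intro!: derivative_eq_intros)
  ultimately show ?thesis unfolding smooth_bounded_def by simp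
qed

section \<open>Mean square limits\<close>

lemma L2_Cauchy_Schwarz:
  fixes X Y :: "'a \<Rightarrow> real"
  assumes X: "X \<in> L2_fun M" and Y: "Y \<in> L2_fun M"
  shows "integrable M (\<lambda>x. X x * Y x)"
    and "(LINT x|M. X x * Y x)\<^sup>2 \<le> (LINT x|M. (X x)\<^sup>2) * (LINT x|M. (Y x)\<^sup>2)"
proof -
  have [measurable]: "X \<in> borel_measurable M" "Y \<in> borel_measurable M" using X Y by (auto simp: L2_fun_def)
  have i: "integrable M (\<lambda>x. (X x)\<^sup>2)" "integrable M (\<lambda>x. (Y x)\<^sup>2)" using X Y by (auto simp: L2_fun_def)
  show XY: "integrable M (\<lambda>x. X x * Y x)"
  proof (rule Bochner_Integration.integrable_bound[OF Bochner_Integration.integrable_add[OF i]])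
    show "AE x in M. norm (X x * Y x) \<le> norm ((X x)\<^sup>2 + (Y x)\<^sup>2)"
    proof (rule AE_I2)
      fix x
      have "2 * \<bar>X x\<bar> * \<bar>Y x\<bar> \<le> (X x)\<^sup>2 + (Y x)\<^sup>2" using sum_squares_bound[of "\<bar>X x\<bar>" "\<bar>Y x\<bar>"] by simp
      moreover have "0 \<le> \<bar>X x\<bar> * \<bar>Y x\<bar>" by simp
      ultimately have "\<bar>X x\<bar> * \<bar>Y x\<bar> \<le> (X x)\<^sup>2 + (Y x)\<^sup>2" by linarith
      thus "norm (X x * Y x) \<le> norm ((X x)\<^sup>2 + (Y x)\<^sup>2)" by (simp add: abs_mult)
    qed
  qed measurable
  show "(LINT x|M. X x * Y x)\<^sup>2 \<le> (LINT x|M. (X x)\<^sup>2) * (LINT x|M. (Y x)\<^sup>2)"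
  proof (rule discriminant_le_of_nonneg)
    fix a b :: real
    have "0 \<le> (LINT x|M. (a * X x + b * Y x)\<^sup>2)" by simp
    also have "\<dots> = (LINT x|M. a\<^sup>2 * (X x)\<^sup>2 + 2 * a * b * (X x * Y x) + b\<^sup>2 * (Y x)\<^sup>2)"
      by (intro Bochner_Integration.integral_cong) (auto simp: power2_eq_square algebra_simps)
    also have "\<dots> = a\<^sup>2 * (LINT x|M. (X x)\<^sup>2) + 2 * a * b * (LINT x|M. X x * Y x) + b\<^sup>2 * (LINT x|M. (Y x)\<^sup>2)"
      using i XY by (simp only: Bochner_Integration.integral_add integrable_mult_right integral_mult_right_zero Bochner_Integration.integrable_add)
    finally show "0 \<le> a\<^sup>2 * (LINT x|M. (X x)\<^sup>2) + 2 * a * b * (LINT x|M. X x * Y x) + b\<^sup>2 * (LINT x|M. (Y x)\<^sup>2)" .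
  qed
qed

lemma L2_fun_diff:
  assumes X: "X \<in> L2_fun M" and Y: "Y \<in> L2_fun M"
  shows "(\<lambda>x. X x - Y x) \<in> L2_fun M"
proof -
  have [measurable]: "X \<in> borel_measurable M" "Y \<in> borel_measurable M" using X Y by (auto simp: L2_fun_def)
  have "integrable M (\<lambda>x. (X x)\<^sup>2 - 2 * (X x * Y x) + (Y x)\<^sup>2)"
    using X Y L2_Cauchy_Schwarz(1)[OF X Y]
    by (intro Bochner_Integration.integrable_add Bochner_Integration.integrable_diff integrable_mult_right) (auto simp: L2_fun_def)
  thus ?thesis by (auto simp: L2_fun_def power2_diff algebra_simps)
qed

lemma L2_tendsto_norm:
  assumes L: "L2_tendsto M Z Y"
  shows "(\<lambda>k. LINT x|M. (Z k x)\<^sup>2) \<longlonglongrightarrow> (LINT x|M. (Y x)\<^sup>2)"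
proof -
  have Z: "Z k \<in> L2_fun M" and Y: "Y \<in> L2_fun M" and lim: "(\<lambda>k. LINT x|M. (Z k x - Y x)\<^sup>2) \<longlonglongrightarrow> 0" for k
    using L by (auto simp: L2_tendsto_def)
  define D where "D k x = Z k x - Y x" for k x
  have D: "D k \<in> L2_fun M" for k unfolding D_def using Z Y by (rule L2_fun_diff)
  note YD = L2_Cauchy_Schwarz[OF Y D]
  have 0: "(\<lambda>k. LINT x|M. Y x * D k x) \<longlonglongrightarrow> 0"
  proof (rule Lim_null_comparison)
    have "\<bar>LINT x|M. Y x * D k x\<bar> \<le> sqrt ((LINT x|M. (Y x)\<^sup>2) * (LINT x|M. (D k x)\<^sup>2))" for k
      using YD(2)[of k] by (intro real_le_rsqrt) simp
    thus "\<forall>\<^sub>F k in sequentially. norm (LINT x|M. Y x * D k x) \<le> sqrt ((LINT x|M. (Y x)\<^sup>2) * (LINT x|M. (D k x)\<^sup>2))" by simp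
    show "(\<lambda>k. sqrt ((LINT x|M. (Y x)\<^sup>2) * (LINT x|M. (D k x)\<^sup>2))) \<longlonglongrightarrow> 0"
      using tendsto_real_sqrt[OF tendsto_mult_left[OF lim, of "LINT x|M. (Y x)\<^sup>2"]] by (simp add: D_def)
  qed
  have e: "(LINT x|M. (Z k x)\<^sup>2) = (LINT x|M. (Y x)\<^sup>2) + 2 * (LINT x|M. Y x * D k x) + (LINT x|M. (D k x)\<^sup>2)" for k
  proof -
    have "(LINT x|M. (Z k x)\<^sup>2) = (LINT x|M. (Y x)\<^sup>2 + 2 * (Y x * D k x) + (D k x)\<^sup>2)"
      by (intro Bochner_Integration.integral_cong) (auto simp: D_def power2_eq_square algebra_simps)
    moreover have "integrable M (\<lambda>x. (Y x)\<^sup>2)" "integrable M (\<lambda>x. (D k x)\<^sup>2)" using Y D by (auto simp: L2_fun_def)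
    ultimately show ?thesis
      using YD(1)[of k] by (simp only: Bochner_Integration.integral_add integrable_mult_right integral_mult_right_zero Bochner_Integration.integrable_add)
  qed
  have "(\<lambda>k. (LINT x|M. (Y x)\<^sup>2) + 2 * (LINT x|M. Y x * D k x) + (LINT x|M. (D k x)\<^sup>2)) \<longlonglongrightarrow> (LINT x|M. (Y x)\<^sup>2) + 2 * 0 + 0"
    using lim unfolding D_def[symmetric] by (intro tendsto_intros 0)
  thus ?thesis unfolding e by simp
qed

lemma L2_tendsto_subseq: "L2_tendsto M Z Y \<Longrightarrow> strict_mono r \<Longrightarrow> L2_tendsto M (\<lambda>k. Z (r k)) Y"
  unfolding L2_tendsto_def using LIMSEQ_subseq_LIMSEQ by (fastforce simp: o_def)

text \<open>Mean square convergence is L1 convergence of the squared differences, to which the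
  subsequence theorem for L1 applies.\<close>

lemma L2_tendsto_AE_subseq:
  assumes L: "L2_tendsto M Z Y"
  obtains r :: "nat \<Rightarrow> nat" where "strict_mono r" "AE x in M. (\<lambda>k. Z (r k) x) \<longlonglongrightarrow> Y x"
proof -
  have Z: "Z k \<in> L2_fun M" and Y: "Y \<in> L2_fun M" and lim: "(\<lambda>k. LINT x|M. (Z k x - Y x)\<^sup>2) \<longlonglongrightarrow> 0" for k
    using L by (auto simp: L2_tendsto_def)
  have "integrable M (\<lambda>x. (Z k x - Y x)\<^sup>2)" for k using L2_fun_diff[OF Z Y] by (simp add: L2_fun_def)
  moreover have "(\<lambda>k. LINT x|M. norm ((Z k x - Y x)\<^sup>2)) \<longlonglongrightarrow> 0" using lim by simp
  ultimately obtain r :: "nat \<Rightarrow> nat" where r: "strict_mono r" "AE x in M. (\<lambda>k. (Z (r k) x - Y x)\<^sup>2) \<longlonglongrightarrow> 0"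
    using tendsto_L1_AE_subseq[of M "\<lambda>k x. (Z k x - Y x)\<^sup>2"] by blast
  have "AE x in M. (\<lambda>k. Z (r k) x) \<longlonglongrightarrow> Y x"
    using r(2)
  proof eventually_elim
    case (elim x)
    have "(\<lambda>k. \<bar>Z (r k) x - Y x\<bar>) \<longlonglongrightarrow> 0" using tendsto_real_sqrt[OF elim] by simp
    thus ?case by (simp add: tendsto_rabs_zero_iff LIM_zero_iff)
  qed
  with r(1) show ?thesis by (rule that)
qed

lemma tendsto_herm:
  assumes "(q \<longlongrightarrow> v) F" "(z \<longlongrightarrow> x) F"
  shows "((\<lambda>k. herm (q k) (z k) n) \<longlongrightarrow> herm v x n) F"
proof (induction n rule: less_induct)
  case (less n)
  consider "n = 0" | "n = 1" | m where "n = Suc (Suc m)" by (metis One_nat_def not0_implies_Suc)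
  thus ?case
  proof cases
    case (3 m)
    thus ?thesis using less.IH[of m] less.IH[of "Suc m"] assms by (auto intro!: tendsto_intros)
  qed (use assms in auto)
qed

section \<open>Iterated integrals tested against cosines\<close>

context white_noise_space
begin

lemma restrict_upto_theta_fin: "h \<in> theta_functions H \<Longrightarrow> restrict_upto t h \<in> theta_fin"
  using theta_functions_indicator[of h "{0..t}"] unfolding restrict_upto_def by simp

lemma ip_restrict_upto_eq:
  assumes "h \<in> theta_functions H"
  shows "theta_inner_on H {0..t} h h = ip (restrict_upto t h) (restrict_upto t h)"
  using theta_inner_on_eq_ip[of "{0..t}" h h] restrict_upto_theta_fin[OF assms, of t] unfolding restrict_upto_def by simp

text \<open>For the cylinder functional cos (\<langle>\<omega>,g\<rangle> + j \<pi>/2) the Malliavin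
  derivative is the next shifted cosine times \<open>g\<close>. Fubini moves the expectation inside
  the double integral, where it meets only the integrand process \<open>Y\<close> and becomes the
  deterministic \<open>m\<close>.\<close>

lemma fwis_integral_cos:
  assumes fw: "fwis_integral H P (\<lambda>w. restrict_upto t (\<lambda>s. Y s w * h s)) Z"
    and g: "g \<in> schwartz"
    and m: "\<And>r. 0 \<le> r \<Longrightarrow> r \<le> t \<Longrightarrow> (LINT w|P. cosj (Suc j) (w g) * Y r w) = m r"
  shows "(LINT w|P. cosj j (w g) * Z w) =
      integral\<^sup>L lborel2 (\<lambda>(s, r). g s * restrict_upto t h r * theta H s r * m r)"
    and "integrable lborel2 (\<lambda>(s, r). g s * restrict_upto t h r * theta H s r * m r)"
proof -
  have Q: "sigma_finite_measure lborel2"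
    unfolding lborel_prod ..
  interpret PQ: pair_sigma_finite P "lborel2"
    using sigma_finite_measure_axioms Q by (rule pair_sigma_finite.intro)
  define U where "U w = restrict_upto t (\<lambda>s. Y s w * h s)" for w
  define c where "c w = cosj (Suc j) (w g)" for w :: "(real \<Rightarrow> real) \<Rightarrow> real"
  define F where "F w s r = c w * g s * U w r * theta H s r" for w s r
  have [measurable]: "g \<in> borel_measurable borel" using g by auto
  have [measurable]: "(\<lambda>w. w g) \<in> borel_measurable P" using g by (rule eval_measurable)
  have [measurable]: "c \<in> borel_measurable P" unfolding c_def by measurable
  have Um[measurable]: "(\<lambda>(w, s). U w s) \<in> borel_measurable (P \<Otimes>\<^sub>M lborel)"
    using fw unfolding fwis_integral_def U_def by blast
  have Us[measurable]: "U w \<in> borel_measurable borel" if "w \<in> space P" for w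
    using measurable_Pair2[OF Um that] by simp
  have Ueq: "indicator {0..} s * U w s = U w s" for w s
    by (auto simp: U_def restrict_upto_def indicator_def)
  have Fm[measurable]: "(\<lambda>(w, p). case p of (s, r) \<Rightarrow> F w s r) \<in> borel_measurable (P \<Otimes>\<^sub>M lborel2)"
    unfolding F_def by measurable
  have fin: "(\<integral>\<^sup>+w. theta_abs (U w) (U w) \<partial>P) < \<infinity>"
  proof -
    have "(\<integral>\<^sup>+w. theta_abs (U w) (U w) \<partial>P)
      = (\<integral>\<^sup>+w. (\<integral>\<^sup>+s\<in>{0..}. (\<integral>\<^sup>+r\<in>{0..}. ennreal (\<bar>U w s\<bar> * \<bar>U w r\<bar> * theta H s r) \<partial>lborel) \<partial>lborel) \<partial>P)"
      unfolding theta_nn_def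
    proof (intro nn_integral_cong)
      fix w s
      have neg: "U w x = 0" if "x < 0" for x using that by (simp add: U_def restrict_upto_def)
      show "(\<integral>\<^sup>+t. ennreal \<bar>U w s\<bar> * ennreal \<bar>U w t\<bar> * ennreal (theta H s t) \<partial>lborel)
        = (\<integral>\<^sup>+r\<in>{0..}. ennreal (\<bar>U w s\<bar> * \<bar>U w r\<bar> * theta H s r) \<partial>lborel) * indicator {0..} s"
      proof (cases "0 \<le> s")
        case True
        have "ennreal \<bar>U w s\<bar> * ennreal \<bar>U w r\<bar> * ennreal (theta H s r) = ennreal (\<bar>U w s\<bar> * \<bar>U w r\<bar> * theta H s r) * indicator {0..} r" for r
          using neg[of r] theta_nonneg by (cases "0 \<le> r") (auto simp: ennreal_mult)
        thus ?thesis using True by simp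
      qed (simp add: neg)
    qed
    also have "\<dots> < \<infinity>" using fw unfolding fwis_integral_def U_def by blast
    finally show ?thesis .
  qed
  \<comment> \<open>The cosine is at most 1 in absolute value and the form of |g| and |U w| is
    bounded by the sum of their squares; the first is constant and the second has finite expectation
    by the domain condition of the integral.\<close>
  have Fint: "integrable (P \<Otimes>\<^sub>M lborel2) (\<lambda>(w, p). case p of (s, r) \<Rightarrow> F w s r)"
  proof (rule integrableI_bounded)
    let ?N = "\<lambda>w. theta_abs (U w) (U w)"
    let ?G = "theta_abs g g"
    have Nm[measurable]: "?N \<in> borel_measurable P" unfolding theta_nn_def by measurable
    have "(\<integral>\<^sup>+x. ennreal (norm ((\<lambda>(w, p). case p of (s, r) \<Rightarrow> F w s r) x)) \<partial>(P \<Otimes>\<^sub>M lborel2))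
      = (\<integral>\<^sup>+w. \<integral>\<^sup>+p. ennreal (norm (case p of (s, r) \<Rightarrow> F w s r)) \<partial>lborel2 \<partial>P)"
      by (subst sigma_finite_measure.nn_integral_fst[OF Q, symmetric]) auto
    also have "\<dots> \<le> (\<integral>\<^sup>+w. ?G + ?N w \<partial>P)"
    proof (rule nn_integral_mono)
      fix w assume w: "w \<in> space P"
      have [measurable]: "U w \<in> borel_measurable borel" using w by (rule Us)
      have "(\<integral>\<^sup>+p. ennreal (norm (case p of (s, r) \<Rightarrow> F w s r)) \<partial>lborel2)
        \<le> (\<integral>\<^sup>+p. ennreal (norm ((\<lambda>(s, r). g s * U w r * theta H s r) p)) \<partial>lborel2)"
      proof (intro nn_integral_mono ennreal_leI)
        fix p :: "real \<times> real"
        have "\<bar>c w\<bar> \<le> 1" by (simp add: c_def)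
        hence "\<bar>c w\<bar> * \<bar>g s * U w r * theta H s r\<bar> \<le> 1 * \<bar>g s * U w r * theta H s r\<bar>" for s r
          by (rule mult_right_mono) simp
        thus "norm (case p of (s, r) \<Rightarrow> F w s r) \<le> norm ((\<lambda>(s, r). g s * U w r * theta H s r) p)"
          by (simp add: F_def abs_mult mult.assoc split: prod.split)
      qed
      also have "\<dots> = theta_abs g (U w)"
        by (rule theta_nn_abs) measurable
      also have "\<dots> \<le> 2 * theta_abs g (U w)"
        by (simp add: mult_2 add_increasing2)
      also have "\<dots> \<le> ?G + ?N w" by (rule theta_nn_amgm) measurable
      finally show "(\<integral>\<^sup>+p. ennreal (norm (case p of (s, r) \<Rightarrow> F w s r)) \<partial>lborel2) \<le> ?G + ?N w" .
    qed
    also have "\<dots> = ?G + (\<integral>\<^sup>+w. ?N w \<partial>P)"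
      by (subst nn_integral_add) (auto simp: emeasure_space_1)
    also have "\<dots> < \<infinity>" using fin schwartz_theta_fin[OF g] by (simp add: theta_fin_def)
    finally show "(\<integral>\<^sup>+x. ennreal (norm ((\<lambda>(w, p). case p of (s, r) \<Rightarrow> F w s r) x)) \<partial>(P \<Otimes>\<^sub>M lborel2)) < \<infinity>" .
  qed measurable
  have inner: "(LINT w|P. (case p of (s, r) \<Rightarrow> F w s r)) = (\<lambda>(s, r). g s * restrict_upto t h r * theta H s r * m r) p" for p
  proof (cases p)
    case (Pair s r)
    show ?thesis
    proof (cases "r \<in> {0..t}")
      case True
      have "(LINT w|P. F w s r) = (LINT w|P. (g s * h r * theta H s r) * (c w * Y r w))"
        by (intro Bochner_Integration.integral_cong) (use True in \<open>auto simp: F_def U_def restrict_upto_def mult_ac\<close>)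
      also have "\<dots> = g s * h r * theta H s r * m r"
        unfolding integral_mult_right_zero c_def using True m[of r] by simp
      finally show ?thesis using True Pair by (simp add: restrict_upto_def)
    qed (simp add: Pair F_def U_def restrict_upto_def)
  qed
  have "(LINT w|P. cylinder (\<lambda>x. cosj j (x 0)) (\<lambda>_. g) w * Z w)
      = (LINT w|P. theta_inner H (malliavin_deriv 1 (\<lambda>x. cosj j (x 0)) (\<lambda>_. g) w) (U w))"
    unfolding U_def
    by (rule fw[unfolded fwis_integral_def, THEN conjunct2, THEN conjunct2, THEN conjunct2, rule_format, OF smooth_bounded_cos]) (rule g)
  hence "(LINT w|P. cosj j (w g) * Z w)
      = (LINT w|P. theta_inner H (malliavin_deriv 1 (\<lambda>x. cosj j (x 0)) (\<lambda>_. g) w) (U w))"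
    by (simp only: cylinder_def)
  also have "\<dots> = (LINT w|P. LINT s|lborel. LINT r|lborel. F w s r)"
  proof (rule Bochner_Integration.integral_cong[OF refl])
    fix w
    have md: "malliavin_deriv 1 (\<lambda>x. cosj j (x 0)) (\<lambda>_. g) w = (\<lambda>s. c w * g s)"
      unfolding malliavin_deriv_def c_def by (simp add: partial_deriv_cos del: of_nat_Suc times_divide_eq_right) simp
    have "indicator {0..} s *\<^sub>R (indicator {0..} r *\<^sub>R (c w * g s * U w r * theta H s r)) = F w s r" for s r
      using schwartz_neg[OF g, of s] by (auto simp: F_def U_def restrict_upto_def indicator_def)
    hence "indicator {0..} s *\<^sub>R (LINT r|lborel. indicator {0..} r *\<^sub>R (c w * g s * U w r * theta H s r)) = (LINT r|lborel. F w s r)" for s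
      unfolding integral_scaleR_right[symmetric] by simp
    thus "theta_inner H (malliavin_deriv 1 (\<lambda>x. cosj j (x 0)) (\<lambda>_. g) w) (U w) = (LINT s|lborel. LINT r|lborel. F w s r)"
      unfolding theta_inner_on_def set_lebesgue_integral_def md by simp
  qed
  also have "\<dots> = (LINT w|P. integral\<^sup>L lborel2 (\<lambda>(s, r). F w s r))"
  proof (rule integral_cong_AE)
    show "AE w in P. (LINT s|lborel. LINT r|lborel. F w s r) = integral\<^sup>L lborel2 (\<lambda>(s, r). F w s r)"
      using PQ.AE_integrable_fst[OF Fint] by eventually_elim (rule lborel_pair.integral_fst)
    show "(\<lambda>w. LINT s|lborel. LINT r|lborel. F w s r) \<in> borel_measurable P"
      unfolding F_def by measurable
    show "(\<lambda>w. integral\<^sup>L lborel2 (\<lambda>(s, r). F w s r)) \<in> borel_measurable P"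
      by measurable
  qed
  also have "\<dots> = (LINT p|lborel2. LINT w|P. (case p of (s, r) \<Rightarrow> F w s r))"
    by (rule PQ.Fubini_integral[OF Fint, symmetric])
  finally show "(LINT w|P. cosj j (w g) * Z w) =
      integral\<^sup>L lborel2 (\<lambda>(s, r). g s * restrict_upto t h r * theta H s r * m r)"
    unfolding inner .
  show "integrable lborel2 (\<lambda>(s, r). g s * restrict_upto t h r * theta H s r * m r)"
    using PQ.integrable_snd[OF Fint] unfolding inner .
qed

text \<open>Each order uses the duality once, so \<open>j\<close> and \<open>t\<close> are general
  in the induction. The lower order expectation at time \<open>r\<close> is a constant times the
  n-th power of \<open>ip g (restrict_upto r h)\<close>, and integrating this power against its own
  density gives the factor 1 / (n + 1).\<close>

lemma iterated_fwis_fun_cos: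
  assumes Y: "iterated_fwis_fun H P h Y" and h: "h \<in> theta_functions H" and g: "g \<in> schwartz" and t: "0 \<le> t"
  shows "(LINT w|P. cosj j (w g) * Y n t w) =
    cos (real (n + j) * (pi/2)) * (ip g (restrict_upto t h) ^ n / fact n) * exp (- ip g g / 2)"
  using t
proof (induction n arbitrary: t j)
  case 0
  have "(LINT w|P. cosj j (w g) * Y 0 t w) = (LINT w|P. cosj j (w g))"
    using Y 0 by (simp add: iterated_fwis_fun_def)
  thus ?case using expectation_cos_eval[OF g] by simp
next
  case (Suc n)
  let ?u = "restrict_upto t h"
  have u: "?u \<in> theta_fin" using h by (rule restrict_upto_theta_fin)
  define D where "D = cos (real (n + Suc j) * (pi/2)) * exp (- ip g g / 2) / fact n"
  have fw: "fwis_integral H P (\<lambda>w. restrict_upto t (\<lambda>s. Y n s w * h s)) (Y (Suc n) t)"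
    using Y Suc.prems by (simp add: iterated_fwis_fun_def)
  have m: "(LINT w|P. cosj (Suc j) (w g) * Y n r w) = D * ip g (restrict_upto r h) ^ n"
    if "0 \<le> r" "r \<le> t" for r
    unfolding Suc.IH[OF that(1)] D_def by simp
  have F: "(LINT w|P. cosj j (w g) * Y (Suc n) t w) =
      integral\<^sup>L lborel2 (\<lambda>(s, r). g s * ?u r * theta H s r * (D * ip g (restrict_upto r h) ^ n))"
    by (rule fwis_integral_cos(1)[OF fw g]) (rule m)
  have Fi: "integrable lborel2 (\<lambda>(s, r). g s * ?u r * theta H s r * (D * ip g (restrict_upto r h) ^ n))"
    by (rule fwis_integral_cos(2)[OF fw g]) (rule m)
  \<comment> \<open>The density in time of \<open>r \<mapsto> ip g (restrict_upto r h)\<close>,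
    obtained by integrating out the variable of \<open>g\<close>.\<close>
  define k where "k r = (LINT s|lborel. g s * ?u r * theta H s r)" for r
  define K where "K r = (LINT x|lborel. indicator {0..r} x * k x)" for r
  have k: "integrable lborel k"
    unfolding k_def using integrable_theta[OF schwartz_theta_fin[OF g] u] by (rule lborel_pair.integrable_snd)
  have K: "ip g (restrict_upto r h) = K r" if r: "0 \<le> r" "r \<le> t" for r
  proof -
    have "ip g (restrict_upto r h) = (LINT x|lborel. LINT s|lborel. g s * restrict_upto r h x * theta H s x)"
      unfolding ip_def
      by (rule lborel_pair.integral_snd[symmetric, OF integrable_theta[OF schwartz_theta_fin[OF g] restrict_upto_theta_fin[OF h]]])
    also have "\<dots> = K r"
      unfolding K_def
    proof (rule Bochner_Integration.integral_cong[OF refl])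
      fix x
      have e: "g s * restrict_upto r h x * theta H s x = indicator {0..r} x * (g s * ?u x * theta H s x)" for s
        using r by (auto simp: restrict_upto_def indicator_def)
      show "(LINT s|lborel. g s * restrict_upto r h x * theta H s x) = indicator {0..r} x * k x"
        unfolding e k_def by (rule integral_mult_right_zero)
    qed
    finally show ?thesis .
  qed
  have "(LINT w|P. cosj j (w g) * Y (Suc n) t w) =
      (LINT r|lborel. LINT s|lborel. g s * ?u r * theta H s r * (D * ip g (restrict_upto r h) ^ n))"
    unfolding F by (rule lborel_pair.integral_snd[symmetric, OF Fi])
  also have "\<dots> = (LINT r|lborel. D * (indicator {0..t} r * (k r * K r ^ n)))"
  proof (rule Bochner_Integration.integral_cong[OF refl])
    fix r
    have "(LINT s|lborel. g s * ?u r * theta H s r * (D * ip g (restrict_upto r h) ^ n)) = k r * (D * ip g (restrict_upto r h) ^ n)"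
      unfolding k_def by (rule integral_mult_left_zero)
    also have "\<dots> = D * (indicator {0..t} r * (k r * K r ^ n))"
    proof (cases "r \<in> {0..t}")
      case False
      hence "k r = 0" by (simp add: k_def restrict_upto_def)
      thus ?thesis by simp
    qed (simp add: K)
    finally show "(LINT s|lborel. g s * ?u r * theta H s r * (D * ip g (restrict_upto r h) ^ n)) = D * (indicator {0..t} r * (k r * K r ^ n))" .
  qed
  also have "\<dots> = D * (K t ^ Suc n / real (Suc n))"
    unfolding integral_mult_right_zero K_def using integral_indefinite_power[OF k] by simp
  also have "\<dots> = cos (real (Suc n + j) * (pi/2)) * (ip g ?u ^ Suc n / fact (Suc n)) * exp (- ip g g / 2)"
    using K[OF Suc.prems order_refl] by (simp add: D_def mult_ac)
  finally show ?case .
qed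

text \<open>Iterated integral and Hermite polynomial have equal expectations against all shifted
  cosines, so their difference is \<open>fourier_null\<close>. The auxiliary Gaussian variable is
  then eliminated by the case of order one, where the Hermite polynomial is the variable
  itself.\<close>

lemma iterated_fwis_fun_herm:
  assumes Y: "iterated_fwis_fun H P h Y" and h: "h \<in> theta_functions H" and t: "0 \<le> t"
  defines "q \<equiv> ip (restrict_upto t h) (restrict_upto t h)"
  shows "AE w in P. Y n t w = herm q (Y 1 t w) n / fact n"
    and "(LINT w|P. (Y 1 t w)\<^sup>2) = q"
proof -
  let ?u = "restrict_upto t h"
  have u: "?u \<in> theta_fin" using h by (rule restrict_upto_theta_fin)
  obtain Z where Z: "gaussian_for ?u Z"
    using gaussian_for_exists[OF u, of t] t by (auto simp: restrict_upto_def)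
  note G = gaussian_for_moments[OF Z u]
  have Yi: "integrable P (Y n t)" for n
  proof (cases n)
    case (Suc k)
    have "Y n t \<in> L2_fun P" using Y t Suc by (auto simp: iterated_fwis_fun_def fwis_integral_def)
    hence "Y n t \<in> borel_measurable P" "integrable P (\<lambda>w. (Y n t w)\<^sup>2)" by (simp_all add: L2_fun_def)
    thus ?thesis by (rule square_integrable_imp_integrable)
  next
    case 0
    have "Y 0 t = (\<lambda>_. 1)" using Y t unfolding iterated_fwis_fun_def by blast
    thus ?thesis using 0 by simp
  qed
  have rep: "AE w in P. Y n t w = herm q (Z w) n / fact n" for n
  proof -
    have hi: "integrable P (\<lambda>w. herm q (Z w) n / fact n)"
      using integrable_power_herm[OF G(1), of 0 q n] by simp
    have cos0: "(LINT w|P. cosj j (w g) * (Y n t w - herm q (Z w) n / fact n)) = 0" if g: "g \<in> schwartz" for g j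
    proof -
      have [measurable]: "(\<lambda>w. w g) \<in> borel_measurable P" using g by (rule eval_measurable)
      have i: "integrable P (\<lambda>w. cosj j (w g) * Y n t w)" "integrable P (\<lambda>w. cosj j (w g) * (herm q (Z w) n / fact n))"
        by (rule integrable_cos_mult(1)[OF _ Yi] integrable_cos_mult(1)[OF _ hi]; measurable)+
      have "(LINT w|P. cosj j (w g) * (Y n t w - herm q (Z w) n / fact n))
        = (LINT w|P. cosj j (w g) * Y n t w) - (LINT w|P. cosj j (w g) * (herm q (Z w) n / fact n))"
        unfolding right_diff_distrib using i by (rule Bochner_Integration.integral_diff)
      also have "(LINT w|P. cosj j (w g) * (herm q (Z w) n / fact n))
        = (LINT w|P. cosj j (w g) * herm q (Z w) n) / fact n"
        unfolding times_divide_eq_right by (rule integral_divide_zero)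
      finally show ?thesis
        unfolding iterated_fwis_fun_cos[OF Y h g t] q_def G(2)[OF g] by simp
    qed
    have "fourier_null (\<lambda>w. Y n t w - herm q (Z w) n / fact n)"
      unfolding fourier_null_def
    proof (intro conjI ballI)
      show "integrable P (\<lambda>w. Y n t w - herm q (Z w) n / fact n)" using Yi hi by (rule Bochner_Integration.integrable_diff)
      fix g assume g: "g \<in> schwartz"
      show "(LINT w|P. cos (w g) * (Y n t w - herm q (Z w) n / fact n)) = 0" using cos0[OF g, of 0] by simp
      have "(LINT w|P. - (sin (w g) * (Y n t w - herm q (Z w) n / fact n))) = 0" using cos0[OF g, of 1] by (simp add: cos_add)
      thus "(LINT w|P. sin (w g) * (Y n t w - herm q (Z w) n / fact n)) = 0" by simp
    qed
    from fourier_null_AE_0[OF this] show ?thesis by eventually_elim simp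
  qed
  have one: "AE w in P. Y 1 t w = Z w" using rep[of 1] by simp
  show "AE w in P. Y n t w = herm q (Y 1 t w) n / fact n"
    using rep[of n] one by eventually_elim simp
  have "(LINT w|P. (Y 1 t w)\<^sup>2) = (LINT w|P. (Z w)\<^sup>2)"
  proof (rule integral_cong_AE)
    have "Z \<in> borel_measurable P" using Z by (simp add: gaussian_for_def)
    thus "(\<lambda>w. (Z w)\<^sup>2) \<in> borel_measurable P" by measurable
    have "Y 1 t \<in> borel_measurable P" using Yi[of 1] by (rule borel_measurable_integrable)
    thus "(\<lambda>w. (Y 1 t w)\<^sup>2) \<in> borel_measurable P" by measurable
    show "AE w in P. (Y 1 t w)\<^sup>2 = (Z w)\<^sup>2" using one by eventually_elim simp
  qed
  thus "(LINT w|P. (Y 1 t w)\<^sup>2) = q" unfolding G(3) q_def .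
qed

end

theorem theorem3p3:
  fixes H t :: real
    and P :: "((real \<Rightarrow> real) \<Rightarrow> real) measure"
    and B X :: "real \<Rightarrow> ((real \<Rightarrow> real) \<Rightarrow> real) \<Rightarrow> real"
    and f :: "(nat \<Rightarrow> real \<Rightarrow> real) set"
    and XX :: "nat \<Rightarrow> real \<Rightarrow> ((real \<Rightarrow> real) \<Rightarrow> real) \<Rightarrow> real"
  assumes "1/2 < H" and "H < 1"
    and "white_noise H P"
    and "white_noise_fbm H P B"
    and "f \<in> L2_theta H"
    and "\<And>s. 0 \<le> s \<Longrightarrow> wiener_integral H P f s (X s)"
    and "iterated_fwis H P f XX"
    and "0 \<le> t"
  shows "AE \<omega> in P. limsup (\<lambda>n. ereal (\<bar>Gamma (real n / 2 + 1) * XX n t \<omega>\<bar> powr (2 / real n)))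
           = ereal (1/2 * theta_norm_sq_upto H t f)"
proof -
  interpret white_noise_space H P
    using assms(1-3) by unfold_locales
  note t = \<open>0 \<le> t\<close>
  define l where "l = (LINT w|P. (XX 1 t w)\<^sup>2)"
  have approx: "(\<forall>n. AE w in P. XX n t w = herm l (XX 1 t w) n / fact n)
      \<and> (\<lambda>k. theta_inner_on H {0..t} (F k) (F k)) \<longlonglongrightarrow> l"
    if F: "theta_approximates H F f" for F
  proof -
    obtain Y where Y: "\<And>k. iterated_fwis_fun H P (F k) (Y k)"
      and L: "\<And>n. L2_tendsto P (\<lambda>k. Y k n t) (XX n t)"
      using assms(7) F t unfolding iterated_fwis_def by blast
    have Fh: "F k \<in> theta_functions H" for k using F by (simp add: theta_approximates_def)
    define q where "q k = theta_inner_on H {0..t} (F k) (F k)" for k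
    have q: "q k = ip (restrict_upto t (F k)) (restrict_upto t (F k))" for k
      unfolding q_def by (rule ip_restrict_upto_eq[OF Fh])
    have rep: "AE w in P. Y k n t w = herm (q k) (Y k 1 t w) n / fact n" for k n
      unfolding q by (rule iterated_fwis_fun_herm(1)[OF Y Fh t])
    \<comment> \<open>The truncated squared norm of \<open>F k\<close> is the second moment of its
      first order integral, and second moments are continuous in mean square.\<close>
    have ql: "q \<longlonglongrightarrow> l"
      using L2_tendsto_norm[OF L[of 1]] unfolding iterated_fwis_fun_herm(2)[OF Y Fh t] q[symmetric] l_def .
    have "AE w in P. XX n t w = herm l (XX 1 t w) n / fact n" for n
    proof -
      \<comment> \<open>Almost sure convergence is needed simultaneously for orders 1 and n, hence a
        subsequence of a subsequence.\<close>
      obtain r :: "nat \<Rightarrow> nat" where r: "strict_mono r" "AE w in P. (\<lambda>k. Y (r k) 1 t w) \<longlonglongrightarrow> XX 1 t w"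
        using L2_tendsto_AE_subseq[OF L[of 1]] by blast
      obtain r' :: "nat \<Rightarrow> nat" where r': "strict_mono r'" "AE w in P. (\<lambda>k. Y (r (r' k)) n t w) \<longlonglongrightarrow> XX n t w"
        using L2_tendsto_AE_subseq[OF L2_tendsto_subseq[OF L[of n] r(1)]] by blast
      have "AE w in P. \<forall>k. Y k n t w = herm (q k) (Y k 1 t w) n / fact n"
        unfolding AE_all_countable using rep by blast
      with r(2) r'(2) show ?thesis
      proof eventually_elim
        case (elim w)
        have "(\<lambda>k. herm (q (r (r' k))) (Y (r (r' k)) 1 t w) n / fact n) \<longlonglongrightarrow> herm l (XX 1 t w) n / fact n"
          using LIMSEQ_subseq_LIMSEQ[OF elim(1) r'(1)] LIMSEQ_subseq_LIMSEQ[OF LIMSEQ_subseq_LIMSEQ[OF ql r(1)] r'(1)]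
          by (intro tendsto_divide tendsto_herm tendsto_const) (auto simp: o_def)
        moreover have "(\<lambda>k. herm (q (r (r' k))) (Y (r (r' k)) 1 t w) n / fact n) \<longlonglongrightarrow> XX n t w"
          using elim(2) unfolding elim(3)[rule_format] .
        ultimately show ?case by (rule LIMSEQ_unique[symmetric])
      qed
    qed
    thus ?thesis using ql unfolding q_def by blast
  qed
  \<comment> \<open>A representative of the class approximates \<open>f\<close>; its existence makes
    the description of the norm by a universally quantified limit unique.\<close>
  obtain G where G: "theta_approximates H G f"
  proof -
    obtain G where fG: "f = theta_equiv H `` {G}" and GC: "G \<in> theta_cauchy H"
      using assms(5) unfolding L2_theta_def by (auto elim: quotientE)
    have G0: "theta_norm H (\<lambda>x. G k x - G k x) = 0" for k
      by (simp add: theta_norm_def theta_inner_on_def set_lebesgue_integral_def)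
    have Gf: "G \<in> f" unfolding fG theta_equiv_def using GC G0 by simp
    have "G k \<in> theta_functions H" for k using GC by (intro schwartz_theta_functions) (simp add: theta_cauchy_def)
    hence "theta_approximates H G f"
      unfolding theta_approximates_def using Gf G0 by (intro conjI allI bexI[of _ G]) simp_all
    thus ?thesis by (rule that)
  qed
  have "theta_norm_sq_upto H t f = l"
    unfolding theta_norm_sq_upto_def
  proof (rule the_equality)
    show "\<forall>F. theta_approximates H F f \<longrightarrow> (\<lambda>k. theta_inner_on H {0..t} (F k) (F k)) \<longlonglongrightarrow> l"
      using approx by blast
    fix l' assume "\<forall>F. theta_approximates H F f \<longrightarrow> (\<lambda>k. theta_inner_on H {0..t} (F k) (F k)) \<longlonglongrightarrow> l'"
    thus "l' = l" using G approx[OF G] LIMSEQ_unique by blast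
  qed
  note lnorm = this
  have l0: "0 \<le> l" unfolding l_def by simp
  \<comment> \<open>Countably many null sets are discarded. Outside them the whole sequence consists
    of Hermite values at one real point, so the limsup is deterministic.\<close>
  have "AE w in P. \<forall>n. XX n t w = herm l (XX 1 t w) n / fact n"
    unfolding AE_all_countable using approx[OF G] by blast
  thus ?thesis
  proof eventually_elim
    case (elim w)
    define x where "x = XX 1 t w"
    have "XX n t w = herm l x n / fact n" for n using elim unfolding x_def by blast
    thus ?case using limsup_herm[OF l0, of x] by (simp add: lnorm)
  qed
qed

end
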